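(* Let $M$ be a hypersurface of a six-dimensional strict nearly Kähler manifold $(\tilde M,g,J)$ of constant type equal to one, with unit normal vector field $N$, shape operator $S$ and almost contact structure $(\xi,\phi)$, where $\xi=-JN$ and $\phi=a\phi_1+b\phi_2+c\phi_3$ with $a,b,c\in C^\infty(M)$, $a^2+b^2+c^2=1$. Here $\eta=g(\xi,\cdot)$, $G=\tilde\nabla J$, $\phi_1=J-\eta\otimes N$, $\phi_2=G(\xi,\cdot)$ and $\phi_3=G(N,\cdot)=\phi_2\phi_1$. Then the following statements hold. (1) $(M,g,\xi,\phi)$ is Sasakian if and only if $S=0$ and $\phi=\phi_3$. (2) $(M,g,\xi,\phi)$ is never co-Kähler. (3) If $(M,g,\xi,\phi)$ is nearly Sasakian, then $M$ is $\eta$-quasi-umbilical and belongs to one of the following families: (a) $S=\mathrm{Id}+(\lambda-1)\,\eta\otimes\xi$, $\lambda\in\mathbb R$, and $\phi=\phi_1$; (b) $S=\lambda\,\mathrm{Id}$, $\lambda\in\mathbb R$, and $\phi=\phi_3$; (c) $S=\sec(t)\,\mathrm{Id}$ and $\phi=\cos t\,\phi_1+\sin t\,\phi_2$, for a constant $t\in\mathbb R$; (d) $S=\frac{1-c}{a}\,\mathrm{Id}+\frac1c\,\xi(b)\,\eta\otimes\xi$, where $a,c\neq0$, $a$ is constant, and $X(b)=X(c)=0$ for any $X\in\ker\eta$. (4) If $(M,g,\xi,\phi)$ is nearly cosymplectic, then $M$ is $\eta$-quasi-umbilical and belongs to one of the following families: (a) $S=\lambda\,\mathrm{Id}$, $\lambda\in\mathbb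 R$, and $\phi=\phi_2$; (b) $S=\lambda\,\eta\otimes\xi$, $\lambda\in\mathbb R$, and $\phi=\phi_1$; (c) $S=0$ and $\phi=\cos t\,\phi_1+\sin t\,\phi_2$, for a constant $t\in\mathbb R$; (d) $S=-\frac ca\,\mathrm{Id}+\frac1c\,\xi(b)\,\eta\otimes\xi$, where $a,c\neq0$, $a$ is constant, and $X(b)=X(c)=0$ for any $X\in\ker\eta$.
   Context: A nearly Kähler manifold is an almost Hermitian manifold $(\tilde M,g,J)$ such that $G=\tilde\nabla J$, $G(X,Y)=(\tilde\nabla_XJ)Y$, is skew-symmetric, where $\tilde\nabla$ is the Levi-Civita connection; it is strict if $G$ is non-degenerate (i.e. $G(X,\cdot)=0$ implies $X=0$). In dimension six, constant type equal to one means $\|G(X,Y)\|^2=g(X,X)g(Y,Y)-g(X,Y)^2-g(JX,Y)^2$ for all $X,Y$ (equivalently, $\tilde M$ is Einstein with Einstein constant $5$). A hypersurface is an isometrically immersed submanifold $M$ of codimension one with Levi-Civita connection $\nabla$ and unit normal $N$; its second fundamental form $h$ and shape operator $S$ are defined by $\tilde\nabla_XY=\nabla_XY+h(X,Y)N$, $\tilde\nabla_XN=-SX$, so $h(X,Y)=g(SX,Y)$. It is $\eta$-quasi-umbilical if $h=\alpha g+\beta\,\eta\otimes\eta$ for some $\alpha,\beta\in C^\infty(M)$. The notation $\eta\otimes\xi$ denotes the endomorphism $X\mapsto\eta(X)\xi$ of $TM$. An almost contact (metric) structure on an odd-dimensional Riemannian manifold $(M,g)$ consists of a unit vector field $\xi$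 (the Reeb vector field), its dual one-form $\eta=g(\xi,\cdot)$ and a $(1,1)$-tensor $\varphi$ with $g(\varphi X,\varphi Y)=g(X,Y)-\eta(X)\eta(Y)$ and $\varphi^2=-\mathrm{Id}+\eta\otimes\xi$. On a hypersurface $M$, with unit normal vector field $N$, of a six-dimensional strict nearly Kähler manifold $(\tilde M,g,J)$ of constant type equal to one, put $\xi=-JN$, $\eta=g(\xi,\cdot)$, $\phi_1=J-\eta\otimes N$, $\phi_2=G(\xi,\cdot)$ and $\phi_3=G(N,\cdot)$; then the tensors $\phi_1,\phi_2,\phi_3$ restricted to $TM$ are endomorphisms of $TM$, and each, and more generally each $\phi=a\phi_1+b\phi_2+c\phi_3$ with $a^2+b^2+c^2=1$, defines an almost contact structure with Reeb vector field $\xi=-JN$. An almost contact manifold $(M,g,\xi,\varphi)$ is called, where the conditions are for all vector fields $X,Y$ on $M$: - Sasakian if $(\nabla_X\varphi)Y=\eta(Y)X-g(X,Y)\xi$; - co-Kähler if $\nabla\varphi=0$; - nearly Sasakian if $(\nabla_X\varphi)Y+(\nabla_Y\varphi)X=\eta(Y)X+\eta(X)Y-2g(X,Y)\xi$; - nearly cosymplectic if $(\nabla_X\varphi)Y+(\nabla_Y\varphi)X=0$.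
   Formalization: In (4)(a) the formal statement has φ=φ₂ or φ=−φ₂, since a small geodesic sphere in S⁶ with S=λ Id, λ≠0, and φ=−φ₂ is nearly cosymplectic but in no printed family; M is also taken connected, without which λ, t, a need not be constant. *)

theory Defs
  imports "HOL-Analysis.Analysis"
begin

section \<open>Smooth maps between open subsets of normed spaces\<close>

fun C_k_on :: "nat \<Rightarrow> 'a::real_normed_vector set \<Rightarrow> ('a \<Rightarrow> 'b::real_normed_vector) \<Rightarrow> bool" where
  "C_k_on 0 U h \<longleftrightarrow> continuous_on U h"
| "C_k_on (Suc k) U h \<longleftrightarrow>
     (\<forall>x\<in>U. h differentiable (at x)) \<and> (\<forall>v. C_k_on k U (\<lambda>x. frechet_derivative h (at x) v))"

definition smooth_on :: "'a::real_normed_vector set \<Rightarrow> ('a \<Rightarrow> 'b::real_normed_vector) \<Rightarrow> bool" where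
  "smooth_on U h \<longleftrightarrow> (\<forall>k. C_k_on k U h)"


section \<open>Manifolds, tangent vectors, tensor fields\<close>

text \<open>
  A smooth manifold modelled on the Euclidean space \<open>'e\<close> is a second countable Hausdorff type \<open>'m\<close>
  with a smooth atlas, i.e. a set of charts (domain, coordinate map).
\<close>

type_synonym ('m, 'e) chart = "'m set \<times> ('m \<Rightarrow> 'e)"

abbreviation cdom :: "('m, 'e) chart \<Rightarrow> 'm set" where "cdom \<equiv> fst"
abbreviation cmap :: "('m, 'e) chart \<Rightarrow> 'm \<Rightarrow> 'e" where "cmap \<equiv> snd"

definition cinv :: "('m, 'e) chart \<Rightarrow> 'e \<Rightarrow> 'm" where
  "cinv c = inv_into (cdom c) (cmap c)"

definition smooth_atlas ::
  "('m::{t2_space, second_countable_topology}, 'e::euclidean_space) chart set \<Rightarrow> bool" where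
  "smooth_atlas A \<longleftrightarrow>
     (\<forall>c\<in>A. open (cdom c) \<and> open (cmap c ` cdom c) \<and>
            homeomorphism (cdom c) (cmap c ` cdom c) (cmap c) (cinv c)) \<and>
     (\<Union>c\<in>A. cdom c) = UNIV \<and>
     (\<forall>c\<in>A. \<forall>d\<in>A. smooth_on (cmap c ` (cdom c \<inter> cdom d)) (cmap d \<circ> cinv c))"

text \<open>
  Every point \<open>p\<close> gets a reference chart \<open>chart_at A p\<close>, fixed by choice, and the tangent space at
  \<open>p\<close> is the model space \<open>'e\<close> itself: \<open>v :: 'e\<close> stands for the tangent vector at \<open>p\<close> with components
  \<open>v\<close> in that chart. Nothing below depends on the choice. Since neighbouring points may have
  different reference charts, a vector or tensor field may only be differentiated after all its
  values have been expressed in one chart; this is what \<open>to_coord\<close> and \<open>from_coord\<close> are for.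
\<close>

definition chart_at :: "('m, 'e) chart set \<Rightarrow> 'm \<Rightarrow> ('m, 'e) chart" where
  "chart_at A p = (SOME c. c \<in> A \<and> p \<in> cdom c)"

text \<open>\<open>point_deriv A p h u\<close> is the derivative \<open>u(h)\<close> of \<open>h\<close> in the direction of the tangent vector
  \<open>u\<close> at \<open>p\<close>; only the values of \<open>h\<close> near \<open>p\<close> matter.\<close>

definition point_deriv ::
  "('m, 'e::euclidean_space) chart set \<Rightarrow> 'm \<Rightarrow> ('m \<Rightarrow> 'b::real_normed_vector) \<Rightarrow> 'e \<Rightarrow> 'b" where
  "point_deriv A p h =
     frechet_derivative (h \<circ> cinv (chart_at A p)) (at (cmap (chart_at A p) p))"

definition tangent_map ::
  "('m, 'e::euclidean_space) chart set \<Rightarrow> ('n, 'f::euclidean_space) chart set \<Rightarrow> ('m \<Rightarrow> 'n) \<Rightarrow>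
   'm \<Rightarrow> 'e \<Rightarrow> 'f" where
  "tangent_map A B F p = point_deriv A p (cmap (chart_at B (F p)) \<circ> F)"

text \<open>Components in the chart \<open>c\<close> of a tangent vector at \<open>p\<close>, and conversely.\<close>

definition to_coord ::
  "('m, 'e::euclidean_space) chart set \<Rightarrow> ('m, 'e) chart \<Rightarrow> 'm \<Rightarrow> 'e \<Rightarrow> 'e" where
  "to_coord A c p = point_deriv A p (cmap c)"

definition from_coord ::
  "('m, 'e::euclidean_space) chart set \<Rightarrow> ('m, 'e) chart \<Rightarrow> 'm \<Rightarrow> 'e \<Rightarrow> 'e" where
  "from_coord A c p = frechet_derivative (cmap (chart_at A p) \<circ> cinv c) (at (cmap c p))"

text \<open>The coordinate field on the domain of \<open>chart_at A p\<close> that extends the tangent vector \<open>v\<close> at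
  \<open>p\<close> with constant components.\<close>

definition const_field ::
  "('m, 'e::euclidean_space) chart set \<Rightarrow> 'm \<Rightarrow> 'e \<Rightarrow> 'm \<Rightarrow> 'e" where
  "const_field A p v q = from_coord A (chart_at A p) q v"

definition smooth_fun :: "('m, 'e::euclidean_space) chart set \<Rightarrow> ('m \<Rightarrow> real) \<Rightarrow> bool" where
  "smooth_fun A h \<longleftrightarrow> (\<forall>c\<in>A. smooth_on (cmap c ` cdom c) (h \<circ> cinv c))"

definition smooth_map ::
  "('m::topological_space, 'e::euclidean_space) chart set \<Rightarrow>
   ('n::topological_space, 'f::euclidean_space) chart set \<Rightarrow> ('m \<Rightarrow> 'n) \<Rightarrow> bool" where
  "smooth_map A B F \<longleftrightarrow> continuous_on UNIV F \<and>
     (\<forall>c\<in>A. \<forall>d\<in>B. smooth_on (cmap c ` (cdom c \<inter> F -` cdom d)) (cmap d \<circ> F \<circ> cinv c))"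

text \<open>Smooth vector fields along a map \<open>F\<close>, i.e. \<open>V p\<close> is a tangent vector at \<open>F p\<close>.\<close>

definition smooth_field_along ::
  "('m, 'e::euclidean_space) chart set \<Rightarrow> ('n, 'f::euclidean_space) chart set \<Rightarrow> ('m \<Rightarrow> 'n) \<Rightarrow>
   ('m \<Rightarrow> 'f) \<Rightarrow> bool" where
  "smooth_field_along A B F V \<longleftrightarrow>
     (\<forall>c\<in>A. \<forall>d\<in>B. smooth_on (cmap c ` (cdom c \<inter> F -` cdom d))
        (\<lambda>x. to_coord B d (F (cinv c x)) (V (cinv c x))))"

abbreviation smooth_vector_field ::
  "('m, 'e::euclidean_space) chart set \<Rightarrow> ('m \<Rightarrow> 'e) \<Rightarrow> bool" where
  "smooth_vector_field A \<equiv> smooth_field_along A A id"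

definition smooth_endo_field ::
  "('m, 'e::euclidean_space) chart set \<Rightarrow> ('m \<Rightarrow> 'e \<Rightarrow> 'e) \<Rightarrow> bool" where
  "smooth_endo_field A T \<longleftrightarrow> (\<forall>p. linear (T p)) \<and>
     (\<forall>c\<in>A. \<forall>v. smooth_on (cmap c ` cdom c)
        (\<lambda>x. let q = cinv c x in to_coord A c q (T q (from_coord A c q v))))"


section \<open>Riemannian metrics and the Levi-Civita connection\<close>

definition riemannian_metric ::
  "('m, 'e::euclidean_space) chart set \<Rightarrow> ('m \<Rightarrow> 'e \<Rightarrow> 'e \<Rightarrow> real) \<Rightarrow> bool" where
  "riemannian_metric A g \<longleftrightarrow>
     (\<forall>p. bilinear (g p) \<and> (\<forall>u v. g p u v = g p v u) \<and> (\<forall>u. u \<noteq> 0 \<longrightarrow> g p u u > 0)) \<and>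
     (\<forall>c\<in>A. \<forall>u v. smooth_on (cmap c ` cdom c)
        (\<lambda>x. let q = cinv c x in g q (from_coord A c q u) (from_coord A c q v)))"

text \<open>
  A connection is given at \<open>p\<close> by the bilinear map \<open>\<Gamma>\<close> with \<open>\<nabla>\<^sub>u V = \<Gamma> u v\<close> for the coordinate field
  \<open>V = const_field A p v\<close>. The Levi-Civita connection is the torsion-free one (coordinate fields
  commute, so \<open>\<Gamma>\<close> is symmetric) for which \<open>g\<close> is parallel; see \<open>christoffel_levi_civita\<close> below for
  existence and uniqueness.
\<close>

definition levi_civita_at ::
  "('m, 'e::euclidean_space) chart set \<Rightarrow> ('m \<Rightarrow> 'e \<Rightarrow> 'e \<Rightarrow> real) \<Rightarrow> 'm \<Rightarrow> ('e \<Rightarrow> 'e \<Rightarrow> 'e) \<Rightarrow> bool"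
  where
  "levi_civita_at A g p \<Gamma> \<longleftrightarrow> bilinear \<Gamma> \<and> (\<forall>u v. \<Gamma> u v = \<Gamma> v u) \<and>
     (\<forall>u v w. point_deriv A p (\<lambda>q. g q (const_field A p v q) (const_field A p w q)) u
              = g p (\<Gamma> u v) w + g p v (\<Gamma> u w))"

definition christoffel ::
  "('m, 'e::euclidean_space) chart set \<Rightarrow> ('m \<Rightarrow> 'e \<Rightarrow> 'e \<Rightarrow> real) \<Rightarrow> 'm \<Rightarrow> 'e \<Rightarrow> 'e \<Rightarrow> 'e" where
  "christoffel A g p = (THE \<Gamma>. levi_civita_at A g p \<Gamma>)"

text \<open>Covariant derivative at \<open>p\<close>, in direction \<open>u\<close>, of a vector field \<open>V\<close> along \<open>F\<close>, for the
  Levi-Civita connection of the metric \<open>g\<close> on the target.\<close>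

definition cov_along ::
  "('m, 'e::euclidean_space) chart set \<Rightarrow> ('n, 'f::euclidean_space) chart set \<Rightarrow>
   ('n \<Rightarrow> 'f \<Rightarrow> 'f \<Rightarrow> real) \<Rightarrow> ('m \<Rightarrow> 'n) \<Rightarrow> ('m \<Rightarrow> 'f) \<Rightarrow> 'm \<Rightarrow> 'e \<Rightarrow> 'f" where
  "cov_along A B g F V p u =
     point_deriv A p (\<lambda>q. to_coord B (chart_at B (F p)) (F q) (V q)) u
     + christoffel B g (F p) (tangent_map A B F p u) (V p)"

definition nabla ::
  "('m, 'e::euclidean_space) chart set \<Rightarrow> ('m \<Rightarrow> 'e \<Rightarrow> 'e \<Rightarrow> real) \<Rightarrow> ('m \<Rightarrow> 'e) \<Rightarrow> 'm \<Rightarrow> 'e \<Rightarrow> 'e" where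
  "nabla A g = cov_along A A g id"

text \<open>\<open>(\<nabla>\<^sub>X T)Y = \<nabla>\<^sub>X(TY) - T(\<nabla>\<^sub>X Y)\<close> is tensorial in \<open>X\<close> and \<open>Y\<close>, so that its value at \<open>p\<close> on
  tangent vectors \<open>u\<close>, \<open>v\<close> may be computed with the extension \<open>Y = const_field A p v\<close>; see
  \<open>nabla_endo_tensorial\<close> below.\<close>

definition nabla_endo ::
  "('m, 'e::euclidean_space) chart set \<Rightarrow> ('m \<Rightarrow> 'e \<Rightarrow> 'e \<Rightarrow> real) \<Rightarrow> ('m \<Rightarrow> 'e \<Rightarrow> 'e) \<Rightarrow>
   'm \<Rightarrow> 'e \<Rightarrow> 'e \<Rightarrow> 'e" where
  "nabla_endo A g T p u v =
     nabla A g (\<lambda>q. T q (const_field A p v q)) p u - T p (nabla A g (const_field A p v) p u)"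


section \<open>Nearly Kaehler manifolds\<close>

definition almost_hermitian ::
  "('m, 'e::euclidean_space) chart set \<Rightarrow> ('m \<Rightarrow> 'e \<Rightarrow> 'e \<Rightarrow> real) \<Rightarrow> ('m \<Rightarrow> 'e \<Rightarrow> 'e) \<Rightarrow> bool" where
  "almost_hermitian A g J \<longleftrightarrow> riemannian_metric A g \<and> smooth_endo_field A J \<and>
     (\<forall>p u. J p (J p u) = - u) \<and> (\<forall>p u v. g p (J p u) (J p v) = g p u v)"

definition nearly_kaehler ::
  "('m, 'e::euclidean_space) chart set \<Rightarrow> ('m \<Rightarrow> 'e \<Rightarrow> 'e \<Rightarrow> real) \<Rightarrow> ('m \<Rightarrow> 'e \<Rightarrow> 'e) \<Rightarrow> bool" where
  "nearly_kaehler A g J \<longleftrightarrow> almost_hermitian A g J \<and>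
     (\<forall>p u v. nabla_endo A g J p u v = - nabla_endo A g J p v u)"

definition strict_nearly_kaehler ::
  "('m, 'e::euclidean_space) chart set \<Rightarrow> ('m \<Rightarrow> 'e \<Rightarrow> 'e \<Rightarrow> real) \<Rightarrow> ('m \<Rightarrow> 'e \<Rightarrow> 'e) \<Rightarrow> bool" where
  "strict_nearly_kaehler A g J \<longleftrightarrow> nearly_kaehler A g J \<and>
     (\<forall>p u. (\<forall>v. nabla_endo A g J p u v = 0) \<longrightarrow> u = 0)"

definition constant_type_one ::
  "('m, 'e::euclidean_space) chart set \<Rightarrow> ('m \<Rightarrow> 'e \<Rightarrow> 'e \<Rightarrow> real) \<Rightarrow> ('m \<Rightarrow> 'e \<Rightarrow> 'e) \<Rightarrow> bool" where
  "constant_type_one A g J \<longleftrightarrow>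
     (\<forall>p u v. g p (nabla_endo A g J p u v) (nabla_endo A g J p u v)
              = g p u u * g p v v - (g p u v)\<^sup>2 - (g p (J p u) v)\<^sup>2)"


section \<open>Hypersurfaces\<close>

definition isometric_immersion ::
  "('m::topological_space, 'e::euclidean_space) chart set \<Rightarrow> ('m \<Rightarrow> 'e \<Rightarrow> 'e \<Rightarrow> real) \<Rightarrow>
   ('n::topological_space, 'f::euclidean_space) chart set \<Rightarrow> ('n \<Rightarrow> 'f \<Rightarrow> 'f \<Rightarrow> real) \<Rightarrow>
   ('m \<Rightarrow> 'n) \<Rightarrow> bool" where
  "isometric_immersion A gM B g f \<longleftrightarrow> smooth_map A B f \<and> (\<forall>p. inj (tangent_map A B f p)) \<and>
     (\<forall>p u v. gM p u v = g (f p) (tangent_map A B f p u) (tangent_map A B f p v))"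

definition unit_normal ::
  "('m, 'e::euclidean_space) chart set \<Rightarrow> ('n, 'f::euclidean_space) chart set \<Rightarrow>
   ('n \<Rightarrow> 'f \<Rightarrow> 'f \<Rightarrow> real) \<Rightarrow> ('m \<Rightarrow> 'n) \<Rightarrow> ('m \<Rightarrow> 'f) \<Rightarrow> bool" where
  "unit_normal A B g f N \<longleftrightarrow> smooth_field_along A B f N \<and>
     (\<forall>p. g (f p) (N p) (N p) = 1) \<and> (\<forall>p u. g (f p) (N p) (tangent_map A B f p u) = 0)"

text \<open>The tangent vector of the hypersurface at \<open>p\<close> whose image under the differential of the
  immersion is \<open>w\<close>; only used for \<open>w\<close> orthogonal to the normal.\<close>

definition pull_back ::
  "('m, 'e::euclidean_space) chart set \<Rightarrow> ('n, 'f::euclidean_space) chart set \<Rightarrow> ('m \<Rightarrow> 'n) \<Rightarrow>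
   'm \<Rightarrow> 'f \<Rightarrow> 'e" where
  "pull_back A B f p w = inv (tangent_map A B f p) w"

text \<open>\<open>h\<close> is the normal component of \<open>\<nabla>\<^sub>X Y\<close> (ambient connection), and \<open>S X = - \<nabla>\<^sub>X N\<close>.\<close>

definition second_fundamental_form ::
  "('m, 'e::euclidean_space) chart set \<Rightarrow> ('n, 'f::euclidean_space) chart set \<Rightarrow>
   ('n \<Rightarrow> 'f \<Rightarrow> 'f \<Rightarrow> real) \<Rightarrow> ('m \<Rightarrow> 'n) \<Rightarrow> ('m \<Rightarrow> 'f) \<Rightarrow> 'm \<Rightarrow> 'e \<Rightarrow> 'e \<Rightarrow> real" where
  "second_fundamental_form A B g f N p u v =
     g (f p) (cov_along A B g f (\<lambda>q. tangent_map A B f q (const_field A p v q)) p u) (N p)"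

definition shape_operator ::
  "('m, 'e::euclidean_space) chart set \<Rightarrow> ('n, 'f::euclidean_space) chart set \<Rightarrow>
   ('n \<Rightarrow> 'f \<Rightarrow> 'f \<Rightarrow> real) \<Rightarrow> ('m \<Rightarrow> 'n) \<Rightarrow> ('m \<Rightarrow> 'f) \<Rightarrow> 'm \<Rightarrow> 'e \<Rightarrow> 'e" where
  "shape_operator A B g f N p u = pull_back A B f p (- cov_along A B g f N p u)"

definition eta_quasi_umbilical ::
  "('m, 'e::euclidean_space) chart set \<Rightarrow> ('m \<Rightarrow> 'e \<Rightarrow> 'e \<Rightarrow> real) \<Rightarrow> ('m \<Rightarrow> 'e) \<Rightarrow>
   ('m \<Rightarrow> 'e \<Rightarrow> 'e \<Rightarrow> real) \<Rightarrow> bool" where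
  "eta_quasi_umbilical A gM \<xi> h \<longleftrightarrow>
     (\<exists>\<alpha> \<beta>. smooth_fun A \<alpha> \<and> smooth_fun A \<beta> \<and>
        (\<forall>p u v. h p u v = \<alpha> p * gM p u v + \<beta> p * (gM p (\<xi> p) u * gM p (\<xi> p) v)))"

definition reeb ::
  "('m, 'e::euclidean_space) chart set \<Rightarrow> ('n, 'f::euclidean_space) chart set \<Rightarrow>
   ('n \<Rightarrow> 'f \<Rightarrow> 'f) \<Rightarrow> ('m \<Rightarrow> 'n) \<Rightarrow> ('m \<Rightarrow> 'f) \<Rightarrow> 'm \<Rightarrow> 'e" where
  "reeb A B J f N p = pull_back A B f p (- J (f p) (N p))"

definition phi1 ::
  "('m, 'e::euclidean_space) chart set \<Rightarrow> ('m \<Rightarrow> 'e \<Rightarrow> 'e \<Rightarrow> real) \<Rightarrow>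
   ('n, 'f::euclidean_space) chart set \<Rightarrow>
   ('n \<Rightarrow> 'f \<Rightarrow> 'f) \<Rightarrow> ('m \<Rightarrow> 'n) \<Rightarrow> ('m \<Rightarrow> 'f) \<Rightarrow> 'm \<Rightarrow> 'e \<Rightarrow> 'e" where
  "phi1 A gM B J f N p u =
     pull_back A B f p (J (f p) (tangent_map A B f p u) - gM p (reeb A B J f N p) u *\<^sub>R N p)"

definition phi2 ::
  "('m, 'e::euclidean_space) chart set \<Rightarrow> ('n, 'f::euclidean_space) chart set \<Rightarrow>
   ('n \<Rightarrow> 'f \<Rightarrow> 'f \<Rightarrow> real) \<Rightarrow> ('n \<Rightarrow> 'f \<Rightarrow> 'f) \<Rightarrow> ('m \<Rightarrow> 'n) \<Rightarrow> ('m \<Rightarrow> 'f) \<Rightarrow> 'm \<Rightarrow> 'e \<Rightarrow> 'e" where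
  "phi2 A B g J f N p u =
     pull_back A B f p (nabla_endo B g J (f p)
       (tangent_map A B f p (reeb A B J f N p)) (tangent_map A B f p u))"

definition phi3 ::
  "('m, 'e::euclidean_space) chart set \<Rightarrow> ('n, 'f::euclidean_space) chart set \<Rightarrow>
   ('n \<Rightarrow> 'f \<Rightarrow> 'f \<Rightarrow> real) \<Rightarrow> ('n \<Rightarrow> 'f \<Rightarrow> 'f) \<Rightarrow> ('m \<Rightarrow> 'n) \<Rightarrow> ('m \<Rightarrow> 'f) \<Rightarrow> 'm \<Rightarrow> 'e \<Rightarrow> 'e" where
  "phi3 A B g J f N p u =
     pull_back A B f p (nabla_endo B g J (f p) (N p) (tangent_map A B f p u))"


section \<open>Almost contact metric structures\<close>

definition almost_contact ::
  "('m, 'e::euclidean_space) chart set \<Rightarrow> ('m \<Rightarrow> 'e \<Rightarrow> 'e \<Rightarrow> real) \<Rightarrow> ('m \<Rightarrow> 'e) \<Rightarrow>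
   ('m \<Rightarrow> 'e \<Rightarrow> 'e) \<Rightarrow> bool" where
  "almost_contact A g \<xi> \<phi> \<longleftrightarrow> odd DIM('e) \<and> riemannian_metric A g \<and>
     smooth_vector_field A \<xi> \<and> smooth_endo_field A \<phi> \<and> (\<forall>p. g p (\<xi> p) (\<xi> p) = 1) \<and>
     (\<forall>p u v. g p (\<phi> p u) (\<phi> p v) = g p u v - g p (\<xi> p) u * g p (\<xi> p) v) \<and>
     (\<forall>p u. \<phi> p (\<phi> p u) = - u + g p (\<xi> p) u *\<^sub>R \<xi> p)"

definition sasakian ::
  "('m, 'e::euclidean_space) chart set \<Rightarrow> ('m \<Rightarrow> 'e \<Rightarrow> 'e \<Rightarrow> real) \<Rightarrow> ('m \<Rightarrow> 'e) \<Rightarrow>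
   ('m \<Rightarrow> 'e \<Rightarrow> 'e) \<Rightarrow> bool" where
  "sasakian A g \<xi> \<phi> \<longleftrightarrow> almost_contact A g \<xi> \<phi> \<and>
     (\<forall>p u v. nabla_endo A g \<phi> p u v = g p (\<xi> p) v *\<^sub>R u - g p u v *\<^sub>R \<xi> p)"

definition co_kaehler ::
  "('m, 'e::euclidean_space) chart set \<Rightarrow> ('m \<Rightarrow> 'e \<Rightarrow> 'e \<Rightarrow> real) \<Rightarrow> ('m \<Rightarrow> 'e) \<Rightarrow>
   ('m \<Rightarrow> 'e \<Rightarrow> 'e) \<Rightarrow> bool" where
  "co_kaehler A g \<xi> \<phi> \<longleftrightarrow> almost_contact A g \<xi> \<phi> \<and> (\<forall>p u v. nabla_endo A g \<phi> p u v = 0)"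

definition nearly_sasakian ::
  "('m, 'e::euclidean_space) chart set \<Rightarrow> ('m \<Rightarrow> 'e \<Rightarrow> 'e \<Rightarrow> real) \<Rightarrow> ('m \<Rightarrow> 'e) \<Rightarrow>
   ('m \<Rightarrow> 'e \<Rightarrow> 'e) \<Rightarrow> bool" where
  "nearly_sasakian A g \<xi> \<phi> \<longleftrightarrow> almost_contact A g \<xi> \<phi> \<and>
     (\<forall>p u v. nabla_endo A g \<phi> p u v + nabla_endo A g \<phi> p v u
              = g p (\<xi> p) v *\<^sub>R u + g p (\<xi> p) u *\<^sub>R v - (2 * g p u v) *\<^sub>R \<xi> p)"

definition nearly_cosymplectic ::
  "('m, 'e::euclidean_space) chart set \<Rightarrow> ('m \<Rightarrow> 'e \<Rightarrow> 'e \<Rightarrow> real) \<Rightarrow> ('m \<Rightarrow> 'e) \<Rightarrow>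
   ('m \<Rightarrow> 'e \<Rightarrow> 'e) \<Rightarrow> bool" where
  "nearly_cosymplectic A g \<xi> \<phi> \<longleftrightarrow> almost_contact A g \<xi> \<phi> \<and>
     (\<forall>p u v. nabla_endo A g \<phi> p u v + nabla_endo A g \<phi> p v u = 0)"


section \<open>Well-definedness\<close>

lemma smooth_on_differentiable: "smooth_on U h \<Longrightarrow> x \<in> U \<Longrightarrow> h differentiable (at x)"
  unfolding smooth_on_def by (metis C_k_on.simps(2))

lemma chart_at:
  assumes "smooth_atlas A"
  shows "chart_at A p \<in> A" "p \<in> cdom (chart_at A p)"
proof -
  have "p \<in> (\<Union>c\<in>A. cdom c)" using assms unfolding smooth_atlas_def by simp
  then have "\<exists>c. c \<in> A \<and> p \<in> cdom c" by blast
  from someI_ex[OF this] show "chart_at A p \<in> A" "p \<in> cdom (chart_at A p)"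
    unfolding chart_at_def by auto
qed

lemma cinv_cmap:
  assumes "smooth_atlas A" "c \<in> A" "p \<in> cdom c"
  shows "cinv c (cmap c p) = p"
  using assms unfolding smooth_atlas_def homeomorphism_def by blast

lemma cmap_cinv:
  assumes "smooth_atlas A" "c \<in> A" "x \<in> cmap c ` cdom c"
  shows "cmap c (cinv c x) = x" "cinv c x \<in> cdom c"
  using assms unfolding smooth_atlas_def homeomorphism_def by blast+

lemma open_chart_image:
  assumes "smooth_atlas A" "c \<in> A"
  shows "open (cmap c ` cdom c)"
  using assms unfolding smooth_atlas_def by blast

lemma open_chart_image_Int:
  assumes A: "smooth_atlas A" and c: "c \<in> A" and d: "d \<in> A"
  shows "open (cmap c ` (cdom c \<inter> cdom d))"
proof -
  have hc: "homeomorphism (cdom c) (cmap c ` cdom c) (cmap c) (cinv c)"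
    and oc: "open (cdom c)" "open (cmap c ` cdom c)" and od: "open (cdom d)"
    using A[unfolded smooth_atlas_def] c d by blast+
  have "openin (top_of_set (cmap c ` cdom c)) (cmap c ` (cdom c \<inter> cdom d))"
    using homeomorphism_imp_open_map[OF hc] od by (simp add: oc(1) openin_open_Int)
  then show ?thesis using oc(2) openin_open_trans by blast
qed

lemma transition_differentiable:
  assumes A: "smooth_atlas A" and c: "c \<in> A" and d: "d \<in> A" and p: "p \<in> cdom c" "p \<in> cdom d"
  shows "(cmap d \<circ> cinv c) differentiable (at (cmap c p))"
proof -
  have "smooth_on (cmap c ` (cdom c \<inter> cdom d)) (cmap d \<circ> cinv c)"
    using A c d unfolding smooth_atlas_def by blast
  then show ?thesis by (rule smooth_on_differentiable) (use p in blast)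
qed

lemma transition_self:
  assumes A: "smooth_atlas A" and c: "c \<in> A" and p: "p \<in> cdom c"
  shows "frechet_derivative (cmap c \<circ> cinv c) (at (cmap c p)) = (\<lambda>v. v)"
proof -
  have "((\<lambda>x. x) has_derivative (\<lambda>v. v)) (at (cmap c p))" by simp
  then have "(cmap c \<circ> cinv c has_derivative (\<lambda>v. v)) (at (cmap c p))"
    by (rule has_derivative_transform_within_open[OF _ open_chart_image[OF A c]])
      (use p cmap_cinv[OF A c] in auto)
  then show ?thesis using frechet_derivative_at by metis
qed

lemma to_coord_self: "smooth_atlas A \<Longrightarrow> to_coord A (chart_at A p) p v = v"
  unfolding to_coord_def point_deriv_def by (simp add: transition_self chart_at)

lemma const_field_self: "smooth_atlas A \<Longrightarrow> const_field A p v p = v"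
  unfolding const_field_def from_coord_def by (simp add: transition_self chart_at)

lemma linear_to_coord:
  assumes "smooth_atlas A" "c \<in> A" "q \<in> cdom c"
  shows "linear (to_coord A c q)"
  unfolding to_coord_def point_deriv_def
  by (intro linear_frechet_derivative transition_differentiable[OF assms(1)] assms
      chart_at[OF assms(1)])

lemma linear_from_coord:
  assumes "smooth_atlas A" "c \<in> A" "q \<in> cdom c"
  shows "linear (from_coord A c q)"
  unfolding from_coord_def
  by (intro linear_frechet_derivative transition_differentiable[OF assms(1)] assms
      chart_at[OF assms(1)])

lemma transition_inverse:
  assumes A: "smooth_atlas A" and c: "c \<in> A" and d: "d \<in> A" and p: "p \<in> cdom c" "p \<in> cdom d"
  shows "frechet_derivative (cmap c \<circ> cinv d) (at (cmap d p))
           (frechet_derivative (cmap d \<circ> cinv c) (at (cmap c p)) v) = v"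
proof -
  let ?D = "frechet_derivative (cmap d \<circ> cinv c) (at (cmap c p))"
  let ?E = "frechet_derivative (cmap c \<circ> cinv d) (at (cmap d p))"
  have D: "((cmap d \<circ> cinv c) has_derivative ?D) (at (cmap c p))"
    using transition_differentiable[OF A c d p] frechet_derivative_works by blast
  have E: "((cmap c \<circ> cinv d) has_derivative ?E) (at (cmap d p))"
    using transition_differentiable[OF A d c p(2) p(1)] frechet_derivative_works by blast
  have "(cmap d \<circ> cinv c) (cmap c p) = cmap d p" by (simp add: cinv_cmap[OF A c p(1)])
  then have "((cmap c \<circ> cinv d) \<circ> (cmap d \<circ> cinv c) has_derivative ?E \<circ> ?D) (at (cmap c p))"
    using D E by (intro diff_chain_at) auto
  then have "((\<lambda>x. x) has_derivative ?E \<circ> ?D) (at (cmap c p))"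
    by (rule has_derivative_transform_within_open[OF _ open_chart_image_Int[OF A c d]])
      (use p cinv_cmap[OF A d] cinv_cmap[OF A c] in auto)
  then have "?E \<circ> ?D = (\<lambda>v. v)" using has_derivative_ident has_derivative_unique by blast
  then show ?thesis by (metis comp_apply)
qed

lemma from_to_coord:
  assumes "smooth_atlas A" "c \<in> A" "q \<in> cdom c"
  shows "from_coord A c q (to_coord A c q v) = v"
  unfolding to_coord_def from_coord_def point_deriv_def
  by (intro transition_inverse[OF assms(1)] assms chart_at[OF assms(1)])

lemma differentiable_metric_coeff:
  assumes A: "smooth_atlas A" and g: "riemannian_metric A g"
  shows "((\<lambda>q. g q (const_field A p v q) (const_field A p w q)) \<circ> cinv (chart_at A p))
           differentiable (at (cmap (chart_at A p) p))"
proof -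
  have "smooth_on (cmap (chart_at A p) ` cdom (chart_at A p))
     (\<lambda>x. let q = cinv (chart_at A p) x in
        g q (from_coord A (chart_at A p) q v) (from_coord A (chart_at A p) q w))"
    using g chart_at(1)[OF A] unfolding riemannian_metric_def by blast
  from smooth_on_differentiable[OF this, of "cmap (chart_at A p) p"] show ?thesis
    using chart_at(2)[OF A] by (simp add: o_def Let_def const_field_def)
qed

lemma has_derivative_metric_coeff:
  assumes A: "smooth_atlas A" and g: "riemannian_metric A g"
  shows "((\<lambda>q. g q (const_field A p v q) (const_field A p w q)) \<circ> cinv (chart_at A p)
           has_derivative point_deriv A p (\<lambda>q. g q (const_field A p v q) (const_field A p w q)))
           (at (cmap (chart_at A p) p))"
  using differentiable_metric_coeff[OF assms] frechet_derivative_works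
  unfolding point_deriv_def by blast

lemma point_deriv_eqI:
  assumes A: "smooth_atlas A"
    and D: "(k has_derivative D) (at (cmap (chart_at A p) p))"
    and eq: "\<And>q. q \<in> cdom (chart_at A p) \<Longrightarrow> k (cmap (chart_at A p) q) = h q"
  shows "point_deriv A p h = D"
proof -
  let ?c = "chart_at A p"
  have "(h \<circ> cinv ?c has_derivative D) (at (cmap ?c p))"
    by (rule has_derivative_transform_within_open[OF D open_chart_image[OF A chart_at(1)[OF A]]])
      (use chart_at[OF A] cinv_cmap[OF A chart_at(1)[OF A]] eq in auto)
  then show ?thesis unfolding point_deriv_def using frechet_derivative_at by metis
qed

lemma metric_coeff_linear:
  fixes A :: "('m::{t2_space, second_countable_topology}, 'e::euclidean_space) chart set" and p :: 'm
  assumes A: "smooth_atlas A" and g: "riemannian_metric A g"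
  defines "D \<equiv> \<lambda>u v w. point_deriv A p (\<lambda>q. g q (const_field A p v q) (const_field A p w q)) u"
  shows "linear (\<lambda>u. D u v w)" "linear (\<lambda>v. D u v w)" "D u v w = D u w v"
proof -
  note hd = has_derivative_metric_coeff[OF A g, where p = p]
  have bil: "bilinear (g q)" for q using g unfolding riemannian_metric_def by blast
  show "linear (\<lambda>u. D u v w)"
    unfolding D_def using has_derivative_linear[OF hd] .
  have lin: "linear (\<lambda>v. const_field A p v q)" if "q \<in> cdom (chart_at A p)" for q
    unfolding const_field_def using linear_from_coord[OF A chart_at(1)[OF A] that] .
  show "linear (\<lambda>v. D u v w)"
  proof (rule linearI)
    fix x y
    have "point_deriv A p (\<lambda>q. g q (const_field A p (x + y) q) (const_field A p w q))
        = (\<lambda>u. D u x w + D u y w)"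
      unfolding D_def
      by (rule point_deriv_eqI[OF A has_derivative_add[OF hd hd]])
        (simp add: linear_add[OF lin] bilinear_ladd[OF bil] cinv_cmap[OF A chart_at(1)[OF A]])
    then show "D u (x + y) w = D u x w + D u y w" unfolding D_def by metis
  next
    fix r :: real and x
    have "point_deriv A p (\<lambda>q. g q (const_field A p (r *\<^sub>R x) q) (const_field A p w q))
        = (\<lambda>u. r *\<^sub>R D u x w)"
      unfolding D_def
      by (rule point_deriv_eqI[OF A has_derivative_scaleR_right[OF hd]])
        (simp add: linear_scale[OF lin] bilinear_lmul[OF bil] cinv_cmap[OF A chart_at(1)[OF A]])
    then show "D u (r *\<^sub>R x) w = r *\<^sub>R D u x w" unfolding D_def by metis
  qed
  have sym: "g q x y = g q y x" for q x y using g unfolding riemannian_metric_def by blast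
  have "(\<lambda>q. g q (const_field A p v q) (const_field A p w q))
      = (\<lambda>q. g q (const_field A p w q) (const_field A p v q))" by (rule ext) (rule sym)
  then show "D u v w = D u w v" unfolding D_def by simp
qed

lemma metric_nondegenerate:
  assumes "riemannian_metric A g" "\<And>w. g p x w = g p y w"
  shows "x = y"
proof (rule ccontr)
  assume "x \<noteq> y"
  have "g p (x - y) (x - y) = 0"
    using assms(1) assms(2)[of "x - y"] bilinear_lsub[of "g p" x y "x - y"]
    unfolding riemannian_metric_def by simp
  then show False using assms(1) \<open>x \<noteq> y\<close> unfolding riemannian_metric_def
    by (metis eq_iff_diff_eq_0 less_irrefl)
qed

lemma metric_represent:
  fixes g :: "'m::{t2_space, second_countable_topology} \<Rightarrow> 'e::euclidean_space \<Rightarrow> 'e \<Rightarrow> real"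
  assumes g: "riemannian_metric A g" and K: "linear K"
  shows "\<exists>x. \<forall>w. g p x w = K w"
proof -
  have bil: "bilinear (g p)" using g unfolding riemannian_metric_def by blast
  define L where "L x = (\<Sum>i\<in>Basis. g p x i *\<^sub>R i)" for x
  have linL: "linear L"
    unfolding L_def
    by (rule linearI)
      (simp_all add: bilinear_ladd[OF bil] bilinear_lmul[OF bil] scaleR_left_distrib
        sum.distrib scaleR_sum_right)
  have Lb: "L x \<bullet> i = g p x i" if "i \<in> Basis" for x i
    unfolding L_def using that by (simp add: inner_sum_left_Basis)
  have lin2: "linear (g p x)" for x using bil unfolding bilinear_def by blast
  have ext: "g p x = k" if "\<And>i. i \<in> Basis \<Longrightarrow> g p x i = k i" "linear k" for x k
    using linear_eq_stdbasis[OF lin2 that(2)] that(1) by blast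
  have "inj L"
  proof (rule injI)
    fix x y assume "L x = L y"
    then have "g p x i = g p y i" if "i \<in> Basis" for i using Lb that by metis
    then have "g p x = g p y" by (rule ext[OF _ lin2])
    then show "x = y" using metric_nondegenerate[OF g, of p x y] by simp
  qed
  then have "surj L" using linL linear_injective_imp_surjective by blast
  then obtain x where x: "L x = (\<Sum>i\<in>Basis. K i *\<^sub>R i)" by (metis surjD)
  have "g p x i = K i" if "i \<in> Basis" for i
    using Lb[OF that, of x] x that by (simp add: inner_sum_left_Basis)
  then have "g p x = K" by (rule ext[OF _ K])
  then show ?thesis by auto
qed

theorem christoffel_levi_civita:
  assumes A: "smooth_atlas A" and g: "riemannian_metric A g"
  shows "\<exists>!\<Gamma>. levi_civita_at A g p \<Gamma>" "levi_civita_at A g p (christoffel A g p)"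
proof -
  define D where
    "D = (\<lambda>u v w. point_deriv A p (\<lambda>q. g q (const_field A p v q) (const_field A p w q)) u)"
  have DD: "linear (\<lambda>u. D u v w)" "linear (\<lambda>v. D u v w)" "D u v w = D u w v" for u v w
    unfolding D_def using metric_coeff_linear[OF A g, where p = p] by blast+
  have D3: "linear (\<lambda>w. D u v w)" for u v
  proof -
    have "(\<lambda>w. D u v w) = (\<lambda>w. D u w v)" by (rule ext) (rule DD(3))
    then show ?thesis using DD(2) by metis
  qed
  have bil: "bilinear (g p)" and sym: "\<And>u v. g p u v = g p v u"
    using g unfolding riemannian_metric_def by blast+
  have lc: "levi_civita_at A g p \<Gamma> \<longleftrightarrow> bilinear \<Gamma> \<and> (\<forall>u v. \<Gamma> u v = \<Gamma> v u) \<and>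
     (\<forall>u v w. D u v w = g p (\<Gamma> u v) w + g p v (\<Gamma> u w))" for \<Gamma>
    unfolding levi_civita_at_def D_def by simp
  define K where "K u v w = (D u v w + D v u w - D w u v) / 2" for u v w
  note lins = linear_add[OF DD(1)] linear_add[OF DD(2)] linear_add[OF D3]
    linear_scale[OF DD(1)] linear_scale[OF DD(2)] linear_scale[OF D3]
  have "linear (K u v)" for u v
    by (rule linearI) (simp_all add: K_def lins field_simps)
  then have "\<forall>u v. \<exists>x. \<forall>w. g p x w = K u v w" using metric_represent[OF g] by blast
  then obtain \<Gamma> where \<Gamma>: "\<And>u v w. g p (\<Gamma> u v) w = K u v w" by metis
  have ndg: "x = y" if "\<And>w. g p x w = g p y w" for x y
    using metric_nondegenerate[OF g that] .
  have 1: "levi_civita_at A g p \<Gamma>"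
    unfolding lc
  proof (intro conjI allI)
    show "\<Gamma> u v = \<Gamma> v u" for u v
      by (rule ndg) (simp add: \<Gamma> K_def DD(3)[of _ u v])
    show "D u v w = g p (\<Gamma> u v) w + g p v (\<Gamma> u w)" for u v w
      using DD(3)[of u v w] by (simp add: sym[of v] \<Gamma> K_def DD(3)[of v u w] DD(3)[of w u v] field_simps)
    show "bilinear \<Gamma>"
      unfolding bilinear_def
      by (intro conjI allI linearI ndg)
        (simp_all add: \<Gamma> K_def bilinear_ladd[OF bil] bilinear_lmul[OF bil] lins field_simps)
  qed
  have 2: "\<Gamma>' = \<Gamma>" if L: "levi_civita_at A g p \<Gamma>'" for \<Gamma>'
  proof (intro ext ndg)
    fix u v w
    have s: "\<Gamma>' x y = \<Gamma>' y x" and m: "D x y z = g p (\<Gamma>' x y) z + g p y (\<Gamma>' x z)" for x y z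
      using L unfolding lc by blast+
    have "K u v w = g p (\<Gamma>' u v) w"
      unfolding K_def m using s[of u v] s[of u w] s[of v w] sym[of v] sym[of u]
      by (simp add: field_simps)
    then show "g p (\<Gamma>' u v) w = g p (\<Gamma> u v) w" using \<Gamma> by simp
  qed
  show ex: "\<exists>!\<Gamma>. levi_civita_at A g p \<Gamma>" using 1 2 by blast
  show "levi_civita_at A g p (christoffel A g p)"
    unfolding christoffel_def by (rule theI'[OF ex])
qed

theorem nabla_endo_tensorial:
  fixes A :: "('m::{t2_space, second_countable_topology}, 'e::euclidean_space) chart set"
  assumes A: "smooth_atlas A" and g: "riemannian_metric A g"
    and T: "smooth_endo_field A T" and Y: "smooth_vector_field A Y"
  shows "nabla A g (\<lambda>q. T q (Y q)) p u - T p (nabla A g Y p u) = nabla_endo A g T p u (Y p)"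
proof -
  define c where "c = chart_at A p"
  have c: "c \<in> A" "p \<in> cdom c" using chart_at[OF A] c_def by auto
  let ?x = "cmap c p"
  have x: "?x \<in> cmap c ` cdom c" using c by blast
  define \<Gamma> where "\<Gamma> = christoffel A g p"
  have bil: "bilinear \<Gamma>"
    using christoffel_levi_civita(2)[OF A g] unfolding \<Gamma>_def levi_civita_at_def by blast
  have linT: "linear (T q)" for q using T unfolding smooth_endo_field_def by blast
  have tm: "tangent_map A A id p u = u"
    using to_coord_self[OF A, of p u] unfolding tangent_map_def to_coord_def by (simp add: o_def)
  have nab: "nabla A g V p u = point_deriv A p (\<lambda>q. to_coord A c q (V q)) u + \<Gamma> u (V p)" for V
    unfolding nabla_def cov_along_def \<Gamma>_def c_def by (simp add: tm)
  define y where "y = (\<lambda>x. to_coord A c (cinv c x) (Y (cinv c x)))"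
  define t where "t = (\<lambda>v x. to_coord A c (cinv c x) (T (cinv c x) (from_coord A c (cinv c x) v)))"
  have "smooth_on (cmap c ` cdom c) y"
  proof -
    have "smooth_on (cmap c ` (cdom c \<inter> id -` cdom c))
        (\<lambda>x. to_coord A c (id (cinv c x)) (Y (cinv c x)))"
      using Y c(1) unfolding smooth_field_along_def by blast
    then show ?thesis by (simp add: y_def)
  qed
  then have "y differentiable (at ?x)" using x by (rule smooth_on_differentiable)
  then obtain y' where y': "(y has_derivative y') (at ?x)" unfolding differentiable_def by blast
  have "smooth_on (cmap c ` cdom c) (t v)" for v
    using T c unfolding smooth_endo_field_def t_def Let_def by blast
  then have "t v differentiable (at ?x)" for v using x by (rule smooth_on_differentiable)
  then have "\<exists>t'. (t v has_derivative t') (at ?x)" for v unfolding differentiable_def by blast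
  then obtain t' where t': "\<And>v. (t v has_derivative t' v) (at ?x)" by metis
  have lint: "linear (\<lambda>v. t v (cmap c q))" if q: "q \<in> cdom c" for q
    using linear_compose[OF linear_compose[OF linear_from_coord[OF A c(1) q] linT[of q]]
        linear_to_coord[OF A c(1) q]]
    by (simp add: t_def o_def cinv_cmap[OF A c(1) q])
  have exp: "t v (cmap c q) = (\<Sum>i\<in>Basis. (v \<bullet> i) *\<^sub>R t i (cmap c q))" if "q \<in> cdom c" for q v
    using linear_sum[OF lint[OF that], of "\<lambda>i. (v \<bullet> i) *\<^sub>R i" Basis] linear_scale[OF lint[OF that]]
    by (simp add: euclidean_representation)
  have cT: "t v ?x = T p v" for v
    unfolding t_def using c cinv_cmap[OF A c] const_field_self[OF A, of p] to_coord_self[OF A, of p]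
    by (simp add: const_field_def c_def[symmetric])
  have yp: "y ?x = Y p"
    unfolding y_def using cinv_cmap[OF A c] to_coord_self[OF A, of p] by (simp add: c_def[symmetric])
  have d0: "point_deriv A p (\<lambda>q. to_coord A c q (Y q)) = y'"
    by (rule point_deriv_eqI[OF A y'[unfolded c_def]])
      (simp add: y_def c_def[symmetric] cinv_cmap[OF A c(1)])
  have d1: "point_deriv A p (\<lambda>q. to_coord A c q (T q (const_field A p v q))) = t' v" for v
    by (rule point_deriv_eqI[OF A t'[unfolded c_def]])
      (simp add: t_def c_def[symmetric] const_field_def cinv_cmap[OF A c(1)])
  have inv: "to_coord A c q (from_coord A c q v) = v" if "q \<in> cdom c" for q v
    unfolding to_coord_def from_coord_def point_deriv_def
    by (intro transition_inverse[OF A] c(1) that chart_at[OF A])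
  have d2: "point_deriv A p (\<lambda>q. to_coord A c q (const_field A p v q)) = (\<lambda>u. 0)" for v
    by (rule point_deriv_eqI[OF A, where k = "\<lambda>x. v"])
      (simp_all add: c_def[symmetric] const_field_def inv)
  have tt: "t' v u = (\<Sum>i\<in>Basis. (v \<bullet> i) *\<^sub>R t' i u)" for v
  proof -
    have "((\<lambda>x. \<Sum>i\<in>Basis. (v \<bullet> i) *\<^sub>R t i x) has_derivative
        (\<lambda>u. \<Sum>i\<in>Basis. (v \<bullet> i) *\<^sub>R t' i u)) (at ?x)"
      by (intro has_derivative_sum has_derivative_scaleR_right t')
    then have "(t v has_derivative (\<lambda>u. \<Sum>i\<in>Basis. (v \<bullet> i) *\<^sub>R t' i u)) (at ?x)"
      by (rule has_derivative_transform_within_open[OF _ open_chart_image[OF A c(1)] x])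
        (elim imageE, hypsubst, rule exp[symmetric])
    from has_derivative_unique[OF t' this] show ?thesis by (rule fun_cong)
  qed
  have d3: "point_deriv A p (\<lambda>q. to_coord A c q (T q (Y q)))
      = (\<lambda>u. \<Sum>i\<in>Basis. (y ?x \<bullet> i) *\<^sub>R t' i u + (y' u \<bullet> i) *\<^sub>R t i ?x)"
  proof (rule point_deriv_eqI[OF A])
    show "((\<lambda>x. \<Sum>i\<in>Basis. (y x \<bullet> i) *\<^sub>R t i x) has_derivative
        (\<lambda>u. \<Sum>i\<in>Basis. (y ?x \<bullet> i) *\<^sub>R t' i u + (y' u \<bullet> i) *\<^sub>R t i ?x)) (at (cmap (chart_at A p) p))"
      unfolding c_def[symmetric]
      by (intro has_derivative_sum has_derivative_scaleR t' has_derivative_inner_left y')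
  next
    fix q assume "q \<in> cdom (chart_at A p)"
    then have q: "q \<in> cdom c" by (simp add: c_def)
    show "(\<Sum>i\<in>Basis. (y (cmap (chart_at A p) q) \<bullet> i) *\<^sub>R t i (cmap (chart_at A p) q))
        = to_coord A c q (T q (Y q))"
      unfolding c_def[symmetric] exp[OF q, symmetric]
      by (simp add: t_def y_def cinv_cmap[OF A c(1) q] from_to_coord[OF A c(1) q])
  qed
  have "point_deriv A p (\<lambda>q. to_coord A c q (T q (Y q))) u = t' (Y p) u + T p (y' u)"
    unfolding d3 using tt[of "Y p"] exp[OF c(2), of "y' u"] by (simp add: sum.distrib yp cT)
  then show ?thesis
    unfolding nabla_endo_def nab d0 d1 d2
    by (simp add: const_field_self[OF A] linear_add[OF linT])
qed

end

theory Submission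
  imports Defs
begin

text \<open>
  Write \<open>\<omega> = g(J \<cdot>, \<cdot>)\<close> and \<open>\<Psi> = g(G(\<cdot>, \<cdot>), \<cdot>)\<close>, so that \<open>3 \<Psi> = d\<omega>\<close>. The algebraic identities for \<open>G\<close>
  determine \<open>\<nabla>\<Psi>\<close> up to a one-form, which vanishes because \<open>\<Psi>\<close> is closed: \<open>\<nabla>\<^sub>X\<Psi> = - X \<and> \<omega>\<close>. With the
  formulas of Gauss and Weingarten this expresses \<open>\<nabla>\<phi>\<close> through \<open>S\<close> and the differentials of \<open>a, b, c\<close>.
  Put \<open>\<epsilon> = 1\<close> in the nearly Sasakian and \<open>\<epsilon> = 0\<close> in the nearly cosymplectic case. As \<open>\<phi>\<^sub>1, \<phi>\<^sub>2, \<phi>\<^sub>3\<close> act on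
  \<open>ker \<eta>\<close> like quaternion units and \<open>S\<close> is symmetric, the condition on \<open>\<nabla>\<phi>\<close> forces
  \<open>S = \<mu> Id + (\<nu> - \<mu>) \<eta> \<otimes> \<xi>\<close> with \<open>a \<mu> = \<epsilon> - c\<close>, \<open>da = 0\<close>, \<open>db = c (\<nu> - \<mu>) \<eta>\<close> and \<open>dc = - b (\<nu> - \<mu>) \<eta>\<close>.
  Finally \<open>d\<eta> = 2 (\<Phi>\<^sub>3 + \<mu> \<Phi>\<^sub>1)\<close> for \<open>\<Phi>\<^sub>i = g(\<phi>\<^sub>i \<cdot>, \<cdot>)\<close>, and \<open>d\<^sup>2\<eta> = 0\<close> yields \<open>\<nu> = \<mu>\<close> and \<open>d\<mu> = 0\<close>. So \<open>M\<close> is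
  totally umbilical and \<open>\<mu>, a, b, c\<close> are constants with \<open>a \<mu> = \<epsilon> - c\<close>, which gives all the families; in
  particular \<open>\<phi> = - \<phi>\<^sub>1\<close> falls under (3)(c) and (4)(c) with \<open>t = \<pi>\<close>.
\<close>

section \<open>Calculus of smooth maps\<close>

text \<open>Vector-valued tensors are lowered with the metric to scalar forms, because a scalar
  function can be differentiated without first expressing its values in one chart. One Leibniz rule
  for fields along a smooth map then serves both the ambient manifold (the identity map) and the
  hypersurface (the immersion). The smoothness of \<Psi> comes from 3 \<Psi> = d\<omega>, which
  writes it with first derivatives of \<omega>; d\<Psi> = 0 and d(d\<eta>) = 0 both reduce to the
  symmetry of second partial derivatives in a chart. The last obstacle is regularity. The condition
  on \<nabla>\<phi> is exploited at each point separately and produces \<mu> and \<nu> as bare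
  functions, so \<mu> must first be recovered from d\<eta> as a quotient of differentiable functions
  before d(d\<eta>) = 0 makes sense as an equation for d\<mu>. This equation is what the pointwise
  algebra cannot give; it is decisive because ker \<eta> has dimension four and so leaves room for
  two further directions orthogonal to a given one. Connectedness enters afterwards, to turn
  vanishing differentials into constants.\<close>

lemma differentiable_imp_has_derivative:
  "h differentiable (at x) \<Longrightarrow> (h has_derivative frechet_derivative h (at x)) (at x)"
  using frechet_derivative_works by blast

lemma frechet_derivative_eqI:
  "(h has_derivative h') (at x) \<Longrightarrow> frechet_derivative h (at x) = h'"
  using frechet_derivative_at by metis

section \<open>Closure properties of C^k and smooth maps\<close>

lemma C_k_on_cong:
  assumes "open U" "\<And>x. x \<in> U \<Longrightarrow> h x = k x" "C_k_on n U h"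
  shows "C_k_on n U k"
  using assms(2,3)
proof (induction n arbitrary: h k)
  case 0
  then show ?case using continuous_on_cong by (metis C_k_on.simps(1))
next
  case (Suc n)
  have "k differentiable (at x)" if "x \<in> U" for x
    using Suc.prems that assms(1)
    by (metis C_k_on.simps(2) differentiable_def has_derivative_transform_within_open)
  moreover have "frechet_derivative h (at x) v = frechet_derivative k (at x) v" if "x \<in> U" for x v
    using frechet_derivative_transform_within_open[of h x U k] Suc.prems that assms(1) by auto
  then have "C_k_on n U (\<lambda>x. frechet_derivative k (at x) v)" for v
    using Suc.IH[of "\<lambda>x. frechet_derivative h (at x) v"] Suc.prems(2) by simp
  ultimately show ?case by simp
qed

lemma C_k_on_SucD: "C_k_on (Suc n) U h \<Longrightarrow> C_k_on n U h"
proof (induction n arbitrary: h)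
  case 0
  then show ?case
    by (auto intro!: continuous_at_imp_continuous_on differentiable_imp_continuous_within)
qed auto

lemma C_k_on_const: "C_k_on n U (\<lambda>x. c)"
  by (induction n arbitrary: c) auto

text \<open>Serves functions along an immersion, which near each point have to be written in a
  different target chart.\<close>

lemma C_k_on_local:
  assumes "\<And>x. x \<in> U \<Longrightarrow> \<exists>V. open V \<and> x \<in> V \<and> C_k_on n V h"
  shows "C_k_on n U h"
  using assms
proof (induction n arbitrary: h)
  case 0
  have "isCont h x" if "x \<in> U" for x
    using 0[OF that] continuous_on_eq_continuous_at by (metis C_k_on.simps(1))
  then show ?case by (simp add: continuous_at_imp_continuous_on)
next
  case (Suc n)
  have "C_k_on n U (\<lambda>x. frechet_derivative h (at x) v)" for v
    by (rule Suc.IH) (use Suc.prems in \<open>metis C_k_on.simps(2)\<close>)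
  then show ?case using Suc.prems by (metis C_k_on.simps(2))
qed

lemma C_k_on_subset: "C_k_on n U h \<Longrightarrow> V \<subseteq> U \<Longrightarrow> C_k_on n V h"
  by (induction n arbitrary: h) (auto intro: continuous_on_subset)

lemma C_k_on_add:
  assumes "open U" "C_k_on n U h" "C_k_on n U k"
  shows "C_k_on n U (\<lambda>x. h x + k x)"
  using assms(2,3)
proof (induction n arbitrary: h k)
  case 0
  then show ?case by (simp add: continuous_on_add)
next
  case (Suc n)
  have "C_k_on n U (\<lambda>x. frechet_derivative (\<lambda>x. h x + k x) (at x) v)" for v
  proof (rule C_k_on_cong[OF assms(1)])
    show "C_k_on n U (\<lambda>x. frechet_derivative h (at x) v + frechet_derivative k (at x) v)"
      using Suc by simp
    show "frechet_derivative h (at x) v + frechet_derivative k (at x) v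
        = frechet_derivative (\<lambda>x. h x + k x) (at x) v" if "x \<in> U" for x
      using frechet_derivative_eqI[OF has_derivative_add[OF
          differentiable_imp_has_derivative[of h x] differentiable_imp_has_derivative[of k x]]]
        Suc.prems that by simp
  qed
  then show ?case using Suc.prems by auto
qed

text \<open>The derivative of a product is a sum of products of the same kind, so a single induction
  covers multiplication, scaling and inner products.\<close>

lemma C_k_on_bounded_bilinear:
  assumes "bounded_bilinear pr" "open U" "C_k_on n U h" "C_k_on n U k"
  shows "C_k_on n U (\<lambda>x. pr (h x) (k x))"
  using assms(3,4)
proof (induction n arbitrary: h k)
  case 0
  then show ?case using bounded_bilinear.continuous_on[OF assms(1)] by auto
next
  case (Suc n)
  have hd: "((\<lambda>x. pr (h x) (k x)) has_derivative
      (\<lambda>v. pr (h x) (frechet_derivative k (at x) v) + pr (frechet_derivative h (at x) v) (k x))) (at x)"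
    if "x \<in> U" for x
    using Suc.prems that
    by (intro bounded_bilinear.FDERIV[OF assms(1)] differentiable_imp_has_derivative) auto
  have "C_k_on n U (\<lambda>x. frechet_derivative (\<lambda>x. pr (h x) (k x)) (at x) v)" for v
  proof (rule C_k_on_cong[OF assms(2)])
    show "C_k_on n U (\<lambda>x. pr (h x) (frechet_derivative k (at x) v) + pr (frechet_derivative h (at x) v) (k x))"
      using Suc.IH Suc.prems C_k_on_SucD[OF Suc.prems(1)] C_k_on_SucD[OF Suc.prems(2)]
      by (intro C_k_on_add assms) auto
  qed (simp add: frechet_derivative_eqI[OF hd])
  then show ?case using differentiableI[OF hd] by simp
qed

lemma C_k_on_sum:
  assumes "open U" "\<And>i. i \<in> I \<Longrightarrow> C_k_on n U (h i)"
  shows "C_k_on n U (\<lambda>x. \<Sum>i\<in>I. h i x)"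
  using assms(2)
  by (induction I rule: infinite_finite_induct) (simp_all add: C_k_on_const C_k_on_add[OF assms(1)])

text \<open>\<open>C_k_on\<close> differentiates along fixed vectors, whereas the chain rule applies
  the derivative of \<open>k\<close> to the moving vector
  \<open>frechet_derivative h (at x) v\<close>. Expanding that vector in a basis restores fixed
  directions; hence the Euclidean middle space.\<close>

lemma C_k_on_compose:
  fixes h :: "'a::real_normed_vector \<Rightarrow> 'b::euclidean_space"
    and k :: "'b \<Rightarrow> 'c::real_normed_vector"
  assumes U: "open U" and "C_k_on n U h" "C_k_on n V k" and sub: "h ` U \<subseteq> V"
  shows "C_k_on n U (\<lambda>x. k (h x))"
  using assms(2,3)
proof (induction n arbitrary: k)
  case 0
  then show ?case using continuous_on_compose2[OF _ _ sub] by auto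
next
  case (Suc n)
  have hd: "((\<lambda>x. k (h x)) has_derivative
      (\<lambda>v. frechet_derivative k (at (h x)) (frechet_derivative h (at x) v))) (at x)"
    if "x \<in> U" for x
  proof -
    have "h differentiable (at x)" "k differentiable (at (h x))" using Suc.prems sub that by auto
    from this[THEN differentiable_imp_has_derivative] show ?thesis by (rule has_derivative_compose)
  qed
  have lin: "linear (frechet_derivative k (at (h x)))" if "x \<in> U" for x
    using Suc.prems sub that by (intro linear_frechet_derivative) auto
  have "C_k_on n U (\<lambda>x. frechet_derivative (\<lambda>x. k (h x)) (at x) v)" for v
  proof (rule C_k_on_cong[OF U])
    show "C_k_on n U (\<lambda>x. \<Sum>i\<in>Basis. (frechet_derivative h (at x) v \<bullet> i) *\<^sub>R frechet_derivative k (at (h x)) i)"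
    proof (intro C_k_on_sum U C_k_on_bounded_bilinear[OF bounded_bilinear_scaleR])
      fix i :: 'b
      have "C_k_on n U (\<lambda>x. frechet_derivative h (at x) v)" using Suc.prems by simp
      then show "C_k_on n U (\<lambda>x. frechet_derivative h (at x) v \<bullet> i)"
        by (rule C_k_on_bounded_bilinear[OF bounded_bilinear_inner U _ C_k_on_const])
      have "C_k_on n V (\<lambda>y. frechet_derivative k (at y) i)" using Suc.prems by simp
      then show "C_k_on n U (\<lambda>x. frechet_derivative k (at (h x)) i)"
        using Suc.IH[OF C_k_on_SucD[OF Suc.prems(1)]] by blast
    qed
    show "(\<Sum>i\<in>Basis. (frechet_derivative h (at x) v \<bullet> i) *\<^sub>R frechet_derivative k (at (h x)) i)
       = frechet_derivative (\<lambda>x. k (h x)) (at x) v" if "x \<in> U" for x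
    proof -
      have "(\<Sum>i\<in>Basis. (frechet_derivative h (at x) v \<bullet> i) *\<^sub>R frechet_derivative k (at (h x)) i)
          = frechet_derivative k (at (h x)) (frechet_derivative h (at x) v)"
        using linear_sum[OF lin[OF that], of "\<lambda>i. (frechet_derivative h (at x) v \<bullet> i) *\<^sub>R i" Basis]
          linear_scale[OF lin[OF that]] by (simp add: euclidean_representation)
      then show ?thesis by (simp add: frechet_derivative_eqI[OF hd[OF that]])
    qed
  qed
  then show ?case using differentiableI[OF hd] by simp
qed

lemma C_k_on_inverse:
  fixes h :: "'a::real_normed_vector \<Rightarrow> real"
  assumes U: "open U" and "C_k_on n U h" and nz: "\<And>x. x \<in> U \<Longrightarrow> h x \<noteq> 0"
  shows "C_k_on n U (\<lambda>x. inverse (h x))"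
  using assms(2)
proof (induction n)
  case 0
  then show ?case using continuous_on_inverse[of U h] nz by auto
next
  case (Suc n)
  have hd: "((\<lambda>x. inverse (h x)) has_derivative
      (\<lambda>v. - (inverse (h x) * frechet_derivative h (at x) v * inverse (h x)))) (at x)"
    if "x \<in> U" for x
    using Suc.prems nz[OF that] that
    by (intro Deriv.has_derivative_inverse differentiable_imp_has_derivative) auto
  \<comment> \<open>The derivative of the inverse contains the inverse itself, one order
    lower.\<close>
  note I = Suc.IH[OF C_k_on_SucD[OF Suc.prems]]
  have "C_k_on n U (\<lambda>x. frechet_derivative (\<lambda>x. inverse (h x)) (at x) v)" for v
  proof (rule C_k_on_cong[OF U])
    show "C_k_on n U (\<lambda>x. (-1) * (inverse (h x) * frechet_derivative h (at x) v * inverse (h x)))"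
      using Suc.prems by (intro C_k_on_bounded_bilinear[OF bounded_bilinear_mult] U I C_k_on_const) auto
    show "(-1) * (inverse (h x) * frechet_derivative h (at x) v * inverse (h x))
        = frechet_derivative (\<lambda>x. inverse (h x)) (at x) v" if "x \<in> U" for x
      by (simp add: frechet_derivative_eqI[OF hd[OF that]])
  qed
  then show ?case using differentiableI[OF hd] by simp
qed

lemma smooth_on_cong:
  "open U \<Longrightarrow> (\<And>x. x \<in> U \<Longrightarrow> h x = k x) \<Longrightarrow> smooth_on U h \<Longrightarrow> smooth_on U k"
  unfolding smooth_on_def using C_k_on_cong by blast

lemma smooth_on_subset: "smooth_on U h \<Longrightarrow> V \<subseteq> U \<Longrightarrow> smooth_on V h"
  unfolding smooth_on_def using C_k_on_subset by blast

lemma smooth_on_local: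
  assumes "\<And>x. x \<in> U \<Longrightarrow> \<exists>V. open V \<and> x \<in> V \<and> smooth_on V h"
  shows "smooth_on U h"
  unfolding smooth_on_def
  by (intro allI C_k_on_local) (use assms in \<open>auto simp: smooth_on_def\<close>)

lemma smooth_on_const: "smooth_on U (\<lambda>x. c)"
  unfolding smooth_on_def by (auto intro!: C_k_on_const)

lemma smooth_on_deriv: "smooth_on U h \<Longrightarrow> smooth_on U (\<lambda>x. frechet_derivative h (at x) v)"
  unfolding smooth_on_def using C_k_on.simps(2) by blast

lemma smooth_on_add:
  "open U \<Longrightarrow> smooth_on U h \<Longrightarrow> smooth_on U k \<Longrightarrow> smooth_on U (\<lambda>x. h x + k x)"
  unfolding smooth_on_def by (auto intro!: C_k_on_add)

lemma smooth_on_sum: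
  "open U \<Longrightarrow> (\<And>i. i \<in> I \<Longrightarrow> smooth_on U (h i)) \<Longrightarrow> smooth_on U (\<lambda>x. \<Sum>i\<in>I. h i x)"
  unfolding smooth_on_def using C_k_on_sum[of U I _ h] by blast

lemma smooth_on_scaleR:
  "open U \<Longrightarrow> smooth_on U h \<Longrightarrow> smooth_on U k \<Longrightarrow> smooth_on U (\<lambda>x. h x *\<^sub>R k x)"
  unfolding smooth_on_def by (auto intro!: C_k_on_bounded_bilinear[OF bounded_bilinear_scaleR])

lemma smooth_on_inner:
  "open U \<Longrightarrow> smooth_on U h \<Longrightarrow> smooth_on U k \<Longrightarrow> smooth_on U (\<lambda>x. h x \<bullet> k x)"
  unfolding smooth_on_def by (auto intro!: C_k_on_bounded_bilinear[OF bounded_bilinear_inner])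

lemma smooth_on_mult:
  fixes h :: "'a::real_normed_vector \<Rightarrow> real"
  shows "open U \<Longrightarrow> smooth_on U h \<Longrightarrow> smooth_on U k \<Longrightarrow> smooth_on U (\<lambda>x. h x * k x)"
  using smooth_on_scaleR[of U h k] by simp

lemma smooth_on_minus:
  assumes "open U" "smooth_on U h"
  shows "smooth_on U (\<lambda>x. - h x)"
  using smooth_on_scaleR[OF assms(1) smooth_on_const[of U "-1"] assms(2)] by simp

lemma smooth_on_prod:
  fixes h :: "'i \<Rightarrow> 'a::real_normed_vector \<Rightarrow> real"
  assumes "open U" "\<And>i. i \<in> I \<Longrightarrow> smooth_on U (h i)"
  shows "smooth_on U (\<lambda>x. \<Prod>i\<in>I. h i x)"
  using assms(2)
  by (induction I rule: infinite_finite_induct)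
    (simp_all add: smooth_on_const smooth_on_mult[OF assms(1)])

lemma smooth_on_divide:
  fixes h :: "'a::real_normed_vector \<Rightarrow> real"
  assumes "open U" "smooth_on U h" "smooth_on U k" "\<And>x. x \<in> U \<Longrightarrow> k x \<noteq> 0"
  shows "smooth_on U (\<lambda>x. h x / k x)"
  unfolding divide_inverse using assms C_k_on_inverse[OF assms(1)]
  by (intro smooth_on_mult) (auto simp: smooth_on_def)

lemma smooth_on_compose:
  fixes h :: "'a::real_normed_vector \<Rightarrow> 'b::euclidean_space"
  shows "open U \<Longrightarrow> smooth_on U h \<Longrightarrow> smooth_on V k \<Longrightarrow> h ` U \<subseteq> V \<Longrightarrow> smooth_on U (\<lambda>x. k (h x))"
  unfolding smooth_on_def using C_k_on_compose[of U _ h V k] by blast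

text \<open>Smoothness of a tensor is required on constant vectors only; a basis expansion extends
  it to varying arguments. Several arguments are treated one slot at a time.\<close>

lemma smooth_on_linear_family:
  fixes h :: "'a::real_normed_vector \<Rightarrow> 'b::euclidean_space"
  assumes U: "open U" and lin: "\<And>x. x \<in> U \<Longrightarrow> linear (T x)"
    and T: "\<And>v. smooth_on U (\<lambda>x. T x v)" and h: "smooth_on U h"
  shows "smooth_on U (\<lambda>x. T x (h x))"
proof (rule smooth_on_cong[OF U])
  show "smooth_on U (\<lambda>x. \<Sum>i\<in>Basis. (h x \<bullet> i) *\<^sub>R T x i)"
    by (intro smooth_on_sum smooth_on_scaleR smooth_on_inner smooth_on_const U h T)
  show "(\<Sum>i\<in>Basis. (h x \<bullet> i) *\<^sub>R T x i) = T x (h x)" if "x \<in> U" for x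
    using linear_sum[OF lin[OF that], of "\<lambda>i. (h x \<bullet> i) *\<^sub>R i" Basis] linear_scale[OF lin[OF that]]
    by (simp add: euclidean_representation)
qed

lemma has_derivative_linear_family:
  fixes h :: "'a::real_normed_vector \<Rightarrow> 'b::euclidean_space"
  assumes U: "open U" "x \<in> U" and lin: "\<And>x. x \<in> U \<Longrightarrow> linear (T x)"
    and T: "\<And>v. ((\<lambda>x. T x v) has_derivative T' v) (at x)" and h: "(h has_derivative h') (at x)"
  shows "((\<lambda>x. T x (h x)) has_derivative (\<lambda>u. T' (h x) u + T x (h' u))) (at x)"
proof -
  have ex: "T y v = (\<Sum>i\<in>Basis. (v \<bullet> i) *\<^sub>R T y i)" if "y \<in> U" for y v
    using linear_sum[OF lin[OF that], of "\<lambda>i. (v \<bullet> i) *\<^sub>R i" Basis] linear_scale[OF lin[OF that]]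
    by (simp add: euclidean_representation)
  have 1: "((\<lambda>y. \<Sum>i\<in>Basis. (k y \<bullet> i) *\<^sub>R T y i) has_derivative
      (\<lambda>u. \<Sum>i\<in>Basis. (k x \<bullet> i) *\<^sub>R T' i u + (k' u \<bullet> i) *\<^sub>R T x i)) (at x)"
    if "(k has_derivative k') (at x)" for k k'
    by (intro has_derivative_sum has_derivative_scaleR T has_derivative_inner_left that)
  \<comment> \<open>The sum formula with a constant argument shows that \<open>T' v\<close> is
    linear in \<open>v\<close>, although \<open>T'\<close> was given separately for each
    \<open>v\<close>.\<close>
  have "((\<lambda>y. T y v) has_derivative (\<lambda>u. \<Sum>i\<in>Basis. (v \<bullet> i) *\<^sub>R T' i u)) (at x)" for v
  proof (rule has_derivative_transform_within_open[OF _ U])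
    show "((\<lambda>y. \<Sum>i\<in>Basis. (v \<bullet> i) *\<^sub>R T y i) has_derivative
        (\<lambda>u. \<Sum>i\<in>Basis. (v \<bullet> i) *\<^sub>R T' i u)) (at x)"
      using 1[OF has_derivative_const[of v]] by simp
  qed (simp only: ex[symmetric])
  from has_derivative_unique[OF T this]
  have T': "T' v u = (\<Sum>i\<in>Basis. (v \<bullet> i) *\<^sub>R T' i u)" for u v
    by (rule fun_cong)
  have "((\<lambda>y. T y (h y)) has_derivative
      (\<lambda>u. \<Sum>i\<in>Basis. (h x \<bullet> i) *\<^sub>R T' i u + (h' u \<bullet> i) *\<^sub>R T x i)) (at x)"
    by (rule has_derivative_transform_within_open[OF 1[OF h] U]) (simp add: ex[symmetric])
  then show ?thesis by (simp only: sum.distrib T'[symmetric] ex[OF U(2), symmetric])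
qed

section \<open>Determinants and raising an index smoothly\<close>

lemma smooth_on_det:
  fixes M :: "'a::real_normed_vector \<Rightarrow> real^'n^'n"
  assumes "open U" "\<And>i j. smooth_on U (\<lambda>x. M x $ i $ j)"
  shows "smooth_on U (\<lambda>x. det (M x))"
  unfolding det_def by (intro smooth_on_sum smooth_on_mult smooth_on_prod assms smooth_on_const)

lemma linear_cart_expand:
  fixes v :: "real^'n"
  assumes "linear L"
  shows "L v = (\<Sum>j\<in>UNIV. (v $ j) *\<^sub>R L (axis j 1))"
proof -
  have "L v = L (\<Sum>j\<in>UNIV. (v $ j) *\<^sub>R axis j 1)"
    using basis_expansion[of v] by (simp add: scalar_mult_eq_scaleR)
  also have "\<dots> = (\<Sum>j\<in>UNIV. (v $ j) *\<^sub>R L (axis j 1))"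
    by (simp only: linear_sum[OF assms] linear_scale[OF assms])
  finally show ?thesis .
qed

lemma smooth_on_cartI:
  fixes h :: "'a::real_normed_vector \<Rightarrow> real^'n"
  assumes "open U" "\<And>i. smooth_on U (\<lambda>x. h x $ i)"
  shows "smooth_on U h"
proof (rule smooth_on_cong[OF assms(1)])
  show "smooth_on U (\<lambda>x. \<Sum>i\<in>UNIV. (h x $ i) *\<^sub>R axis i 1)"
    by (intro smooth_on_sum smooth_on_scaleR assms smooth_on_const)
  show "(\<Sum>i\<in>UNIV. (h x $ i) *\<^sub>R axis i 1) = h x" for x
    using linear_cart_expand[OF linear_ident, of "h x"] by simp
qed

text \<open>The components of \<open>h\<close> solve a linear system whose matrix is the Gram matrix
  of \<open>b x\<close>; Cramer's rule writes them as quotients of smooth determinants. A vector in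
  the kernel of the matrix would satisfy \<open>b x v v = 0\<close>, so the denominator does not
  vanish.\<close>

lemma smooth_on_dual:
  fixes h :: "'a::real_normed_vector \<Rightarrow> real^'n"
  assumes U: "open U" and bil: "\<And>x. x \<in> U \<Longrightarrow> bilinear (b x)"
    and nd: "\<And>x v. x \<in> U \<Longrightarrow> v \<noteq> 0 \<Longrightarrow> b x v v \<noteq> (0::real)"
    and b: "\<And>v w. smooth_on U (\<lambda>x. b x v w)"
    and h: "\<And>w. smooth_on U (\<lambda>x. b x (h x) w)"
  shows "smooth_on U h"
proof (rule smooth_on_cartI[OF U])
  define M where "M x = (\<chi> i j. b x (axis j 1) (axis i 1))" for x
  define y where "y x = (\<chi> i. b x (h x) (axis i 1))" for x
  have Mv: "(M x *v v) $ i = b x v (axis i 1)" if x: "x \<in> U" for x v i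
  proof -
    have lin: "linear (\<lambda>v. b x v (axis i 1))" using bil[OF x] unfolding bilinear_def by blast
    show ?thesis by (simp add: matrix_vector_mult_def M_def mult.commute linear_cart_expand[OF lin, of v])
  qed
  have det: "det (M x) \<noteq> 0" if x: "x \<in> U" for x
  proof -
    have "v = 0" if "M x *v v = 0" for v
    proof -
      have lin: "linear (b x v)" using bil[OF x] unfolding bilinear_def by blast
      have "b x v (axis i 1) = 0" for i using Mv[OF x, of v i] that by simp
      then have "b x v v = 0" using linear_cart_expand[OF lin, of v] by simp
      then show ?thesis using nd[OF x] by blast
    qed
    then show ?thesis by (metis invertible_det_nz invertible_left_inverse matrix_left_invertible_ker)
  qed
  have sol: "M x *v h x = y x" if "x \<in> U" for x
    using Mv[OF that] by (simp add: vec_eq_iff y_def)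
  fix k
  show "smooth_on U (\<lambda>x. h x $ k)"
  proof (rule smooth_on_cong[OF U])
    show "smooth_on U (\<lambda>x. det (\<chi> i j. if j = k then y x $ i else M x $ i $ j) / det (M x))"
    proof (intro smooth_on_divide U smooth_on_det det)
      show "smooth_on U (\<lambda>x. M x $ i $ j)" for i j by (simp add: M_def b)
      show "smooth_on U (\<lambda>x. (\<chi> i j. if j = k then y x $ i else M x $ i $ j) $ i $ j)" for i j
        by (cases "j = k") (simp_all add: M_def y_def b h)
    qed
    show "det (\<chi> i j. if j = k then y x $ i else M x $ i $ j) / det (M x) = h x $ k" if "x \<in> U" for x
      using cramer[OF det[OF that], of "h x" "y x"] sol[OF that] by simp
  qed
qed

text \<open>The second difference over the parallelogram with sides t v and t w is symmetric in v
  and w. By the mean value theorem it equals t^2 times \<open>A w\<close> up to o(t^2), and likewise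
  t^2 times \<open>B v\<close>.\<close>

lemma symmetric_second_derivative_real:
  fixes h :: "'a::real_normed_vector \<Rightarrow> real"
  assumes U: "open U" "x \<in> U" and h: "\<And>y. y \<in> U \<Longrightarrow> (h has_derivative h' y) (at y)"
    and A: "((\<lambda>y. h' y v) has_derivative A) (at x)" and B: "((\<lambda>y. h' y w) has_derivative B) (at x)"
  shows "A w = B v"
proof -
  obtain r where r: "r > 0" "ball x r \<subseteq> U" using U open_contains_ball by blast
  define D where "D t = h (x + t *\<^sub>R v + t *\<^sub>R w) - h (x + t *\<^sub>R v) - h (x + t *\<^sub>R w) + h x" for t
  have key: "\<exists>d>0. \<forall>t. 0 < t \<and> t < d \<longrightarrow>
      \<bar>h (x + t *\<^sub>R v + t *\<^sub>R w) - h (x + t *\<^sub>R v) - h (x + t *\<^sub>R w) + h x - t\<^sup>2 * A w\<bar> \<le> e * (2 * norm v + norm w) * t\<^sup>2"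
    if A: "((\<lambda>y. h' y v) has_derivative A) (at x)" and e: "e > 0" for A v w and e :: real
  proof -
    obtain d where d: "d > 0" "\<And>y. norm (y - x) < d \<Longrightarrow> norm (h' y v - h' x v - A (y - x)) \<le> e * norm (y - x)"
      using A e unfolding has_derivative_at_alt by blast
    have linA: "linear A" using A has_derivative_linear by blast
    \<comment> \<open>The summand 1 keeps this positive when \<open>v\<close> and \<open>w\<close>
      are zero.\<close>
    let ?K = "norm v + norm w + 1"
    have K: "?K > 0" by (smt (verit) norm_ge_zero)
    show ?thesis
    proof (intro exI[of _ "min d r / ?K"] conjI allI impI)
      show "0 < min d r / ?K" using d r K by simp
      fix t assume t: "0 < t \<and> t < min d r / ?K"
      then have tK: "t * ?K < min d r" using K by (simp add: field_simps)
      have near: "norm (s *\<^sub>R v + s' *\<^sub>R w) < min d r" if "0 \<le> s" "s \<le> t" "0 \<le> s'" "s' \<le> t" for s s'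
      proof -
        have "norm (s *\<^sub>R v + s' *\<^sub>R w) \<le> s * norm v + s' * norm w"
          using that by (metis abs_of_nonneg norm_scaleR norm_triangle_ineq)
        also have "\<dots> \<le> t * norm v + t * norm w" using that by (simp add: add_mono mult_right_mono)
        also have "\<dots> \<le> t * ?K" using t by (simp add: algebra_simps)
        finally show ?thesis using tK by simp
      qed
      have inU: "x + s *\<^sub>R v + s' *\<^sub>R w \<in> U" if "0 \<le> s" "s \<le> t" "0 \<le> s'" "s' \<le> t" for s s'
      proof -
        have "dist x (x + s *\<^sub>R v + s' *\<^sub>R w) < r"
          using near[OF that] by (simp add: dist_norm add.assoc norm_minus_commute)
             (metis add_diff_cancel_left' norm_minus_commute diff_diff_eq2 diff_add_cancel add.assoc)
        then show ?thesis using r(2) by auto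
      qed
      \<comment> \<open>\<open>p t - p 0\<close> is the second difference. Applying the mean value
        theorem to \<open>p\<close> leaves a difference of first derivatives, which
        differentiability at the single point \<open>x\<close> controls.\<close>
      define p where "p s = h (x + s *\<^sub>R v + t *\<^sub>R w) - h (x + s *\<^sub>R v)" for s
      have pd: "(p has_real_derivative (h' (x + s *\<^sub>R v + t *\<^sub>R w) v - h' (x + s *\<^sub>R v) v)) (at s)"
        if "0 \<le> s" "s \<le> t" for s
      proof -
        have 1: "((\<lambda>s. h (x + s *\<^sub>R v + c *\<^sub>R w)) has_derivative (\<lambda>u. h' (x + s *\<^sub>R v + c *\<^sub>R w) (u *\<^sub>R v))) (at s)"
          if "0 \<le> c" "c \<le> t" for c
          by (rule has_derivative_compose[OF _ h]) (auto intro!: derivative_eq_intros inU \<open>0 \<le> s\<close> \<open>s \<le> t\<close> that)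
        have l: "linear (h' (x + s *\<^sub>R v + c *\<^sub>R w))" if "0 \<le> c" "c \<le> t" for c
          using has_derivative_linear[OF h[OF inU]] \<open>0 \<le> s\<close> \<open>s \<le> t\<close> that by blast
        have "(p has_derivative (\<lambda>u. h' (x + s *\<^sub>R v + t *\<^sub>R w) (u *\<^sub>R v) - h' (x + s *\<^sub>R v) (u *\<^sub>R v))) (at s)"
          unfolding p_def using has_derivative_diff[OF 1[of t] 1[of 0]] t by simp
        moreover have "(\<lambda>u. h' (x + s *\<^sub>R v + t *\<^sub>R w) (u *\<^sub>R v) - h' (x + s *\<^sub>R v) (u *\<^sub>R v))
            = (*) (h' (x + s *\<^sub>R v + t *\<^sub>R w) v - h' (x + s *\<^sub>R v) v)"
          using linear_scale[OF l[of t]] linear_scale[OF l[of 0]] t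
          by (intro ext) (simp add: left_diff_distrib)
        ultimately show ?thesis unfolding has_field_derivative_def by simp
      qed
      obtain s where s: "0 < s" "s < t" "p t - p 0 = (t - 0) * (h' (x + s *\<^sub>R v + t *\<^sub>R w) v - h' (x + s *\<^sub>R v) v)"
        using MVT2[of 0 t p, OF _ pd] t by auto
      let ?y = "x + s *\<^sub>R v + t *\<^sub>R w" and ?z = "x + s *\<^sub>R v"
      have ny: "norm (?y - x) < d" and nz: "norm (?z - x) < d"
        using near[of s t] near[of s 0] s t by (auto simp: add.assoc)
      have "\<bar>h' ?y v - h' ?z v - A (t *\<^sub>R w)\<bar> \<le> e * norm (?y - x) + e * norm (?z - x)"
      proof -
        have "A (?y - x) - A (?z - x) = A (t *\<^sub>R w)" by (simp add: linear_diff[OF linA, symmetric])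
        then show ?thesis using d(2)[OF ny] d(2)[OF nz] by simp
      qed
      also have "\<dots> \<le> e * (t * (norm v + norm w)) + e * (t * norm v)"
      proof (intro add_mono mult_left_mono)
        show "norm (?z - x) \<le> t * norm v" using s by (simp add: mult_right_mono)
        have "norm (?y - x) \<le> s * norm v + t * norm w"
          using s t norm_triangle_ineq[of "s *\<^sub>R v" "t *\<^sub>R w"] by (simp add: add.assoc)
        also have "\<dots> \<le> t * norm v + t * norm w" using s by (simp add: mult_right_mono)
        finally show "norm (?y - x) \<le> t * (norm v + norm w)" by (simp add: algebra_simps)
      qed (use e in auto)
      also have "\<dots> = e * (2 * norm v + norm w) * t" by (simp add: algebra_simps)
      finally have "t * \<bar>h' ?y v - h' ?z v - A (t *\<^sub>R w)\<bar> \<le> t * (e * (2 * norm v + norm w) * t)"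
        using t by (intro mult_left_mono) auto
      moreover have "t * \<bar>h' ?y v - h' ?z v - A (t *\<^sub>R w)\<bar> = \<bar>t * (h' ?y v - h' ?z v - A (t *\<^sub>R w))\<bar>"
        using t by (simp add: abs_mult)
      moreover have "t * (h' ?y v - h' ?z v - A (t *\<^sub>R w)) =
          h (x + t *\<^sub>R v + t *\<^sub>R w) - h (x + t *\<^sub>R v) - h (x + t *\<^sub>R w) + h x - t\<^sup>2 * A w"
        using s(3) linear_scale[OF linA] by (simp add: p_def power2_eq_square algebra_simps)
      ultimately show "\<bar>h (x + t *\<^sub>R v + t *\<^sub>R w) - h (x + t *\<^sub>R v) - h (x + t *\<^sub>R w) + h x - t\<^sup>2 * A w\<bar> \<le> e * (2 * norm v + norm w) * t\<^sup>2"
        by (simp add: power2_eq_square algebra_simps)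
    qed
  qed
  have "\<bar>A w - B v\<bar> \<le> e * (3 * (norm v + norm w))" if e: "e > 0" for e
  proof -
    obtain d1 where d1: "d1 > 0"
      "\<And>t. 0 < t \<and> t < d1 \<Longrightarrow> \<bar>D t - t\<^sup>2 * A w\<bar> \<le> e * (2 * norm v + norm w) * t\<^sup>2"
      using key[OF A e, of w] unfolding D_def by blast
    \<comment> \<open>The symmetry of the second difference lets the same estimate be used with the
      roles of \<open>v\<close> and \<open>w\<close> exchanged.\<close>
    have D: "D t = h (x + t *\<^sub>R w + t *\<^sub>R v) - h (x + t *\<^sub>R w) - h (x + t *\<^sub>R v) + h x" for t
      unfolding D_def by (simp add: add.commute add.left_commute)
    obtain d2 where d2: "d2 > 0"
      "\<And>t. 0 < t \<and> t < d2 \<Longrightarrow> \<bar>D t - t\<^sup>2 * B v\<bar> \<le> e * (2 * norm w + norm v) * t\<^sup>2"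
      using key[OF B e, of v] unfolding D by blast
    define t where "t = min d1 d2 / 2"
    have t: "0 < t" "t < d1" "t < d2" using d1(1) d2(1) by (auto simp: t_def)
    have "\<bar>t\<^sup>2 * (A w - B v)\<bar> \<le> t\<^sup>2 * (e * (3 * (norm v + norm w)))"
    proof -
      have "\<bar>t\<^sup>2 * A w - t\<^sup>2 * B v\<bar> \<le> e * (2 * norm v + norm w) * t\<^sup>2 + e * (2 * norm w + norm v) * t\<^sup>2"
        using d1(2)[of t] d2(2)[of t] t by linarith
      then show ?thesis by (simp add: algebra_simps)
    qed
    then show ?thesis using t by (simp add: abs_mult)
  qed
  note le = this
  have "\<bar>A w - B v\<bar> \<le> 0"
  proof (rule field_le_epsilon)
    fix e :: real assume e: "e > 0"
    let ?K = "3 * (norm v + norm w) + 1"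
    have K: "?K > 0" by (simp add: add_nonneg_pos)
    have "\<bar>A w - B v\<bar> \<le> e / ?K * (3 * (norm v + norm w))" using le[of "e / ?K"] e K by simp
    also have "\<dots> \<le> e / ?K * ?K" using e K by (intro mult_left_mono) auto
    also have "\<dots> = e" using K by simp
    finally show "\<bar>A w - B v\<bar> \<le> 0 + e" by simp
  qed
  then show ?thesis by simp
qed

lemma symmetric_second_derivative:
  fixes h :: "'a::real_normed_vector \<Rightarrow> 'b::euclidean_space"
  assumes U: "open U" "x \<in> U" and h: "smooth_on U h"
  shows "frechet_derivative (\<lambda>y. frechet_derivative h (at y) v) (at x) w
       = frechet_derivative (\<lambda>y. frechet_derivative h (at y) w) (at x) v"
proof (rule euclidean_eqI)
  fix i :: 'b
  have D: "(k has_derivative frechet_derivative k (at y)) (at y)" if "smooth_on U k" "y \<in> U"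
    for k :: "'a \<Rightarrow> 'b" and y
    using smooth_on_differentiable[OF that] frechet_derivative_works by blast
  show "frechet_derivative (\<lambda>y. frechet_derivative h (at y) v) (at x) w \<bullet> i
       = frechet_derivative (\<lambda>y. frechet_derivative h (at y) w) (at x) v \<bullet> i"
    by (rule symmetric_second_derivative_real[OF U, of "\<lambda>y. h y \<bullet> i" "\<lambda>y u. frechet_derivative h (at y) u \<bullet> i"])
      (rule has_derivative_inner_left, rule D, auto intro: h smooth_on_deriv U)+
qed

section \<open>Linear algebra of the tangent spaces\<close>

locale inner_form =
  fixes g :: "'e::euclidean_space \<Rightarrow> 'e \<Rightarrow> real"
  assumes bil: "bilinear g" and sym: "g u v = g v u" and pos: "u \<noteq> 0 \<Longrightarrow> g u u > 0"
begin

lemmas glin = bilinear_ladd[OF bil] bilinear_radd[OF bil] bilinear_lmul[OF bil] bilinear_rmul[OF bil]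
  bilinear_lneg[OF bil] bilinear_rneg[OF bil] bilinear_lsub[OF bil] bilinear_rsub[OF bil]
  bilinear_lzero[OF bil] bilinear_rzero[OF bil]

lemma g_linear: "linear (g u)"
  using bil unfolding bilinear_def by blast

lemma g_eqI: "(\<And>w. g x w = g y w) \<Longrightarrow> x = y"
  using pos[of "x - y"] by (force simp: glin)

text \<open>The orthogonal complement of the head is a subspace: it contains the span of the tail
  but not the head.\<close>

lemma independent_orthogonal:
  "sorted_wrt (\<lambda>x y. g x y = 0) l \<Longrightarrow> \<forall>x\<in>set l. g x x \<noteq> 0 \<Longrightarrow> independent (set l) \<and> distinct l"
proof (induction l)
  case (Cons x l)
  have "subspace {y. g x y = 0}"
    by (auto simp: subspace_def glin)
  then have "span (set l) \<subseteq> {y. g x y = 0}"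
    using Cons.prems by (intro span_minimal) auto
  then have x: "x \<notin> span (set l)" using Cons.prems by auto
  then have "x \<notin> set l" using span_base by blast
  then show ?case using Cons x by (simp add: independent_insert)
qed (simp add: independent_empty)

lemma length_orthogonal_le:
  assumes "sorted_wrt (\<lambda>x y. g x y = 0) l" "\<forall>x\<in>set l. g x x \<noteq> 0"
  shows "length l \<le> DIM('e)"
proof -
  have "card (set l) \<le> DIM('e)" using independent_orthogonal[OF assms] independent_card_le by blast
  then show ?thesis using independent_orthogonal[OF assms] distinct_card by metis
qed

lemma exists_orthogonal:
  assumes "1 < DIM('e)"
  shows "\<exists>e. e \<noteq> 0 \<and> g x e = 0"
proof (rule ccontr)
  assume n: "\<not> ?thesis"
  have "inj (g x)"
  proof (rule injI)
    fix u v assume "g x u = g x v"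
    then have "g x (u - v) = 0" by (simp add: glin)
    then have "u - v = 0" using n by blast
    then show "u = v" by simp
  qed
  then have "DIM('e) \<le> DIM(real)"
    using g_linear dim_image_eq[of "g x" UNIV] dim_subset_UNIV[of "range (g x)"]
    by (simp add: linear_iff)
  then show False using assms by simp
qed

end

text \<open>The structure on the tangent spaces of a nearly Kaehler manifold of constant type one.\<close>

locale hermitian_cross = inner_form g for g :: "'e::euclidean_space \<Rightarrow> 'e \<Rightarrow> real" +
  fixes J :: "'e \<Rightarrow> 'e" and G :: "'e \<Rightarrow> 'e \<Rightarrow> 'e"
  assumes J_linear: "linear J" and JJ: "J (J u) = - u" and J_iso: "g (J u) (J v) = g u v"
    and G_bil: "bilinear G" and G_skew: "G u v = - G v u"
    and g_G: "g (G u v) w = - g v (G u w)" and G_J: "G u (J v) = - J (G u v)"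
    and const_type: "g (G u v) (G u v) = g u u * g v v - (g u v)\<^sup>2 - (g (J u) v)\<^sup>2"
begin

lemmas Jlin = linear_add[OF J_linear] linear_scale[OF J_linear] linear_neg[OF J_linear]
  linear_diff[OF J_linear] linear_0[OF J_linear]

lemmas Glin = bilinear_ladd[OF G_bil] bilinear_radd[OF G_bil] bilinear_lmul[OF G_bil]
  bilinear_rmul[OF G_bil] bilinear_lneg[OF G_bil] bilinear_rneg[OF G_bil] bilinear_lsub[OF G_bil]
  bilinear_rsub[OF G_bil] bilinear_lzero[OF G_bil] bilinear_rzero[OF G_bil]

lemma g_J: "g u (J v) = - g (J u) v"
  using J_iso[of u "J v"] by (simp add: JJ glin)

lemma om_skew: "g (J u) v = - g (J v) u"
  using g_J[of v u] sym[of v "J u"] by simp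

lemma om_self [simp]: "g (J u) u = 0"
  using om_skew[of u u] by simp

lemma G_self [simp]: "G u u = 0"
proof -
  have "2 *\<^sub>R G u u = 0" using arg_cong[OF G_skew[of u u], of "\<lambda>v. G u u + v"] by (simp add: scaleR_2)
  then show ?thesis by simp
qed

lemma G_J_left: "G (J u) v = - J (G u v)"
  using G_skew[of "J u" v] G_J[of v u] G_skew[of v u] by (simp add: Jlin)

lemma psi_cyclic: "g (G u v) w = g (G v w) u"
  using g_G[of v u w] G_skew[of u v] sym[of u "G v w"] by (simp add: glin)

text \<open>Cyclic symmetry and skewness make \<Psi> alternating, and \<open>J\<close> passes from
  one argument to another; two arguments in a common complex line therefore annihilate it.\<close>

lemma psi_zero [simp]: "g (G u v) u = 0" "g (G u v) v = 0" "g (G u v) (J u) = 0" "g (G u v) (J v) = 0"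
proof -
  show 1: "g (G u v) u = 0" "g (G u v) v = 0"
    using psi_cyclic[of u u v] psi_cyclic[of v v u] psi_cyclic[of u v u] psi_cyclic[of u v v]
    by (simp_all add: glin)
  show "g (G u v) (J u) = 0"
    using psi_cyclic[of "J u" u v] by (simp add: G_J_left Jlin glin)
  show "g (G u v) (J v) = 0"
    using psi_cyclic[of u v "J v"] by (simp add: G_J Jlin glin)
qed

text \<open>Polarise \<open>const_type\<close> in its second argument and move \<open>G u\<close> to
  the other side by skew-adjointness.\<close>

lemma GG_self: "G u (G u v) = - (g u u *\<^sub>R v) + g u v *\<^sub>R u + g (J u) v *\<^sub>R J u"
proof (rule g_eqI)
  fix w
  have "g (G u v) (G u w) = g u u * g v w - g u v * g u w - g (J u) v * g (J u) w"
    using const_type[of u "v + w"] const_type[of u v] const_type[of u w] sym[of "G u w" "G u v"] sym[of w v]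
    by (simp add: Glin glin power2_eq_square algebra_simps)
  then show "g (G u (G u v)) w = g (- (g u u *\<^sub>R v) + g u v *\<^sub>R u + g (J u) v *\<^sub>R J u) w"
    using g_G[of u "G u v" w] by (simp add: glin)
qed

text \<open>Polarising \<open>GG_self\<close> determines only the part symmetric in \<open>z\<close>
  and \<open>x\<close>, so the defect \<tau> is skew in them. Moving \<open>J\<close> into the last
  slot costs opposite signs from \<open>z\<close> and from \<open>x\<close>, and skewness then
  forces \<tau> = 0.\<close>

lemma GG: "G z (G x y) = g z y *\<^sub>R x + g (J z) y *\<^sub>R J x - g z x *\<^sub>R y - g (J z) x *\<^sub>R J y"
proof (rule g_eqI)
  define \<tau> where "\<tau> z x y w =
    g (G z (G x y)) w - g z y * g x w - g (J z) y * g (J x) w + g z x * g y w + g (J z) x * g (J y) w" for z x y w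
  have s: "\<tau> z x y w = - \<tau> x z y w" for z x y w
    using arg_cong[OF GG_self[of "z + x" y], of "\<lambda>v. g v w"]
      arg_cong[OF GG_self[of z y], of "\<lambda>v. g v w"] arg_cong[OF GG_self[of x y], of "\<lambda>v. g v w"]
      om_skew[of z x] sym[of z x]
    unfolding \<tau>_def by (simp add: Glin glin Jlin algebra_simps)
  have J1: "\<tau> (J z) x y w = \<tau> z x y (J w)" for z x y w
    unfolding \<tau>_def using g_J[of "G z (G x y)" w] g_J[of x w] g_J[of y w] g_J[of "J x" w] g_J[of "J y" w]
    by (simp add: G_J_left JJ glin)
  have J2: "\<tau> z (J x) y w = - \<tau> z x y (J w)" for z x y w
    unfolding \<tau>_def using g_J[of "G z (G x y)" w] g_J[of x w] g_J[of y w] g_J[of z x] g_J[of "J z" x]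
      g_J[of "J x" w] g_J[of "J y" w]
    by (simp add: G_J_left G_J Jlin Glin JJ glin)
  fix w
  \<comment> \<open>Take \<open>J\<close> out of the last slot into \<open>z\<close>, exchange the
    first two slots, put it back and exchange again: the value equals its own negative.\<close>
  have "\<tau> z x y (J (J w)) = 0"
    using J1[of z x y "J w"] J2[of x z y "J w"] s[of "J z" x y "J w"] s[of z x y "J (J w)"] by simp
  then show "g (G z (G x y)) w = g (g z y *\<^sub>R x + g (J z) y *\<^sub>R J x - g z x *\<^sub>R y - g (J z) x *\<^sub>R J y) w"
    unfolding \<tau>_def by (simp add: JJ glin)
qed

text \<open>A unitary frame adapted to \<open>G\<close> reduces linear identities in dimension six
  to six values, most of which vanish for type reasons.\<close>

lemma frame_zero:
  assumes dim: "DIM('e) = 6" and k: "linear (k :: 'e \<Rightarrow> real)"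
    and e: "g e e = 1" "g y y = 1" "g e y = 0" "g (J e) y = 0"
    and z: "k e = 0" "k (J e) = 0" "k y = 0" "k (J y) = 0" "k (G e y) = 0" "k (J (G e y)) = 0"
  shows "k w = 0"
proof -
  let ?z = "G e y"
  let ?l = "[e, J e, y, J y, ?z, J ?z]"
  \<comment> \<open>If nonzero, the remainder of the expansion would be a seventh vector of an
    orthogonal family in dimension six.\<close>
  define r where "r = w - g e w *\<^sub>R e - g (J e) w *\<^sub>R J e - g y w *\<^sub>R y - g (J y) w *\<^sub>R J y
    - g ?z w *\<^sub>R ?z - g (J ?z) w *\<^sub>R J ?z"
  have zz: "g ?z ?z = 1" using const_type[of e y] e by simp
  have o: "sorted_wrt (\<lambda>x y. g x y = 0) ?l"
    using e psi_zero[of e y] sym[of e ?z] sym[of "J e" ?z] sym[of y ?z] sym[of "J y" ?z]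
      g_J[of e e] g_J[of e y] g_J[of y y] g_J[of ?z ?z] g_J[of e ?z] g_J[of y ?z] J_iso
    by simp
  have n: "\<forall>x\<in>set ?l. g x x = 1" using e zz by (simp add: J_iso)
  have o': "sorted_wrt (\<lambda>x y. g y x = 0) ?l"
    by (rule sorted_wrt_mono_rel[OF _ o]) (metis sym)
  have "\<forall>x\<in>set ?l. g x r = 0"
    using o o' n unfolding r_def by (simp add: glin)
  then have "sorted_wrt (\<lambda>x y. g x y = 0) (?l @ [r])" using o by (simp add: sorted_wrt_append)
  then have "r = 0"
    using length_orthogonal_le[of "?l @ [r]"] n dim pos[of r] by fastforce
  then have "w = g e w *\<^sub>R e + g (J e) w *\<^sub>R J e + g y w *\<^sub>R y + g (J y) w *\<^sub>R J y
    + g ?z w *\<^sub>R ?z + g (J ?z) w *\<^sub>R J ?z" unfolding r_def by (simp add: algebra_simps)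
  then have "k w = k (g e w *\<^sub>R e + g (J e) w *\<^sub>R J e + g y w *\<^sub>R y + g (J y) w *\<^sub>R J y
    + g ?z w *\<^sub>R ?z + g (J ?z) w *\<^sub>R J ?z)" by simp
  then show ?thesis by (simp add: linear_add[OF k] linear_scale[OF k] z)
qed

text \<open>The complement of the complex line of \<open>n\<close> is spanned over the complex
  numbers by a unit vector \<open>e\<close> and \<open>G n e\<close>. There \<open>G e\<close> kills
  \<open>e\<close> and sends \<open>G n e\<close> into the line of \<open>n\<close>, which is
  orthogonal to \<open>z\<close>.\<close>

lemma psi_orthogonal:
  assumes dim: "DIM('e) = 6" and n: "g n n = 1"
    and x: "g n x = 0" "g (J n) x = 0" and z: "g n z = 0" "g (J n) z = 0"
    and y: "g n y = 0" "g (J n) y = 0"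
  shows "g (G x y) z = 0"
proof (cases "x = 0")
  case False
  define r where "r = sqrt (g x x)"
  have r: "r > 0" "r * r = g x x" using pos[OF False] by (auto simp: r_def)
  define e where "e = (1 / r) *\<^sub>R x"
  have e: "g e e = 1" "g n e = 0" "g (J n) e = 0" using r x by (auto simp: e_def glin field_simps)
  let ?k = "\<lambda>w. g (G e (w - g n w *\<^sub>R n - g (J n) w *\<^sub>R J n)) z"
  have "?k y = 0"
  proof (rule frame_zero[where k = ?k, OF dim _ n e(1) e(2) e(3)])
    show "linear ?k" by (rule linearI) (simp_all add: glin Glin algebra_simps)
    have 1: "g n (J n) = 0" "g (J n) (J n) = 1" "g n (J e) = 0" "g (J n) (J e) = 0"
      using e n g_J[of n n] g_J[of n e] by (simp_all add: J_iso)
    have 2: "g n (G n e) = 0" "g (J n) (G n e) = 0" "g n (J (G n e)) = 0" "g (J n) (J (G n e)) = 0"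
      using sym[of n "G n e"] sym[of "J n" "G n e"] g_J[of n "G n e"] by (simp_all add: J_iso)
    \<comment> \<open>This is \<open>GG\<close> for the orthonormal pair \<open>n\<close>,
      \<open>e\<close>; it shows that \<open>G e\<close> leads out of the complement.\<close>
    have 3: "G e (G n e) = n" using GG[of e n e] e om_skew[of e n] sym[of e n] by simp
    show "?k n = 0" "?k (J n) = 0" using 1 n by (simp_all add: Glin glin)
    show "?k e = 0" "?k (J e) = 0" using e 1 by (simp_all add: Glin glin Jlin G_J)
    show "?k (G n e) = 0" "?k (J (G n e)) = 0" using 2 3 z by (simp_all add: Glin glin Jlin G_J)
  qed
  then have "g (G e y) z = 0" using y by simp
  then show ?thesis using r by (simp add: e_def Glin glin)
qed (simp add: Glin glin)

text \<open>This rests on \<open>psi_orthogonal\<close>: a space of complex dimension two carries no forms of type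
  \<open>(3,0)\<close>.\<close>

lemma psi_hyperplane:
  assumes dim: "DIM('e) = 6" and n: "g n n = 1" and xi: "\<xi> = - J n"
    and x: "g n x = 0" and y: "g n y = 0" and z: "g n z = 0"
  shows "g (G x y) z = g \<xi> x * g (G \<xi> y) z + g \<xi> y * g (G \<xi> z) x + g \<xi> z * g (G \<xi> x) y"
proof -
  have xx: "g \<xi> \<xi> = 1" "g n \<xi> = 0" using n g_J[of n n] by (simp_all add: xi glin J_iso)
  have Jn: "g (J n) v = - g \<xi> v" for v by (simp add: xi glin)
  \<comment> \<open>Removing the \<xi>-components places all three vectors in the complement of the
    complex line of \<open>n\<close>. In the expansion of \<Psi> every term with \<xi> in two slots
    drops out.\<close>
  let ?p = "\<lambda>v. v - g \<xi> v *\<^sub>R \<xi>"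
  have "g (G (?p x) (?p y)) (?p z) = 0"
    by (rule psi_orthogonal[OF dim n]) (use x y z xx in \<open>simp_all add: Jn glin\<close>)
  moreover have "g (G x \<xi>) z = g (G \<xi> z) x"
    using G_skew[of x \<xi>] g_G[of \<xi> x z] sym[of x "G \<xi> z"] by (simp add: glin)
  ultimately show ?thesis
    using psi_cyclic[of \<xi> x y] by (simp add: Glin glin algebra_simps)
qed

text \<open>The difference \<open>P\<close> of both sides is, for fixed \<open>t\<close>, of type \<open>(3,0) + (0,3)\<close> and orthogonal to
  \<open>\<Psi>\<close>, hence a multiple of \<open>\<Psi>(J \<cdot>, \<cdot>, \<cdot>)\<close>. Evaluating \<open>dC\<close> on \<open>e, J e, y, G e y\<close> shows that
  \<open>P e e = 0\<close>, so that \<open>P\<close> is alternating in all four arguments, and then \<open>dC\<close> reads \<open>4 P = 0\<close>.\<close>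

lemma derivative_of_psi:
  assumes dim: "DIM('e) = 6"
    and lin: "\<And>x y z. linear (\<lambda>t. D t x y z)" "\<And>t y z. linear (\<lambda>x. D t x y z)"
    and skew: "\<And>t x y z. D t x y z = - D t y x z" "\<And>t x y z. D t x y z = - D t x z y"
    and dJ: "\<And>t x y z. D t x y (J z) + g (G x y) (G t z) = D t (J x) y z + g (G (G t x) y) z"
    and dT: "\<And>t x y. D t x y (G x y) = - g (J x) y * g (G t x) y"
    and dC: "\<And>w x y z. D w x y z - D x w y z - D y x w z - D z x y w = (0::real)"
  shows "D t x y z = - (g (J x) y * g t z + g (J y) z * g t x + g (J z) x * g t y)"
proof -
  define P where "P t x y z = D t x y z + (g (J x) y * g t z + g (J y) z * g t x + g (J z) x * g t y)" for t x y z
  have P_skew: "P t x y z = - P t y x z" "P t x y z = - P t x z y" for t x y z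
    unfolding P_def using skew[of t x y z] om_skew[of x y] om_skew[of y z] om_skew[of z x] by simp_all
  have P_same [simp]: "P t x x z = 0" "P t x y y = 0" "P t x y x = 0" for t x y z
    using P_skew(1)[of t x x z] P_skew(2)[of t x y y] P_skew(1)[of t x y x] P_skew(2)[of t y x x] by simp_all
  have P_lin: "linear (\<lambda>t. P t x y z)" "linear (\<lambda>x. P t x y z)" for t x y z
    unfolding P_def
    by (rule linearI;
        simp add: linear_add[OF lin(1)] linear_add[OF lin(2)] linear_scale[OF lin(1)] linear_scale[OF lin(2)]
          glin Jlin algebra_simps)+
  have P_lin2: "linear (\<lambda>y. P t x y z)" for t x z
  proof -
    have eq: "(\<lambda>y. P t x y z) = (\<lambda>y. - P t y x z)" by (rule ext) (rule P_skew(1))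
    show ?thesis unfolding eq by (rule linear_compose_neg[OF P_lin(2)])
  qed
  have P_lin3: "linear (\<lambda>z. P t x y z)" for t x y
  proof -
    have eq: "(\<lambda>z. P t x y z) = (\<lambda>z. - P t x z y)" by (rule ext) (rule P_skew(2))
    show ?thesis unfolding eq by (rule linear_compose_neg[OF P_lin2])
  qed
  \<comment> \<open>The hypothesis \<open>dJ\<close> is the derivative of the rule that moves
    \<open>J\<close> between the arguments of \<Psi>. Its two terms quadratic in \<open>G\<close>,
    evaluated by \<open>GG\<close>, are compensated exactly by the wedge terms in
    \<open>P\<close>.\<close>
  have P_J: "P t x y (J z) = P t (J x) y z" for t x y z
  proof -
    have 1: "g (G (G t x) y) z = - (g y x * g t z + g (J y) x * g (J t) z - g y t * g x z - g (J y) t * g (J x) z)"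
      using arg_cong[OF GG[of y t x], of "\<lambda>v. g v z"] G_skew[of "G t x" y] by (simp add: glin)
    have 2: "g (G x y) (G t z) = - (g x z * g t y + g (J x) z * g (J t) y - g x t * g z y - g (J x) t * g (J z) y)"
      using arg_cong[OF GG[of x t z], of "\<lambda>v. g v y"] g_G[of x y "G t z"] sym[of y "G x (G t z)"] by (simp add: glin)
    show ?thesis
      using dJ[of t x y z] unfolding P_def 1 2
      using om_skew[of y z] om_skew[of z x] om_skew[of x y] om_skew[of t x] om_skew[of t y] om_skew[of t z]
        g_J[of t z] g_J[of t x] sym[of x y] sym[of y z] sym[of x z] sym[of t x] sym[of t y] sym[of t z] J_iso[of y z] J_iso[of z x]
      by (simp add: JJ glin algebra_simps)
  qed
  have P_J2: "P t (J x) y z = P t x (J y) z" for t x y z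
    using P_J[of t x y z] P_J[of t y x z] P_skew(1)[of t x "J y" z] P_skew(1)[of t y x "J z"] by linarith
  have P_xJx: "P t x (J x) z = 0" for t x z
    using P_J2[of t x x z] P_skew(1)[of t x "J x" z] by simp
  have P_xJx': "P t (J x) x z = 0" "P t (J x) z x = 0" "P t x z (J x) = 0" "P t z x (J x) = 0" for t x z
    using P_xJx[of t x z] P_skew(1)[of t "J x" x z] P_skew(2)[of t "J x" z x] P_skew(2)[of t x z "J x"]
      P_skew(1)[of t z x "J x"] by linarith+
  have P_G: "P t x y (G x y) = 0" for t x y
    unfolding P_def dT using psi_cyclic[of t x y] sym[of t "G x y"] sym[of "J y" "G x y"]
      g_J[of "G x y" x] by (simp add: algebra_simps)
  have P_C: "P w x y z - P x w y z - P y x w z - P z x y w = 0" for w x y z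
    using dC[of w x y z] unfolding P_def om_skew[of y w] om_skew[of x w] om_skew[of w z]
      sym[of x w] sym[of y w] sym[of z w] sym[of z x] sym[of y x] sym[of z y]
    by (simp add: algebra_simps)
  have unit: "P e e y w = 0" if e: "g e e = 1" "g y y = 1" "g e y = 0" "g (J e) y = 0" for e y w
  proof (rule frame_zero[OF dim P_lin3 e])
    have "P e e y (J (G e y)) = P e (J e) y (G e y)" by (rule P_J)
    also have "\<dots> = 0"
      using P_C[of e "J e" y "G e y"] by (simp add: P_G P_xJx')
    finally show "P e e y (J (G e y)) = 0" .
  qed (simp_all add: P_xJx' P_G)
  have sc: "P t (r *\<^sub>R x) y z = r * P t x y z" "P (r *\<^sub>R t) x y z = r * P t x y z" "P t x (r *\<^sub>R y) z = r * P t x y z" for r t x y z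
    using linear_scale[OF P_lin(2)] linear_scale[OF P_lin(1)] linear_scale[OF P_lin2] by simp_all
  have unit': "P e e y w = 0" if e: "g e e = 1" for e y w
  proof -
    \<comment> \<open>The part of \<open>y\<close> in the complex line of \<open>e\<close>
      contributes nothing, since \<open>P\<close> vanishes on two arguments from one complex
      line.\<close>
    define y' where "y' = y - g e y *\<^sub>R e - g (J e) y *\<^sub>R J e"
    have y': "g e y' = 0" "g (J e) y' = 0"
      using e g_J[of e e] by (simp_all add: y'_def glin J_iso)
    have "P e e y' w = 0"
    proof (cases "y' = 0")
      case True
      then show ?thesis using linear_0[OF P_lin2] by simp
    next
      case False
      define r where "r = sqrt (g y' y')"
      have r: "r > 0" "r * r = g y' y'" using pos[OF False] by (auto simp: r_def)
      have "P e e ((1 / r) *\<^sub>R y') w = 0"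
        by (rule unit) (use e y' r in \<open>auto simp: glin field_simps\<close>)
      then show ?thesis using r by (simp add: sc)
    qed
    then show ?thesis
      unfolding y'_def by (simp add: linear_diff[OF P_lin2] sc P_xJx)
  qed
  have P0: "P x x y w = 0" for x y w
  proof (cases "x = 0")
    case True
    then show ?thesis using linear_0[OF P_lin(1)] by simp
  next
    case False
    define r where "r = sqrt (g x x)"
    have r: "r > 0" "r * r = g x x" using pos[OF False] by (auto simp: r_def)
    have "P ((1 / r) *\<^sub>R x) ((1 / r) *\<^sub>R x) y w = 0"
      by (rule unit') (use r in \<open>auto simp: glin field_simps\<close>)
    then show ?thesis using r pos[OF False] by (simp add: sc)
  qed
  have P01: "P t x y z = - P x t y z" for t x y z
    using P0[of "t + x" y z] P0[of t y z] P0[of x y z]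
    by (simp add: linear_add[OF P_lin(1)] linear_add[OF P_lin(2)])
  have "P t x y z = 0"
    using P_C[of t x y z] P01[of x t y z] P01[of y x t z] P01[of z x y t] P01[of t x y z]
      P_skew[of t x y z] P_skew[of x y t z] P_skew[of x t y z] P_skew(1)[of x y z t] P_skew(2)[of x y z t] P_skew(1)[of x z y t]
       P_skew(2)[of x z y t]  P_skew(2)[of x y t z]
       P_skew(1)[of x z t y] P_skew(2)[of x z t y] by linarith
  then show ?thesis unfolding P_def by simp
qed

end

text \<open>A single tangent space of the hypersurface, with quaternion products in the order
  \<open>\<phi>\<^sub>2 \<phi>\<^sub>1 = \<phi>\<^sub>3\<close>. Metric compatibility is encoded by
  skewness together with the formula for the squares.\<close>

locale contact_triple = inner_form g for g :: "'e::euclidean_space \<Rightarrow> 'e \<Rightarrow> real" +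
  fixes \<xi> :: 'e and \<phi>\<^sub>1 \<phi>\<^sub>2 \<phi>\<^sub>3 :: "'e \<Rightarrow> 'e"
  assumes xi_unit: "g \<xi> \<xi> = 1"
    and phi_linear: "linear \<phi>\<^sub>1" "linear \<phi>\<^sub>2" "linear \<phi>\<^sub>3"
    and phi_skew: "g (\<phi>\<^sub>1 u) v = - g u (\<phi>\<^sub>1 v)" "g (\<phi>\<^sub>2 u) v = - g u (\<phi>\<^sub>2 v)" "g (\<phi>\<^sub>3 u) v = - g u (\<phi>\<^sub>3 v)"
    and phi_xi: "\<phi>\<^sub>1 \<xi> = 0" "\<phi>\<^sub>2 \<xi> = 0" "\<phi>\<^sub>3 \<xi> = 0"
    and phi_sq: "\<phi>\<^sub>1 (\<phi>\<^sub>1 u) = - u + g \<xi> u *\<^sub>R \<xi>" "\<phi>\<^sub>2 (\<phi>\<^sub>2 u) = - u + g \<xi> u *\<^sub>R \<xi>"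
      "\<phi>\<^sub>3 (\<phi>\<^sub>3 u) = - u + g \<xi> u *\<^sub>R \<xi>"
    and phi_mult: "\<phi>\<^sub>2 (\<phi>\<^sub>1 u) = \<phi>\<^sub>3 u" "\<phi>\<^sub>1 (\<phi>\<^sub>2 u) = - \<phi>\<^sub>3 u" "\<phi>\<^sub>3 (\<phi>\<^sub>2 u) = \<phi>\<^sub>1 u"
      "\<phi>\<^sub>2 (\<phi>\<^sub>3 u) = - \<phi>\<^sub>1 u" "\<phi>\<^sub>1 (\<phi>\<^sub>3 u) = \<phi>\<^sub>2 u" "\<phi>\<^sub>3 (\<phi>\<^sub>1 u) = - \<phi>\<^sub>2 u"
    and dim_gt_1: "1 < DIM('e)"
begin

lemmas philin = linear_add[OF phi_linear(1)] linear_add[OF phi_linear(2)] linear_add[OF phi_linear(3)]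
  linear_scale[OF phi_linear(1)] linear_scale[OF phi_linear(2)] linear_scale[OF phi_linear(3)]
  linear_neg[OF phi_linear(1)] linear_neg[OF phi_linear(2)] linear_neg[OF phi_linear(3)]
  linear_diff[OF phi_linear(1)] linear_diff[OF phi_linear(2)] linear_diff[OF phi_linear(3)]

lemma eta_phi: "g \<xi> (\<phi>\<^sub>1 u) = 0" "g \<xi> (\<phi>\<^sub>2 u) = 0" "g \<xi> (\<phi>\<^sub>3 u) = 0"
  using phi_skew[of \<xi> u] by (simp_all add: phi_xi glin)

lemma phi_self: "g (\<phi>\<^sub>1 u) u = 0" "g (\<phi>\<^sub>2 u) u = 0" "g (\<phi>\<^sub>3 u) u = 0"
  "g u (\<phi>\<^sub>1 u) = 0" "g u (\<phi>\<^sub>2 u) = 0" "g u (\<phi>\<^sub>3 u) = 0"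
  using phi_skew[of u u] sym[of u "\<phi>\<^sub>1 u"] sym[of u "\<phi>\<^sub>2 u"] sym[of u "\<phi>\<^sub>3 u"] by simp_all

lemma phi_inner:
  assumes "g \<xi> u = 0"
  shows "g (\<phi>\<^sub>1 u) (\<phi>\<^sub>1 u) = g u u" "g (\<phi>\<^sub>2 u) (\<phi>\<^sub>2 u) = g u u" "g (\<phi>\<^sub>3 u) (\<phi>\<^sub>3 u) = g u u"
    "g (\<phi>\<^sub>1 u) (\<phi>\<^sub>2 u) = 0" "g (\<phi>\<^sub>1 u) (\<phi>\<^sub>3 u) = 0" "g (\<phi>\<^sub>2 u) (\<phi>\<^sub>3 u) = 0"
    "g (\<phi>\<^sub>2 u) (\<phi>\<^sub>1 u) = 0" "g (\<phi>\<^sub>3 u) (\<phi>\<^sub>1 u) = 0" "g (\<phi>\<^sub>3 u) (\<phi>\<^sub>2 u) = 0"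
  using assms by (simp_all add: phi_skew phi_sq phi_mult phi_self glin)

text \<open>The vectors \<open>u\<close>, its three images and \<xi> are pairwise orthogonal, so
  coefficients can be compared. This is how vector equations are turned into scalar ones
  below.\<close>

lemma comb_zero:
  assumes u: "u \<noteq> 0" "g \<xi> u = 0"
    and "q *\<^sub>R u + q1 *\<^sub>R \<phi>\<^sub>1 u + q2 *\<^sub>R \<phi>\<^sub>2 u + q3 *\<^sub>R \<phi>\<^sub>3 u + r *\<^sub>R \<xi> = 0"
  shows "q = 0 \<and> q1 = 0 \<and> q2 = 0 \<and> q3 = 0"
proof -
  let ?v = "q *\<^sub>R u + q1 *\<^sub>R \<phi>\<^sub>1 u + q2 *\<^sub>R \<phi>\<^sub>2 u + q3 *\<^sub>R \<phi>\<^sub>3 u + r *\<^sub>R \<xi>"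
  have "g u ?v = 0" "g (\<phi>\<^sub>1 u) ?v = 0" "g (\<phi>\<^sub>2 u) ?v = 0" "g (\<phi>\<^sub>3 u) ?v = 0"
    using assms(3) by (simp_all add: glin)
  then show ?thesis
    using pos[OF u(1)] u(2) sym[of u \<xi>]
    by (simp add: glin phi_inner[OF u(2)] phi_self eta_phi phi_xi phi_skew(1)[of u \<xi>] phi_skew(2)[of u \<xi>]
        phi_skew(3)[of u \<xi>])
qed

text \<open>On \<open>ker \<eta>\<close> the endomorphism \<open>R = a - b \<phi>\<^sub>3 + c \<phi>\<^sub>2\<close> is a unit quaternion, so the equation
  \<open>R S v = q v\<close> with a quaternion \<open>q\<close> makes \<open>S\<close> a quaternion, which has to be real as \<open>S\<close> is
  symmetric.\<close>

lemma nearly_structure: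
  assumes S: "linear S" "\<And>u v. g (S u) v = g u (S v)"
    and abc: "a\<^sup>2 + b\<^sup>2 + c\<^sup>2 = 1" and p: "linear p\<^sub>1" "linear p\<^sub>2" "linear p\<^sub>3"
    and T: "\<And>u v. T u v = p\<^sub>1 u *\<^sub>R \<phi>\<^sub>1 v + (p\<^sub>2 u - c * g \<xi> (S u)) *\<^sub>R \<phi>\<^sub>2 v + (p\<^sub>3 u + b * g \<xi> (S u)) *\<^sub>R \<phi>\<^sub>3 v
        + g \<xi> v *\<^sub>R A u - g (A u) v *\<^sub>R \<xi>"
    and A: "\<And>u. A u = a *\<^sub>R S u - b *\<^sub>R \<phi>\<^sub>3 (S u) + c *\<^sub>R \<phi>\<^sub>2 (S u) + (c - \<epsilon>) *\<^sub>R u"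
    and skew: "\<And>u v. T u v + T v u = 0"
  obtains \<mu> \<nu> where "\<And>u. S u = \<mu> *\<^sub>R u + ((\<nu> - \<mu>) * g \<xi> u) *\<^sub>R \<xi>"
    "a * \<mu> = \<epsilon> - c" "\<And>u. p\<^sub>1 u = 0" "\<And>u. p\<^sub>2 u = c * (\<nu> - \<mu>) * g \<xi> u" "\<And>u. p\<^sub>3 u = - b * (\<nu> - \<mu>) * g \<xi> u"
proof -
  define R where "R x = a *\<^sub>R x - b *\<^sub>R \<phi>\<^sub>3 x + c *\<^sub>R \<phi>\<^sub>2 x" for x
  \<comment> \<open>The conjugate quaternion of \<open>R\<close>: on ker \<eta> the product is a^2 +
    b^2 + c^2 = 1.\<close>
  define R' where "R' x = a *\<^sub>R x + b *\<^sub>R \<phi>\<^sub>3 x - c *\<^sub>R \<phi>\<^sub>2 x" for x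
  have AR: "A u = R (S u) + (c - \<epsilon>) *\<^sub>R u" for u by (simp add: A R_def)
  have R'R: "R' (R x) = x" if "g \<xi> x = 0" for x
  proof -
    have "R' (R x) = (a\<^sup>2 + b\<^sup>2 + c\<^sup>2) *\<^sub>R x"
      using that by (simp add: R_def R'_def philin phi_sq phi_mult power2_eq_square algebra_simps)
    then show ?thesis by (simp add: abc)
  qed
  have R_lin: "R (x + y) = R x + R y" "R (r *\<^sub>R x) = r *\<^sub>R R x" for x y r
    by (simp_all add: R_def philin algebra_simps)
  have R_xi: "R \<xi> = a *\<^sub>R \<xi>" by (simp add: R_def phi_xi)
  have eta_R: "g \<xi> (R x) = a * g \<xi> x" for x by (simp add: R_def glin eta_phi)
  define \<nu> where "\<nu> = g \<xi> (S \<xi>)"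
  have Tuu: "T u u = 0" for u
  proof -
    have "2 *\<^sub>R T u u = 0" using skew[of u u] by (simp only: scaleR_2)
    then show ?thesis by simp
  qed
  \<comment> \<open>All \<open>\<phi>\<^sub>i \<xi>\<close> vanish, so the diagonal value of
    \<open>T\<close> at \<xi> isolates \<open>A \<xi>\<close>. Inverting \<open>R\<close> on ker
    \<eta> then makes \<xi> an eigenvector of \<open>S\<close>.\<close>
  have Axi: "A \<xi> = g (A \<xi>) \<xi> *\<^sub>R \<xi>"
    using Tuu[of \<xi>] by (simp add: T phi_xi xi_unit)
  have Sxi: "S \<xi> = \<nu> *\<^sub>R \<xi>"
  proof -
    define x where "x = S \<xi> - \<nu> *\<^sub>R \<xi>"
    have x: "g \<xi> x = 0" by (simp add: x_def \<nu>_def glin xi_unit)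
    have "S \<xi> = x + \<nu> *\<^sub>R \<xi>" by (simp add: x_def)
    then have RS: "R (S \<xi>) = R x + (\<nu> * a) *\<^sub>R \<xi>" by (simp add: R_lin R_xi)
    then have "R x = (g (A \<xi>) \<xi> - (c - \<epsilon>) - \<nu> * a) *\<^sub>R \<xi>"
      using Axi unfolding AR by (simp add: algebra_simps)
    then obtain r where r: "R x = r *\<^sub>R \<xi>" by blast
    then have "r = 0" using eta_R[of x] x by (simp add: glin xi_unit)
    then have "R x = 0" using r by simp
    then have "x = 0" using R'R[OF x] by (simp add: R'_def philin linear_0[OF phi_linear(2)] linear_0[OF phi_linear(3)])
    then show ?thesis by (simp add: x_def)
  qed
  have etaS: "g \<xi> (S u) = \<nu> * g \<xi> u" for u
    using S(2)[of \<xi> u] by (simp add: Sxi glin)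
  have Axi': "g (A \<xi>) v = 0" if "g \<xi> v = 0" for v
    using arg_cong[OF Axi, of "\<lambda>x. g x v"] that by (simp add: glin)
  \<comment> \<open>On the diagonal at \<open>u\<close> in ker \<eta> only the three images of
    \<open>u\<close> and a multiple of \<xi> survive, so each differential is read off as a
    coefficient.\<close>
  have pD: "p\<^sub>1 u = 0" "p\<^sub>2 u = 0" "p\<^sub>3 u = 0" if u: "g \<xi> u = 0" for u
  proof -
    have "p\<^sub>1 u = 0 \<and> p\<^sub>2 u = 0 \<and> p\<^sub>3 u = 0"
    proof (cases "u = 0")
      case False
      have "0 *\<^sub>R u + p\<^sub>1 u *\<^sub>R \<phi>\<^sub>1 u + p\<^sub>2 u *\<^sub>R \<phi>\<^sub>2 u + p\<^sub>3 u *\<^sub>R \<phi>\<^sub>3 u + (- g (A u) u) *\<^sub>R \<xi> = 0"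
        using u Tuu[of u] by (simp add: T etaS)
      from comb_zero[OF False u this] show ?thesis by blast
    qed (simp add: linear_0[OF p(1)] linear_0[OF p(2)] linear_0[OF p(3)])
    then show "p\<^sub>1 u = 0" "p\<^sub>2 u = 0" "p\<^sub>3 u = 0" by auto
  qed
  define q1 q2 q3 where "q1 = p\<^sub>1 \<xi>" and "q2 = p\<^sub>2 \<xi> - c * \<nu>" and "q3 = p\<^sub>3 \<xi> + b * \<nu>"
  \<comment> \<open>The mixed values at \<xi> and \<open>v\<close> give the quaternionic equation
    for \<open>S\<close>; the coefficients \<open>q1\<close>, \<open>q2\<close>, \<open>q3\<close>
    come from the derivatives along \<xi>.\<close>
  have RS: "R (S v) = (\<epsilon> - c) *\<^sub>R v - q1 *\<^sub>R \<phi>\<^sub>1 v - q2 *\<^sub>R \<phi>\<^sub>2 v - q3 *\<^sub>R \<phi>\<^sub>3 v" if v: "g \<xi> v = 0" for v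
  proof -
    have "g (A v) \<xi> = 0"
      using sym[of "A v" \<xi>] v by (simp add: AR glin eta_R etaS)
    then have "q1 *\<^sub>R \<phi>\<^sub>1 v + q2 *\<^sub>R \<phi>\<^sub>2 v + q3 *\<^sub>R \<phi>\<^sub>3 v + A v = 0"
      using skew[of \<xi> v] v Axi'[OF v] pD[OF v]
      by (simp add: T phi_xi xi_unit etaS q1_def q2_def q3_def)
    then show ?thesis unfolding AR by (simp add: algebra_simps add_eq_0_iff2)
  qed
  obtain e where e: "e \<noteq> 0" "g \<xi> e = 0" using exists_orthogonal[OF dim_gt_1] by blast
  define \<mu> where "\<mu> = a * (\<epsilon> - c) + b * q3 - c * q2"
  have "\<exists>r1 r2 r3. \<forall>v. g \<xi> v = 0 \<longrightarrow> S v = \<mu> *\<^sub>R v + r1 *\<^sub>R \<phi>\<^sub>1 v + r2 *\<^sub>R \<phi>\<^sub>2 v + r3 *\<^sub>R \<phi>\<^sub>3 v"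
  proof (intro exI allI impI)
    fix v assume v: "g \<xi> v = 0"
    have "S v = R' (R (S v))" using R'R[of "S v"] v by (simp add: etaS)
    also have "\<dots> = \<mu> *\<^sub>R v + (- a * q1 - b * q2 - c * q3) *\<^sub>R \<phi>\<^sub>1 v
        + (- a * q2 + b * q1 - c * (\<epsilon> - c)) *\<^sub>R \<phi>\<^sub>2 v + (- a * q3 + b * (\<epsilon> - c) + c * q1) *\<^sub>R \<phi>\<^sub>3 v"
      using v unfolding RS[OF v]
      by (simp add: R'_def \<mu>_def philin phi_sq phi_mult algebra_simps)
    finally show "S v = \<mu> *\<^sub>R v + (- a * q1 - b * q2 - c * q3) *\<^sub>R \<phi>\<^sub>1 v
        + (- a * q2 + b * q1 - c * (\<epsilon> - c)) *\<^sub>R \<phi>\<^sub>2 v + (- a * q3 + b * (\<epsilon> - c) + c * q1) *\<^sub>R \<phi>\<^sub>3 v" .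
  qed
  then obtain r1 r2 r3 where
    Sr: "\<And>v. g \<xi> v = 0 \<Longrightarrow> S v = \<mu> *\<^sub>R v + r1 *\<^sub>R \<phi>\<^sub>1 v + r2 *\<^sub>R \<phi>\<^sub>2 v + r3 *\<^sub>R \<phi>\<^sub>3 v" by blast
  have ge: "g e e > 0" using pos e by simp
  \<comment> \<open>Each imaginary unit is skew while \<open>S\<close> is symmetric, so pairing
    \<open>S e\<close> with an image of \<open>e\<close> gives a number equal to its
    negative.\<close>
  have "r1 = 0" "r2 = 0" "r3 = 0"
    using S(2)[of e "\<phi>\<^sub>1 e"] S(2)[of e "\<phi>\<^sub>2 e"] S(2)[of e "\<phi>\<^sub>3 e"] ge
    by (simp_all add: Sr e(2) eta_phi glin phi_inner[OF e(2)] phi_self phi_sq phi_mult philin)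
  then have SD: "S v = \<mu> *\<^sub>R v" if "g \<xi> v = 0" for v using Sr[OF that] by simp
  \<comment> \<open>Substituting the real multiple for \<open>S\<close> in \<open>RS\<close> and
    comparing coefficients gives the differentials along \<xi>.\<close>
  have "(a * \<mu> - (\<epsilon> - c)) *\<^sub>R e + q1 *\<^sub>R \<phi>\<^sub>1 e + (q2 + c * \<mu>) *\<^sub>R \<phi>\<^sub>2 e + (q3 - b * \<mu>) *\<^sub>R \<phi>\<^sub>3 e + 0 *\<^sub>R \<xi> = 0"
    using RS[OF e(2)] unfolding SD[OF e(2)] R_def by (simp add: philin algebra_simps)
  from comb_zero[OF e this]
  have q: "a * \<mu> = \<epsilon> - c" "p\<^sub>1 \<xi> = 0" "p\<^sub>2 \<xi> = c * (\<nu> - \<mu>)" "p\<^sub>3 \<xi> = - b * (\<nu> - \<mu>)"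
    by (simp_all add: q1_def q2_def q3_def algebra_simps)
  have dec: "u = (u - g \<xi> u *\<^sub>R \<xi>) + g \<xi> u *\<^sub>R \<xi>" "g \<xi> (u - g \<xi> u *\<^sub>R \<xi>) = 0" for u
    by (simp_all add: glin xi_unit)
  show thesis
  proof (rule that)
    fix u
    have "S u = S (u - g \<xi> u *\<^sub>R \<xi>) + g \<xi> u *\<^sub>R S \<xi>"
      using dec(1)[of u] linear_add[OF S(1)] linear_scale[OF S(1)] by metis
    then show "S u = \<mu> *\<^sub>R u + ((\<nu> - \<mu>) * g \<xi> u) *\<^sub>R \<xi>"
      unfolding SD[OF dec(2)] Sxi by (simp add: algebra_simps)
    have pu: "p u = p (u - g \<xi> u *\<^sub>R \<xi>) + g \<xi> u * p \<xi>" if "linear p" for p :: "'e \<Rightarrow> real"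
      using dec(1)[of u] linear_add[OF that] linear_scale[OF that] real_scaleR_def by metis
    show "p\<^sub>1 u = 0" "p\<^sub>2 u = c * (\<nu> - \<mu>) * g \<xi> u" "p\<^sub>3 u = - b * (\<nu> - \<mu>) * g \<xi> u"
      unfolding pu[OF p(1)] pu[OF p(2)] pu[OF p(3)] by (simp_all add: pD[OF dec(2)] q)
  qed (rule q(1))
qed

end

section \<open>Differentiation along a smooth map\<close>

text \<open>Weaker than \<open>smooth_fun\<close>: the eigenvalue function of the shape operator
  arises by pointwise choice and is only shown to be differentiable at each point.\<close>

definition pdiff ::
  "('m, 'e::euclidean_space) chart set \<Rightarrow> 'm \<Rightarrow> ('m \<Rightarrow> 'b::real_normed_vector) \<Rightarrow> bool" where
  "pdiff A p h \<longleftrightarrow> (h \<circ> cinv (chart_at A p)) differentiable (at (cmap (chart_at A p) p))"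

lemma has_derivative_point_deriv:
  "pdiff A p h \<Longrightarrow> (h \<circ> cinv (chart_at A p) has_derivative point_deriv A p h) (at (cmap (chart_at A p) p))"
  unfolding pdiff_def point_deriv_def by (rule differentiable_imp_has_derivative)

lemma pdiffI:
  assumes "(h \<circ> cinv (chart_at A p) has_derivative D) (at (cmap (chart_at A p) p))"
  shows "pdiff A p h" "point_deriv A p h = D"
  using assms frechet_derivative_eqI[OF assms] unfolding pdiff_def point_deriv_def differentiable_def by auto

lemma linear_point_deriv: "pdiff A p h \<Longrightarrow> linear (point_deriv A p h)"
  by (rule has_derivative_linear[OF has_derivative_point_deriv])

lemma pdiff_const: "pdiff A p (\<lambda>q. r)" "point_deriv A p (\<lambda>q. r) = (\<lambda>u. 0)"
  using pdiffI[of "\<lambda>q. r" A p "\<lambda>u. 0"] by (simp_all add: o_def)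

lemma pdiff_add:
  assumes "pdiff A p h" "pdiff A p k"
  shows "pdiff A p (\<lambda>q. h q + k q)"
    "point_deriv A p (\<lambda>q. h q + k q) = (\<lambda>u. point_deriv A p h u + point_deriv A p k u)"
  using pdiffI[of "\<lambda>q. h q + k q"] has_derivative_add[OF assms[THEN has_derivative_point_deriv]]
  by (simp_all add: o_def)

lemma pdiff_minus:
  assumes "pdiff A p h"
  shows "pdiff A p (\<lambda>q. - h q)" "point_deriv A p (\<lambda>q. - h q) = (\<lambda>u. - point_deriv A p h u)"
  using pdiffI[of "\<lambda>q. - h q"] has_derivative_minus[OF assms[THEN has_derivative_point_deriv]]
  by (simp_all add: o_def)

context
  fixes A :: "('m::{t2_space, second_countable_topology}, 'e::euclidean_space) chart set"
  assumes A: "smooth_atlas A"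
begin

lemma pdiff_mult:
  fixes h k :: "'m \<Rightarrow> real"
  assumes "pdiff A p h" "pdiff A p k"
  shows "pdiff A p (\<lambda>q. h q * k q)"
    "point_deriv A p (\<lambda>q. h q * k q) = (\<lambda>u. h p * point_deriv A p k u + point_deriv A p h u * k p)"
  using pdiffI[of "\<lambda>q. h q * k q"] has_derivative_mult[OF assms[THEN has_derivative_point_deriv]]
    cinv_cmap[OF A chart_at[OF A]]
  by (simp_all add: o_def)

lemma pdiff_divide:
  fixes h k :: "'m \<Rightarrow> real"
  assumes "pdiff A p h" "pdiff A p k" "k p \<noteq> 0"
  shows "pdiff A p (\<lambda>q. h q / k q)"
  using pdiffI(1)[of "\<lambda>q. h q / k q"] has_derivative_divide[OF assms(1,2)[THEN has_derivative_point_deriv]]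
    cinv_cmap[OF A chart_at[OF A]] assms(3)
  by (simp add: o_def)

lemma open_cdom: "c \<in> A \<Longrightarrow> open (cdom c)"
  using A unfolding smooth_atlas_def by blast

lemma open_chart_image_open:
  assumes c: "c \<in> A" and W: "open W"
  shows "open (cmap c ` (cdom c \<inter> W))"
proof -
  have hc: "homeomorphism (cdom c) (cmap c ` cdom c) (cmap c) (cinv c)"
    using A[unfolded smooth_atlas_def] c by blast
  have "openin (top_of_set (cmap c ` cdom c)) (cmap c ` (cdom c \<inter> W))"
    using homeomorphism_imp_open_map[OF hc] W open_cdom[OF c] by (simp add: openin_open_Int)
  then show ?thesis using open_chart_image[OF A c] openin_open_trans by blast
qed

lemma pdiff_cong:
  assumes W: "open W" "p \<in> W" and eq: "\<And>q. q \<in> W \<Longrightarrow> h q = k q" and h: "pdiff A p h"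
  shows "pdiff A p k" "point_deriv A p k = point_deriv A p h"
proof -
  let ?c = "chart_at A p"
  have "(k \<circ> cinv ?c has_derivative point_deriv A p h) (at (cmap ?c p))"
    by (rule has_derivative_transform_within_open[OF has_derivative_point_deriv[OF h]
          open_chart_image_open[OF chart_at(1)[OF A] W(1)]])
      (use chart_at[OF A, of p] W(2) in \<open>auto simp: eq cinv_cmap[OF A]\<close>)
  from pdiffI[OF this] show "pdiff A p k" "point_deriv A p k = point_deriv A p h" by auto
qed

lemma has_derivative_chart_at:
  assumes c: "c \<in> A" "q \<in> cdom c" and h: "(h \<circ> cinv c has_derivative D) (at (cmap c q))"
  shows "(h \<circ> cinv (chart_at A q) has_derivative (\<lambda>u. D (to_coord A c q u))) (at (cmap (chart_at A q) q))"
proof -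
  let ?e = "chart_at A q"
  note e = chart_at[OF A, of q]
  have 1: "(cmap c \<circ> cinv ?e has_derivative to_coord A c q) (at (cmap ?e q))"
    unfolding to_coord_def point_deriv_def
    by (rule differentiable_imp_has_derivative, rule transition_differentiable[OF A e(1) c(1) e(2) c(2)])
  have 2: "((\<lambda>x. (h \<circ> cinv c) ((cmap c \<circ> cinv ?e) x)) has_derivative (\<lambda>u. D (to_coord A c q u))) (at (cmap ?e q))"
    by (rule has_derivative_compose[OF 1]) (use h in \<open>simp add: cinv_cmap[OF A e] o_def\<close>)
  show ?thesis
    by (rule has_derivative_transform_within_open[OF 2 open_chart_image_Int[OF A e(1) c(1)]])
      (use c e in \<open>auto simp: cinv_cmap[OF A]\<close>)
qed

lemma to_from_coord:
  assumes "c \<in> A" "q \<in> cdom c"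
  shows "to_coord A c q (from_coord A c q v) = v"
  unfolding to_coord_def from_coord_def point_deriv_def
  by (intro transition_inverse[OF A] assms chart_at[OF A])

text \<open>The chain rule for the transition to the reference chart makes
  \<open>point_deriv\<close> computable in any chart \<open>c\<close>: on coordinate vectors of
  \<open>c\<close> it is an ordinary directional derivative.\<close>

lemma point_deriv_chart:
  assumes c: "c \<in> A" "q \<in> cdom c" and h: "(h \<circ> cinv c has_derivative D) (at (cmap c q))"
  shows "pdiff A q h" "point_deriv A q h u = D (to_coord A c q u)"
    "point_deriv A q h (from_coord A c q u) = D u"
  using pdiffI[OF has_derivative_chart_at[OF assms]] by (simp_all add: to_from_coord[OF c])

lemma point_deriv_smooth_chart:
  assumes c: "c \<in> A" "q \<in> cdom c" and h: "smooth_on (cmap c ` cdom c) (h \<circ> cinv c)"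
  shows "pdiff A q h"
    "point_deriv A q h (from_coord A c q u) = frechet_derivative (h \<circ> cinv c) (at (cmap c q)) u"
  using point_deriv_chart[OF c differentiable_imp_has_derivative[OF smooth_on_differentiable[OF h]]] c
  by auto

lemma smooth_fun_pdiff: "smooth_fun A h \<Longrightarrow> pdiff A p h"
  using point_deriv_smooth_chart(1)[of "chart_at A p" p h] chart_at[OF A, of p] unfolding smooth_fun_def by blast

text \<open>A zero derivative on a coordinate ball makes the function locally constant, and
  connectedness does the rest.\<close>

lemma pdiff_constant:
  fixes h :: "'m \<Rightarrow> real"
  assumes conn: "connected (UNIV :: 'm set)" and h: "\<And>p. pdiff A p h" and z: "\<And>p u. point_deriv A p h u = 0"
  obtains k where "\<And>p. h p = k"
proof -
  have "eventually (\<lambda>q. h p = h q) (at p)" for p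
  proof -
    let ?c = "chart_at A p"
    note c = chart_at[OF A, of p]
    \<comment> \<open>Hypothesis \<open>z\<close> speaks about the reference chart of each point
      \<open>q\<close>; it has to be transported to the one chart at \<open>p\<close> in which the
      ball lies.\<close>
    have D: "(h \<circ> cinv ?c has_derivative (\<lambda>u. 0)) (at x)" if x: "x \<in> cmap ?c ` cdom ?c" for x
    proof -
      obtain q where q: "q \<in> cdom ?c" "x = cmap ?c q" using x by blast
      note e = chart_at[OF A, of q]
      have 1: "(cmap (chart_at A q) \<circ> cinv ?c has_derivative from_coord A ?c q) (at (cmap ?c q))"
        unfolding from_coord_def
        by (rule differentiable_imp_has_derivative, rule transition_differentiable[OF A c(1) e(1) q(1) e(2)])
      have "((\<lambda>x. (h \<circ> cinv (chart_at A q)) ((cmap (chart_at A q) \<circ> cinv ?c) x)) has_derivative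
          (\<lambda>u. point_deriv A q h (from_coord A ?c q u))) (at (cmap ?c q))"
        by (rule has_derivative_compose[OF 1])
          (use has_derivative_point_deriv[OF h] in \<open>simp add: cinv_cmap[OF A c(1) q(1)] o_def\<close>)
      then have "(h \<circ> cinv ?c has_derivative (\<lambda>u. point_deriv A q h (from_coord A ?c q u))) (at (cmap ?c q))"
        by (rule has_derivative_transform_within_open[OF _ open_chart_image_Int[OF A c(1) e(1)]])
          (use q e c in \<open>auto simp: cinv_cmap[OF A]\<close>)
      then show ?thesis by (simp add: z q)
    qed
    obtain r where r: "r > 0" "ball (cmap ?c p) r \<subseteq> cmap ?c ` cdom ?c"
      using open_chart_image[OF A c(1)] c(2) by (meson imageI open_contains_ball)
    have eq: "(h \<circ> cinv ?c) x = (h \<circ> cinv ?c) (cmap ?c p)" if "x \<in> ball (cmap ?c p) r" for x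
    proof (rule has_derivative_zero_unique_connected[of "ball (cmap ?c p) r"])
      show "(h \<circ> cinv ?c has_derivative (\<lambda>u. 0)) (at y)" if "y \<in> ball (cmap ?c p) r" for y
        using D r(2) that by blast
    qed (use r that in \<open>auto simp: convex_connected\<close>)
    have "continuous_on (cdom ?c) (cmap ?c)"
      using A[unfolded smooth_atlas_def] c(1) unfolding homeomorphism_def by blast
    then have "open (cdom ?c \<inter> cmap ?c -` ball (cmap ?c p) r)"
      using continuous_on_open_vimage[OF open_cdom[OF c(1)]] by (metis inf_commute open_ball)
    moreover have "h p = h q" if "q \<in> cdom ?c \<inter> cmap ?c -` ball (cmap ?c p) r" for q
      using eq[of "cmap ?c q"] that c by (simp add: cinv_cmap[OF A])
    moreover have "p \<in> cdom ?c \<inter> cmap ?c -` ball (cmap ?c p) r" using c r by simp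
    ultimately show ?thesis unfolding eventually_at_topological by blast
  qed
  then have "h p = h q" for p q
    using connected_local_const[OF conn, of p q h] by simp
  then show thesis using that by blast
qed

end

text \<open>By continuity \<open>k\<close> has no zero near \<open>p\<close>, so \<open>m\<close>
  agrees there with the quotient of \<open>h\<close> and \<open>k\<close>. This provides the
  differentiability of a function that is known only through a product.\<close>

lemma pdiff_factor:
  fixes A :: "('m::{t2_space, second_countable_topology}, 'e::euclidean_space) chart set" and h k m :: "'m \<Rightarrow> real"
  assumes A: "smooth_atlas A" and h: "pdiff A p h" and k: "pdiff A p k" "k p \<noteq> 0"
    and cont: "continuous_on (cmap (chart_at A p) ` cdom (chart_at A p)) (k \<circ> cinv (chart_at A p))"
    and eq: "\<And>q. q \<in> cdom (chart_at A p) \<Longrightarrow> h q = m q * k q"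
  shows "pdiff A p m"
proof -
  let ?c = "chart_at A p"
  note c = chart_at[OF A, of p]
  define U where "U = cmap ?c ` cdom ?c \<inter> (k \<circ> cinv ?c) -` (- {0})"
  have U: "open U" "cmap ?c p \<in> U"
    unfolding U_def using continuous_open_preimage[OF cont open_chart_image[OF A c(1)], of "- {0}"] c k(2)
    by (auto simp: cinv_cmap[OF A])
  have "(m \<circ> cinv ?c has_derivative point_deriv A p (\<lambda>q. h q / k q)) (at (cmap ?c p))"
    by (rule has_derivative_transform_within_open[OF has_derivative_point_deriv[OF pdiff_divide[OF A h k]] U])
      (use c in \<open>auto simp: U_def cinv_cmap[OF A] eq\<close>)
  then show ?thesis by (rule pdiffI(1))
qed

section \<open>Covariant tensor fields and their covariant derivatives\<close>

definition smooth_form2 ::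
  "('m, 'e::euclidean_space) chart set \<Rightarrow> ('m \<Rightarrow> 'e \<Rightarrow> 'e \<Rightarrow> real) \<Rightarrow> bool" where
  "smooth_form2 A T \<longleftrightarrow> (\<forall>p. bilinear (T p)) \<and>
     (\<forall>c\<in>A. \<forall>u v. smooth_on (cmap c ` cdom c)
        (\<lambda>x. T (cinv c x) (from_coord A c (cinv c x) u) (from_coord A c (cinv c x) v)))"

definition smooth_form3 ::
  "('m, 'e::euclidean_space) chart set \<Rightarrow> ('m \<Rightarrow> 'e \<Rightarrow> 'e \<Rightarrow> 'e \<Rightarrow> real) \<Rightarrow> bool" where
  "smooth_form3 A T \<longleftrightarrow>
     (\<forall>p. (\<forall>v w. linear (\<lambda>u. T p u v w)) \<and> (\<forall>u w. linear (\<lambda>v. T p u v w)) \<and> (\<forall>u v. linear (T p u v))) \<and>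
     (\<forall>c\<in>A. \<forall>u v w. smooth_on (cmap c ` cdom c)
        (\<lambda>x. T (cinv c x) (from_coord A c (cinv c x) u) (from_coord A c (cinv c x) v) (from_coord A c (cinv c x) w)))"

definition nabla_form2 ::
  "('m, 'e::euclidean_space) chart set \<Rightarrow> ('m \<Rightarrow> 'e \<Rightarrow> 'e \<Rightarrow> real) \<Rightarrow> ('m \<Rightarrow> 'e \<Rightarrow> 'e \<Rightarrow> real) \<Rightarrow>
   'm \<Rightarrow> 'e \<Rightarrow> 'e \<Rightarrow> 'e \<Rightarrow> real" where
  "nabla_form2 A g T p t u v =
     point_deriv A p (\<lambda>q. T q (const_field A p u q) (const_field A p v q)) t
     - T p (christoffel A g p t u) v - T p u (christoffel A g p t v)"

definition nabla_form3 ::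
  "('m, 'e::euclidean_space) chart set \<Rightarrow> ('m \<Rightarrow> 'e \<Rightarrow> 'e \<Rightarrow> real) \<Rightarrow>
   ('m \<Rightarrow> 'e \<Rightarrow> 'e \<Rightarrow> 'e \<Rightarrow> real) \<Rightarrow> 'm \<Rightarrow> 'e \<Rightarrow> 'e \<Rightarrow> 'e \<Rightarrow> 'e \<Rightarrow> real" where
  "nabla_form3 A g T p t u v w =
     point_deriv A p (\<lambda>q. T q (const_field A p u q) (const_field A p v q) (const_field A p w q)) t
     - T p (christoffel A g p t u) v w - T p u (christoffel A g p t v) w - T p u v (christoffel A g p t w)"

context
  fixes A :: "('m::{t2_space, second_countable_topology}, 'e::euclidean_space) chart set"
  assumes A: "smooth_atlas A"
begin

lemma linear_form2:
  assumes T: "smooth_form2 A T" and c: "c \<in> A" "q \<in> cdom c"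
  shows "linear (\<lambda>u. T q (from_coord A c q u) v)" "linear (\<lambda>v. T q u (from_coord A c q v))"
proof -
  have "bilinear (T q)" using T unfolding smooth_form2_def by blast
  then have "linear (\<lambda>u. T q u v)" "linear (T q u)" unfolding bilinear_def by auto
  from this[THEN linear_compose[OF linear_from_coord[OF A c]]]
  show "linear (\<lambda>u. T q (from_coord A c q u) v)" "linear (\<lambda>v. T q u (from_coord A c q v))"
    by (simp_all add: o_def)
qed

lemma linear_form3:
  assumes T: "smooth_form3 A T" and c: "c \<in> A" "q \<in> cdom c"
  shows "linear (\<lambda>u. T q (from_coord A c q u) v w)" "linear (\<lambda>v. T q u (from_coord A c q v) w)"
    "linear (\<lambda>w. T q u v (from_coord A c q w))"
proof -
  have "linear (\<lambda>u. T q u v w)" "linear (\<lambda>v. T q u v w)" "linear (T q u v)"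
    using T unfolding smooth_form3_def by blast+
  from this[THEN linear_compose[OF linear_from_coord[OF A c]]]
  show "linear (\<lambda>u. T q (from_coord A c q u) v w)" "linear (\<lambda>v. T q u (from_coord A c q v) w)"
    "linear (\<lambda>w. T q u v (from_coord A c q w))"
    by (simp_all add: o_def)
qed

end

text \<open>Covering an arbitrary smooth map gives two uses: the identity yields the intrinsic
  Levi-Civita connection, and an immersion yields the ambient derivative that the formulas of Gauss
  and Weingarten decompose.\<close>

locale manifold_map =
  fixes A :: "('m::{t2_space, second_countable_topology}, 'e::euclidean_space) chart set"
    and B :: "('n::{t2_space, second_countable_topology}, 'f::euclidean_space) chart set"
    and f :: "'m \<Rightarrow> 'n" and g :: "'n \<Rightarrow> 'f \<Rightarrow> 'f \<Rightarrow> real"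
  assumes A: "smooth_atlas A" and B: "smooth_atlas B" and f_smooth: "smooth_map A B f"
    and g_metric: "riemannian_metric B g"
begin

abbreviation df where "df \<equiv> tangent_map A B f"
abbreviation \<Gamma> where "\<Gamma> \<equiv> christoffel B g"
abbreviation cov where "cov \<equiv> cov_along A B g f"
abbreviation rep where "rep c d \<equiv> cmap d \<circ> f \<circ> cinv c"
abbreviation ovl where "ovl c d \<equiv> cmap c ` (cdom c \<inter> f -` cdom d)"

definition fdiff :: "('m \<Rightarrow> 'f) \<Rightarrow> 'm \<Rightarrow> bool" where
  "fdiff V p \<longleftrightarrow> pdiff A p (\<lambda>q. to_coord B (chart_at B (f p)) (f q) (V q))"

text \<open>Restricted to one source chart \<open>c\<close>, because the coordinate fields of
  \<open>c\<close> are meaningful on its domain only; all target charts are still required.\<close>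

definition field_smooth :: "('m, 'e) chart \<Rightarrow> ('m \<Rightarrow> 'f) \<Rightarrow> bool" where
  "field_smooth c V \<longleftrightarrow> (\<forall>d\<in>B. smooth_on (ovl c d) (\<lambda>x. to_coord B d (f (cinv c x)) (V (cinv c x))))"

definition coord_field :: "('m, 'e) chart \<Rightarrow> 'e \<Rightarrow> 'm \<Rightarrow> 'f" where
  "coord_field c v q = df q (from_coord A c q v)"

lemma open_vimage_cdom: "d \<in> B \<Longrightarrow> open (f -` cdom d)"
  using f_smooth open_cdom[OF B] open_vimage unfolding smooth_map_def by blast

lemma open_ovl: "c \<in> A \<Longrightarrow> d \<in> B \<Longrightarrow> open (ovl c d)"
  by (intro open_chart_image_open[OF A] open_vimage_cdom)

lemma smooth_rep: "c \<in> A \<Longrightarrow> d \<in> B \<Longrightarrow> smooth_on (ovl c d) (rep c d)"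
  using f_smooth unfolding smooth_map_def by blast

lemma rep_in: "c \<in> A \<Longrightarrow> d \<in> B \<Longrightarrow> rep c d ` ovl c d \<subseteq> cmap d ` cdom d"
  by (auto simp: cinv_cmap[OF A])

lemma rep_has_derivative:
  assumes "c \<in> A" "d \<in> B" "q \<in> cdom c" "f q \<in> cdom d"
  shows "(rep c d has_derivative frechet_derivative (rep c d) (at (cmap c q))) (at (cmap c q))"
  by (rule differentiable_imp_has_derivative, rule smooth_on_differentiable[OF smooth_rep]) (use assms in auto)

text \<open>By the chain rule, the push-forward of a coordinate field has the partial derivatives of
  the local expression of \<open>f\<close> as components, whichever target chart is used.\<close>

lemma coord_field_chart:
  assumes c: "c \<in> A" "q \<in> cdom c" and d: "d \<in> B" "f q \<in> cdom d"
  shows "to_coord B d (f q) (coord_field c v q) = frechet_derivative (rep c d) (at (cmap c q)) v"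
proof -
  let ?e = "chart_at B (f q)"
  note e = chart_at[OF B, of "f q"]
  have df: "df q (from_coord A c q v) = frechet_derivative (rep c ?e) (at (cmap c q)) v"
    unfolding tangent_map_def
    by (rule point_deriv_chart(3)[OF A c], rule rep_has_derivative) (use c e in auto)
  have 1: "(cmap d \<circ> cinv ?e has_derivative to_coord B d (f q)) (at (cmap ?e (f q)))"
    unfolding to_coord_def point_deriv_def
    by (rule differentiable_imp_has_derivative, rule transition_differentiable[OF B e(1) d(1) e(2) d(2)])
  have "((\<lambda>x. (cmap d \<circ> cinv ?e) (rep c ?e x)) has_derivative
      (\<lambda>v. to_coord B d (f q) (frechet_derivative (rep c ?e) (at (cmap c q)) v))) (at (cmap c q))"
    by (rule has_derivative_compose[OF rep_has_derivative[OF c(1) e(1) c(2) e(2)]])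
      (use 1 in \<open>simp add: cinv_cmap[OF A c] o_def\<close>)
  then have "(rep c d has_derivative
      (\<lambda>v. to_coord B d (f q) (frechet_derivative (rep c ?e) (at (cmap c q)) v))) (at (cmap c q))"
    by (rule has_derivative_transform_within_open[OF _ open_ovl[OF c(1) e(1)]])
      (use c e in \<open>auto simp: cinv_cmap[OF A] cinv_cmap[OF B]\<close>)
  then show ?thesis
    unfolding coord_field_def df using frechet_derivative_eqI by metis
qed

lemma field_smooth_coord_field:
  assumes c: "c \<in> A"
  shows "field_smooth c (coord_field c v)"
  unfolding field_smooth_def
proof
  fix d assume d: "d \<in> B"
  show "smooth_on (ovl c d) (\<lambda>x. to_coord B d (f (cinv c x)) (coord_field c v (cinv c x)))"
    by (rule smooth_on_cong[OF open_ovl[OF c d] _ smooth_on_deriv[OF smooth_rep[OF c d], of v]])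
      (auto simp: cinv_cmap[OF A c] coord_field_chart[OF c _ d])
qed

lemma field_smooth_along: "smooth_field_along A B f V \<Longrightarrow> c \<in> A \<Longrightarrow> field_smooth c V"
  unfolding field_smooth_def smooth_field_along_def by blast

lemma field_smooth_fdiff:
  assumes V: "field_smooth c V" and c: "c \<in> A" "p \<in> cdom c"
  shows "fdiff V p"
proof -
  let ?d = "chart_at B (f p)"
  note d = chart_at[OF B, of "f p"]
  have "smooth_on (ovl c ?d) ((\<lambda>q. to_coord B ?d (f q) (V q)) \<circ> cinv c)"
    using V d(1) unfolding field_smooth_def by (auto simp: o_def)
  then have "((\<lambda>q. to_coord B ?d (f q) (V q)) \<circ> cinv c) differentiable (at (cmap c p))"
    by (rule smooth_on_differentiable) (use c d in auto)
  from point_deriv_chart(1)[OF A c differentiable_imp_has_derivative[OF this]]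
  show ?thesis unfolding fdiff_def .
qed

lemma smooth_form2_along:
  assumes T: "smooth_form2 B T" and V: "field_smooth c V" and W: "field_smooth c W" and c: "c \<in> A"
  shows "smooth_on (cmap c ` cdom c) ((\<lambda>q. T (f q) (V q) (W q)) \<circ> cinv c)"
proof (rule smooth_on_local)
  fix x assume "x \<in> cmap c ` cdom c"
  then obtain q where q: "q \<in> cdom c" "x = cmap c q" by blast
  let ?d = "chart_at B (f q)"
  note d = chart_at[OF B, of "f q"]
  note O = open_ovl[OF c d(1)]
  \<comment> \<open>Coefficients of \<open>T\<close> pulled back to the source chart: frozen
    arguments first, the varying components of the fields afterwards.\<close>
  define T' where "T' x u v = (let y = rep c ?d x in
    T (cinv ?d y) (from_coord B ?d (cinv ?d y) u) (from_coord B ?d (cinv ?d y) v))" for x u v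
  define V' where "V' x = to_coord B ?d (f (cinv c x)) (V (cinv c x))" for x
  define W' where "W' x = to_coord B ?d (f (cinv c x)) (W (cinv c x))" for x
  have lin: "linear (T' x u)" "linear (\<lambda>u. T' x u v)" if "x \<in> ovl c ?d" for x u v
  proof -
    have y: "cinv ?d (rep c ?d x) \<in> cdom ?d"
      using cmap_cinv(2)[OF B d(1), of "rep c ?d x"] rep_in[OF c d(1)] that by blast
    show "linear (T' x u)" "linear (\<lambda>u. T' x u v)"
      unfolding T'_def Let_def by (rule linear_form2[OF B T d(1) y])+
  qed
  have T': "smooth_on (ovl c ?d) (\<lambda>x. T' x u v)" for u v
    unfolding T'_def Let_def
    by (rule smooth_on_compose[OF O smooth_rep[OF c d(1)] _ rep_in[OF c d(1)]])
      (use T d(1) in \<open>auto simp: smooth_form2_def\<close>)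
  have V': "smooth_on (ovl c ?d) V'" and W': "smooth_on (ovl c ?d) W'"
    using V W d(1) unfolding field_smooth_def V'_def W'_def by auto
  have 1: "smooth_on (ovl c ?d) (\<lambda>x. T' x (V' x) v)" for v
    by (rule smooth_on_linear_family[where T = "\<lambda>x u. T' x u v", OF O lin(2) T' V'])
  have "smooth_on (ovl c ?d) (\<lambda>x. T' x (V' x) (W' x))"
    by (rule smooth_on_linear_family[where T = "\<lambda>x v. T' x (V' x) v", OF O lin(1) 1 W'])
  then have "smooth_on (ovl c ?d) ((\<lambda>q. T (f q) (V q) (W q)) \<circ> cinv c)"
    by (rule smooth_on_cong[OF O, rotated])
      (use d(1) in \<open>auto simp: T'_def V'_def W'_def cinv_cmap[OF A c] cinv_cmap[OF B] from_to_coord[OF B]\<close>)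
  then show "\<exists>U. open U \<and> x \<in> U \<and> smooth_on U ((\<lambda>q. T (f q) (V q) (W q)) \<circ> cinv c)"
    using O q d by blast
qed

lemma smooth_form3_along:
  assumes T: "smooth_form3 B T" and V: "field_smooth c V" and W: "field_smooth c W" and Z: "field_smooth c Z"
    and c: "c \<in> A"
  shows "smooth_on (cmap c ` cdom c) ((\<lambda>q. T (f q) (V q) (W q) (Z q)) \<circ> cinv c)"
proof (rule smooth_on_local)
  fix x assume "x \<in> cmap c ` cdom c"
  then obtain q where q: "q \<in> cdom c" "x = cmap c q" by blast
  let ?d = "chart_at B (f q)"
  note d = chart_at[OF B, of "f q"]
  note O = open_ovl[OF c d(1)]
  define T' where "T' x u v w = (let y = rep c ?d x in
    T (cinv ?d y) (from_coord B ?d (cinv ?d y) u) (from_coord B ?d (cinv ?d y) v) (from_coord B ?d (cinv ?d y) w))"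
    for x u v w
  define V' where "V' x = to_coord B ?d (f (cinv c x)) (V (cinv c x))" for x
  define W' where "W' x = to_coord B ?d (f (cinv c x)) (W (cinv c x))" for x
  define Z' where "Z' x = to_coord B ?d (f (cinv c x)) (Z (cinv c x))" for x
  have lin: "linear (T' x u v)" "linear (\<lambda>v. T' x u v w)" "linear (\<lambda>u. T' x u v w)" if "x \<in> ovl c ?d" for x u v w
  proof -
    have y: "cinv ?d (rep c ?d x) \<in> cdom ?d"
      using cmap_cinv(2)[OF B d(1), of "rep c ?d x"] rep_in[OF c d(1)] that by blast
    show "linear (T' x u v)" "linear (\<lambda>v. T' x u v w)" "linear (\<lambda>u. T' x u v w)"
      unfolding T'_def Let_def by (rule linear_form3[OF B T d(1) y])+
  qed
  have T': "smooth_on (ovl c ?d) (\<lambda>x. T' x u v w)" for u v w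
    unfolding T'_def Let_def
    by (rule smooth_on_compose[OF O smooth_rep[OF c d(1)] _ rep_in[OF c d(1)]])
      (use T d(1) in \<open>auto simp: smooth_form3_def\<close>)
  have V': "smooth_on (ovl c ?d) V'" and W': "smooth_on (ovl c ?d) W'" and Z': "smooth_on (ovl c ?d) Z'"
    using V W Z d(1) unfolding field_smooth_def V'_def W'_def Z'_def by auto
  have 1: "smooth_on (ovl c ?d) (\<lambda>x. T' x (V' x) v w)" for v w
    by (rule smooth_on_linear_family[where T = "\<lambda>x u. T' x u v w", OF O lin(3) T' V'])
  have 2: "smooth_on (ovl c ?d) (\<lambda>x. T' x (V' x) (W' x) w)" for w
    by (rule smooth_on_linear_family[where T = "\<lambda>x v. T' x (V' x) v w", OF O lin(2) 1 W'])
  have "smooth_on (ovl c ?d) (\<lambda>x. T' x (V' x) (W' x) (Z' x))"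
    by (rule smooth_on_linear_family[where T = "\<lambda>x w. T' x (V' x) (W' x) w", OF O lin(1) 2 Z'])
  then have "smooth_on (ovl c ?d) ((\<lambda>q. T (f q) (V q) (W q) (Z q)) \<circ> cinv c)"
    by (rule smooth_on_cong[OF O, rotated])
      (use d(1) in \<open>auto simp: T'_def V'_def W'_def Z'_def cinv_cmap[OF A c] cinv_cmap[OF B] from_to_coord[OF B]\<close>)
  then show "\<exists>U. open U \<and> x \<in> U \<and> smooth_on U ((\<lambda>q. T (f q) (V q) (W q) (Z q)) \<circ> cinv c)"
    using O q d by blast
qed

section \<open>The Leibniz rule along a map and the induced connection\<close>

lemma f_chart_derivative:
  "(rep (chart_at A p) (chart_at B (f p)) has_derivative df p) (at (cmap (chart_at A p) p))"
  using rep_has_derivative[OF chart_at(1)[OF A] chart_at(1)[OF B] chart_at(2)[OF A] chart_at(2)[OF B]]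
  unfolding tangent_map_def point_deriv_def .

lemma df_linear: "linear (df p)"
  by (rule has_derivative_linear[OF f_chart_derivative])

lemma coord_field_at: "coord_field (chart_at A p) v p = df p v"
  using const_field_self[OF A, of p v] unfolding coord_field_def const_field_def by simp

text \<open>In coordinates this is the product rule for coefficients and components. The Christoffel
  terms that \<open>cov\<close> adds for the two fields are those that \<open>nabla_form2\<close>
  subtracts.\<close>

lemma leibniz2:
  assumes T: "smooth_form2 B T" and V: "fdiff V p" and W: "fdiff W p"
  shows "pdiff A p (\<lambda>q. T (f q) (V q) (W q))" (is ?P)
    "point_deriv A p (\<lambda>q. T (f q) (V q) (W q)) u =
      nabla_form2 B g T (f p) (df p u) (V p) (W p) + T (f p) (cov V p u) (W p) + T (f p) (V p) (cov W p u)"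
    (is ?Q)
proof -
  define c where "c = chart_at A p"
  define d where "d = chart_at B (f p)"
  have c: "c \<in> A" "p \<in> cdom c" and d: "d \<in> B" "f p \<in> cdom d"
    unfolding c_def d_def by (simp_all add: chart_at[OF A] chart_at[OF B])
  note O = open_ovl[OF c(1) d(1)]
  have x: "cmap c p \<in> ovl c d" using c d by blast
  define T' where "T' y u v = T (cinv d y) (from_coord B d (cinv d y) u) (from_coord B d (cinv d y) v)" for y u v
  define V' where "V' = (\<lambda>q. to_coord B d (f q) (V q)) \<circ> cinv c"
  define W' where "W' = (\<lambda>q. to_coord B d (f q) (W q)) \<circ> cinv c"
  define dV where "dV = point_deriv A p (\<lambda>q. to_coord B d (f q) (V q))"
  define dW where "dW = point_deriv A p (\<lambda>q. to_coord B d (f q) (W q))"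
  define dT where "dT u v = point_deriv B (f p) (\<lambda>q. T q (const_field B (f p) u q) (const_field B (f p) v q))" for u v
  have lin: "linear (\<lambda>v. T' (rep c d x) u v)" "linear (\<lambda>u. T' (rep c d x) u v)" if "x \<in> ovl c d" for x u v
  proof -
    have y: "cinv d (rep c d x) \<in> cdom d"
      using cmap_cinv(2)[OF B d(1), of "rep c d x"] rep_in[OF c(1) d(1)] that by blast
    show "linear (\<lambda>v. T' (rep c d x) u v)" "linear (\<lambda>u. T' (rep c d x) u v)"
      unfolding T'_def by (rule linear_form2[OF B T d(1) y])+
  qed
  have "((\<lambda>y. T' y u v) has_derivative dT u v) (at (cmap d (f p)))" for u v
  proof -
    have "smooth_on (cmap d ` cdom d) (\<lambda>y. T' y u v)"
      using T d(1) unfolding smooth_form2_def T'_def by blast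
    then have "(\<lambda>y. T' y u v) differentiable (at (cmap d (f p)))"
      using d by (intro smooth_on_differentiable) auto
    from differentiable_imp_has_derivative[OF this] show ?thesis
      unfolding dT_def point_deriv_def T'_def by (simp add: o_def const_field_def d_def)
  qed
  \<comment> \<open>With frozen arguments the coefficient depends on the point only through
    \<open>f\<close>, so its derivative is taken along \<open>df\<close>.\<close>
  then have T': "((\<lambda>x. T' (rep c d x) u v) has_derivative (\<lambda>t. dT u v (df p t))) (at (cmap c p))" for u v
    using has_derivative_compose[OF f_chart_derivative[of p, folded c_def d_def], of "\<lambda>y. T' y u v" "dT u v"]
    by (simp add: cinv_cmap[OF A c])
  have V': "(V' has_derivative dV) (at (cmap c p))" and W': "(W' has_derivative dW) (at (cmap c p))"
    using V W unfolding V'_def W'_def dV_def dW_def c_def d_def fdiff_def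
    by (simp_all add: has_derivative_point_deriv)
  have at_p: "V' (cmap c p) = V p" "W' (cmap c p) = W p" "T' (rep c d (cmap c p)) u v = T (f p) u v" for u v
  proof -
    show "V' (cmap c p) = V p" "W' (cmap c p) = W p"
      unfolding V'_def W'_def d_def by (simp_all add: cinv_cmap[OF A c] to_coord_self[OF B])
    show "T' (rep c d (cmap c p)) u v = T (f p) u v"
      using const_field_self[OF B, of "f p"]
      unfolding T'_def const_field_def d_def[symmetric] by (simp add: cinv_cmap[OF A c] cinv_cmap[OF B d])
  qed
  have 1: "((\<lambda>x. T' (rep c d x) (V' x) v) has_derivative (\<lambda>t. dT (V p) v (df p t) + T (f p) (dV t) v)) (at (cmap c p))" for v
    using has_derivative_linear_family[where T = "\<lambda>x u. T' (rep c d x) u v", OF O x lin(2) T' V'] by (simp only: at_p)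
  have lin2: "linear (\<lambda>v. T' (rep c d x) (V' x) v)" if "x \<in> ovl c d" for x by (rule lin(1)[OF that])
  have 2: "((\<lambda>x. T' (rep c d x) (V' x) (W' x)) has_derivative
      (\<lambda>t. dT (V p) (W p) (df p t) + T (f p) (dV t) (W p) + T (f p) (V p) (dW t))) (at (cmap c p))"
    using has_derivative_linear_family[where T = "\<lambda>x v. T' (rep c d x) (V' x) v", OF O x lin2 1 W'] by (simp only: at_p)
  have "((\<lambda>q. T (f q) (V q) (W q)) \<circ> cinv c has_derivative
      (\<lambda>t. dT (V p) (W p) (df p t) + T (f p) (dV t) (W p) + T (f p) (V p) (dW t))) (at (cmap c p))"
    by (rule has_derivative_transform_within_open[OF 2 O x])
      (use c(1) d(1) in \<open>auto simp: T'_def V'_def W'_def cinv_cmap[OF A] cinv_cmap[OF B] from_to_coord[OF B]\<close>)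
  from pdiffI[OF this[unfolded c_def]] have P: ?P and D: "point_deriv A p (\<lambda>q. T (f q) (V q) (W q)) u =
      dT (V p) (W p) (df p u) + T (f p) (dV u) (W p) + T (f p) (V p) (dW u)" by simp_all
  show ?P by (rule P)
  have bil: "bilinear (T (f p))" using T unfolding smooth_form2_def by blast
  show ?Q
    unfolding D nabla_form2_def cov_along_def
    by (simp add: dT_def dV_def dW_def d_def bilinear_ladd[OF bil] bilinear_radd[OF bil])
qed

lemma leibniz3:
  assumes T: "smooth_form3 B T" and V: "fdiff V p" and W: "fdiff W p" and Z: "fdiff Z p"
  shows "pdiff A p (\<lambda>q. T (f q) (V q) (W q) (Z q))" (is ?P)
    "point_deriv A p (\<lambda>q. T (f q) (V q) (W q) (Z q)) u =
      nabla_form3 B g T (f p) (df p u) (V p) (W p) (Z p) + T (f p) (cov V p u) (W p) (Z p)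
      + T (f p) (V p) (cov W p u) (Z p) + T (f p) (V p) (W p) (cov Z p u)"
    (is ?Q)
proof -
  define c where "c = chart_at A p"
  define d where "d = chart_at B (f p)"
  have c: "c \<in> A" "p \<in> cdom c" and d: "d \<in> B" "f p \<in> cdom d"
    unfolding c_def d_def by (simp_all add: chart_at[OF A] chart_at[OF B])
  note O = open_ovl[OF c(1) d(1)]
  have x: "cmap c p \<in> ovl c d" using c d by blast
  define T' where "T' y u v w = T (cinv d y) (from_coord B d (cinv d y) u) (from_coord B d (cinv d y) v)
    (from_coord B d (cinv d y) w)" for y u v w
  define V' where "V' = (\<lambda>q. to_coord B d (f q) (V q)) \<circ> cinv c"
  define W' where "W' = (\<lambda>q. to_coord B d (f q) (W q)) \<circ> cinv c"
  define Z' where "Z' = (\<lambda>q. to_coord B d (f q) (Z q)) \<circ> cinv c"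
  define dV where "dV = point_deriv A p (\<lambda>q. to_coord B d (f q) (V q))"
  define dW where "dW = point_deriv A p (\<lambda>q. to_coord B d (f q) (W q))"
  define dZ where "dZ = point_deriv A p (\<lambda>q. to_coord B d (f q) (Z q))"
  define dT where "dT u v w = point_deriv B (f p)
    (\<lambda>q. T q (const_field B (f p) u q) (const_field B (f p) v q) (const_field B (f p) w q))" for u v w
  have lin: "linear (\<lambda>w. T' (rep c d x) u v w)" "linear (\<lambda>v. T' (rep c d x) u v w)"
    "linear (\<lambda>u. T' (rep c d x) u v w)" if "x \<in> ovl c d" for x u v w
  proof -
    have y: "cinv d (rep c d x) \<in> cdom d"
      using cmap_cinv(2)[OF B d(1), of "rep c d x"] rep_in[OF c(1) d(1)] that by blast
    show "linear (\<lambda>w. T' (rep c d x) u v w)" "linear (\<lambda>v. T' (rep c d x) u v w)"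
      "linear (\<lambda>u. T' (rep c d x) u v w)"
      unfolding T'_def by (rule linear_form3[OF B T d(1) y])+
  qed
  have "((\<lambda>y. T' y u v w) has_derivative dT u v w) (at (cmap d (f p)))" for u v w
  proof -
    have "smooth_on (cmap d ` cdom d) (\<lambda>y. T' y u v w)"
      using T d(1) unfolding smooth_form3_def T'_def by blast
    then have "(\<lambda>y. T' y u v w) differentiable (at (cmap d (f p)))"
      using d by (intro smooth_on_differentiable) auto
    from differentiable_imp_has_derivative[OF this] show ?thesis
      unfolding dT_def point_deriv_def T'_def by (simp add: o_def const_field_def d_def)
  qed
  then have T': "((\<lambda>x. T' (rep c d x) u v w) has_derivative (\<lambda>t. dT u v w (df p t))) (at (cmap c p))" for u v w
    using has_derivative_compose[OF f_chart_derivative[of p, folded c_def d_def], of "\<lambda>y. T' y u v w" "dT u v w"]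
    by (simp add: cinv_cmap[OF A c])
  have V': "(V' has_derivative dV) (at (cmap c p))" and W': "(W' has_derivative dW) (at (cmap c p))"
    and Z': "(Z' has_derivative dZ) (at (cmap c p))"
    using V W Z unfolding V'_def W'_def Z'_def dV_def dW_def dZ_def c_def d_def fdiff_def
    by (simp_all add: has_derivative_point_deriv)
  have at_p: "V' (cmap c p) = V p" "W' (cmap c p) = W p" "Z' (cmap c p) = Z p"
    "T' (rep c d (cmap c p)) u v w = T (f p) u v w" for u v w
  proof -
    show "V' (cmap c p) = V p" "W' (cmap c p) = W p" "Z' (cmap c p) = Z p"
      unfolding V'_def W'_def Z'_def d_def by (simp_all add: cinv_cmap[OF A c] to_coord_self[OF B])
    show "T' (rep c d (cmap c p)) u v w = T (f p) u v w"
      using const_field_self[OF B, of "f p"]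
      unfolding T'_def const_field_def d_def[symmetric] by (simp add: cinv_cmap[OF A c] cinv_cmap[OF B d])
  qed
  have 1: "((\<lambda>x. T' (rep c d x) (V' x) v w) has_derivative
      (\<lambda>t. dT (V p) v w (df p t) + T (f p) (dV t) v w)) (at (cmap c p))" for v w
    using has_derivative_linear_family[where T = "\<lambda>x u. T' (rep c d x) u v w", OF O x lin(3) T' V']
    by (simp only: at_p)
  have lin2: "linear (\<lambda>v. T' (rep c d x) (V' x) v w)" if "x \<in> ovl c d" for x w by (rule lin(2)[OF that])
  have 2: "((\<lambda>x. T' (rep c d x) (V' x) (W' x) w) has_derivative
      (\<lambda>t. dT (V p) (W p) w (df p t) + T (f p) (dV t) (W p) w + T (f p) (V p) (dW t) w)) (at (cmap c p))" for w
    using has_derivative_linear_family[where T = "\<lambda>x v. T' (rep c d x) (V' x) v w", OF O x lin2 1 W']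
    by (simp only: at_p)
  have lin3: "linear (\<lambda>w. T' (rep c d x) (V' x) (W' x) w)" if "x \<in> ovl c d" for x by (rule lin(1)[OF that])
  have 3: "((\<lambda>x. T' (rep c d x) (V' x) (W' x) (Z' x)) has_derivative
      (\<lambda>t. dT (V p) (W p) (Z p) (df p t) + T (f p) (dV t) (W p) (Z p) + T (f p) (V p) (dW t) (Z p)
        + T (f p) (V p) (W p) (dZ t))) (at (cmap c p))"
    using has_derivative_linear_family[where T = "\<lambda>x w. T' (rep c d x) (V' x) (W' x) w", OF O x lin3 2 Z']
    by (simp only: at_p)
  have "((\<lambda>q. T (f q) (V q) (W q) (Z q)) \<circ> cinv c has_derivative
      (\<lambda>t. dT (V p) (W p) (Z p) (df p t) + T (f p) (dV t) (W p) (Z p) + T (f p) (V p) (dW t) (Z p)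
        + T (f p) (V p) (W p) (dZ t))) (at (cmap c p))"
    by (rule has_derivative_transform_within_open[OF 3 O x])
      (use c(1) d(1) in \<open>auto simp: T'_def V'_def W'_def Z'_def cinv_cmap[OF A] cinv_cmap[OF B] from_to_coord[OF B]\<close>)
  from pdiffI[OF this[unfolded c_def]] have P: ?P and D: "point_deriv A p (\<lambda>q. T (f q) (V q) (W q) (Z q)) u =
      dT (V p) (W p) (Z p) (df p u) + T (f p) (dV u) (W p) (Z p) + T (f p) (V p) (dW u) (Z p)
        + T (f p) (V p) (W p) (dZ u)" by simp_all
  show ?P by (rule P)
  have l: "linear (\<lambda>u. T (f p) u v w)" "linear (\<lambda>v. T (f p) u v w)" "linear (T (f p) u v)" for u v w
    using T unfolding smooth_form3_def by blast+
  show ?Q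
    unfolding D nabla_form3_def cov_along_def
    by (simp add: dT_def dV_def dW_def dZ_def d_def linear_add[OF l(1)] linear_add[OF l(2)] linear_add[OF l(3)])
qed

lemma smooth_form2_metric: "smooth_form2 B g"
  using g_metric unfolding riemannian_metric_def smooth_form2_def by (simp add: Let_def)

lemma g_bilinear: "bilinear (g q)" and g_sym: "g q u v = g q v u"
  using g_metric unfolding riemannian_metric_def by blast+

lemma levi_civita: "levi_civita_at B g q (\<Gamma> q)"
  by (rule christoffel_levi_civita(2)[OF B g_metric])

lemma Gamma_bilinear: "bilinear (\<Gamma> q)" and Gamma_sym: "\<Gamma> q u v = \<Gamma> q v u"
  using levi_civita[of q] unfolding levi_civita_at_def by blast+

lemma metric_parallel: "nabla_form2 B g g q t u v = 0"
  using levi_civita[of q] unfolding levi_civita_at_def nabla_form2_def by simp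

lemma cov_metric:
  assumes "fdiff V p" "fdiff W p"
  shows "point_deriv A p (\<lambda>q. g (f q) (V q) (W q)) u = g (f p) (cov V p u) (W p) + g (f p) (V p) (cov W p u)"
  using leibniz2(2)[OF smooth_form2_metric assms] by (simp add: metric_parallel)

lemma cov_linear: "fdiff V p \<Longrightarrow> linear (cov V p)"
proof -
  assume "fdiff V p"
  then have l: "linear (point_deriv A p (\<lambda>q. to_coord B (chart_at B (f p)) (f q) (V q)))"
    unfolding fdiff_def by (rule linear_point_deriv)
  show ?thesis
    unfolding cov_along_def
    by (rule linearI) (simp_all add: linear_add[OF l] linear_scale[OF l] linear_add[OF df_linear]
        linear_scale[OF df_linear] bilinear_ladd[OF Gamma_bilinear] bilinear_lmul[OF Gamma_bilinear]
        scaleR_add_right)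
qed

text \<open>Second partial derivatives of \<open>f\<close> commute and the Christoffel symbols are
  symmetric. For the identity this is vanishing torsion; for an immersion it will make the second
  fundamental form symmetric.\<close>

lemma cov_coord_field:
  assumes c: "c \<in> A" "q \<in> cdom c"
  shows "cov (coord_field c v) q (from_coord A c q u) = cov (coord_field c u) q (from_coord A c q v)"
proof -
  let ?d = "chart_at B (f q)"
  note d = chart_at[OF B, of "f q"]
  have D: "point_deriv A q (\<lambda>q. to_coord B ?d (f q) (coord_field c v q)) (from_coord A c q u)
      = frechet_derivative (\<lambda>x. frechet_derivative (rep c ?d) (at x) v) (at (cmap c q)) u" for u v
  proof (rule point_deriv_chart(3)[OF A c])
    have "((\<lambda>x. frechet_derivative (rep c ?d) (at x) v) has_derivative
        frechet_derivative (\<lambda>x. frechet_derivative (rep c ?d) (at x) v) (at (cmap c q))) (at (cmap c q))"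
      by (rule differentiable_imp_has_derivative,
          rule smooth_on_differentiable[OF smooth_on_deriv[OF smooth_rep[OF c(1) d(1)]]]) (use c d in auto)
    then show "((\<lambda>q. to_coord B ?d (f q) (coord_field c v q)) \<circ> cinv c has_derivative
        frechet_derivative (\<lambda>x. frechet_derivative (rep c ?d) (at x) v) (at (cmap c q))) (at (cmap c q))"
      by (rule has_derivative_transform_within_open[OF _ open_ovl[OF c(1) d(1)]])
        (use c d in \<open>auto simp: cinv_cmap[OF A] coord_field_chart\<close>)
  qed
  have x: "cmap c q \<in> ovl c ?d" using c d by blast
  show ?thesis
    unfolding cov_along_def D coord_field_def[symmetric]
    using symmetric_second_derivative[OF open_ovl[OF c(1) d(1)] x smooth_rep[OF c(1) d(1)]] Gamma_sym by simp
qed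

lemma fdiff_const_field: "fdiff (\<lambda>q. const_field B (f p) w (f q)) p"
proof -
  let ?d = "chart_at B (f p)"
  note d = chart_at[OF B, of "f p"]
  show ?thesis
    unfolding fdiff_def const_field_def
    by (rule pdiff_cong(1)[OF A open_vimage_cdom[OF d(1)] _ _ pdiff_const(1)[of A p w]])
      (use d in \<open>auto simp: to_from_coord[OF B]\<close>)
qed

context
  fixes T assumes T: "smooth_endo_field B T"
begin

lemma endo_linear: "linear (T q)"
  using T unfolding smooth_endo_field_def by blast

lemma endo_smooth:
  "d \<in> B \<Longrightarrow> smooth_on (cmap d ` cdom d)
    (\<lambda>y. to_coord B d (cinv d y) (T (cinv d y) (from_coord B d (cinv d y) v)))"
  using T unfolding smooth_endo_field_def by (simp add: Let_def)

lemma smooth_form2_endo: "smooth_form2 B (\<lambda>q u v. g q (T q u) v)"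
  unfolding smooth_form2_def
proof (intro conjI ballI allI)
  fix q
  show "bilinear (\<lambda>u v. g q (T q u) v)"
    unfolding bilinear_def
    by (intro conjI allI linearI) (simp_all add: linear_add[OF endo_linear] linear_scale[OF endo_linear]
        bilinear_ladd[OF g_bilinear] bilinear_radd[OF g_bilinear] bilinear_lmul[OF g_bilinear] bilinear_rmul[OF g_bilinear])
next
  fix d u v assume d: "d \<in> B"
  note O = open_chart_image[OF B d]
  have "smooth_on (cmap d ` cdom d) (\<lambda>y. g (cinv d y)
      (from_coord B d (cinv d y) (to_coord B d (cinv d y) (T (cinv d y) (from_coord B d (cinv d y) u))))
      (from_coord B d (cinv d y) v))"
  proof (rule smooth_on_linear_family[where T = "\<lambda>y w. g (cinv d y) (from_coord B d (cinv d y) w) (from_coord B d (cinv d y) v)", OF O])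
    show "linear (\<lambda>w. g (cinv d y) (from_coord B d (cinv d y) w) (from_coord B d (cinv d y) v))"
      if "y \<in> cmap d ` cdom d" for y
      by (rule linear_form2(1)[OF B smooth_form2_metric d cmap_cinv(2)[OF B d that]])
    show "smooth_on (cmap d ` cdom d) (\<lambda>y. g (cinv d y) (from_coord B d (cinv d y) w) (from_coord B d (cinv d y) v))" for w
      using smooth_form2_metric d unfolding smooth_form2_def by blast
  qed (rule endo_smooth[OF d])
  then show "smooth_on (cmap d ` cdom d) (\<lambda>y. g (cinv d y) (T (cinv d y) (from_coord B d (cinv d y) u)) (from_coord B d (cinv d y) v))"
    by (rule smooth_on_cong[OF O, rotated]) (auto simp: cinv_cmap[OF B d] from_to_coord[OF B d])
qed

lemma field_smooth_endo:
  assumes V: "field_smooth c V" and c: "c \<in> A"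
  shows "field_smooth c (\<lambda>q. T (f q) (V q))"
  unfolding field_smooth_def
proof
  fix d assume d: "d \<in> B"
  note O = open_ovl[OF c d]
  define T' where "T' y v = to_coord B d (cinv d y) (T (cinv d y) (from_coord B d (cinv d y) v))" for y v
  have "smooth_on (ovl c d) (\<lambda>x. T' (rep c d x) (to_coord B d (f (cinv c x)) (V (cinv c x))))"
  proof (rule smooth_on_linear_family[where T = "\<lambda>x. T' (rep c d x)", OF O])
    show "smooth_on (ovl c d) (\<lambda>x. T' (rep c d x) v)" for v
      by (rule smooth_on_compose[OF O smooth_rep[OF c d] _ rep_in[OF c d]])
        (use endo_smooth[OF d] in \<open>simp add: T'_def\<close>)
    show "smooth_on (ovl c d) (\<lambda>x. to_coord B d (f (cinv c x)) (V (cinv c x)))"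
      using V d unfolding field_smooth_def by blast
    show "linear (T' (rep c d x))" if "x \<in> ovl c d" for x
    proof -
      have y: "cinv d (rep c d x) \<in> cdom d"
        using cmap_cinv(2)[OF B d, of "rep c d x"] rep_in[OF c d] that by blast
      from linear_compose[OF linear_compose[OF linear_from_coord[OF B d y] endo_linear] linear_to_coord[OF B d y]]
      show ?thesis unfolding T'_def by (simp add: o_def)
    qed
  qed
  then show "smooth_on (ovl c d) (\<lambda>x. to_coord B d (f (cinv c x)) (T (f (cinv c x)) (V (cinv c x))))"
    by (rule smooth_on_cong[OF O, rotated])
      (use d c in \<open>auto simp: T'_def cinv_cmap[OF A] cinv_cmap[OF B] from_to_coord[OF B]\<close>)
qed

text \<open>The Leibniz rule for an endomorphism field, tested against \<open>w\<close>. Extending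
  \<open>w\<close> to a constant field and expanding the same derivative with the metric and with
  the lowered tensor, the derivative of the test field cancels.\<close>

lemma cov_endo:
  assumes V: "fdiff V p" and TV: "fdiff (\<lambda>q. T (f q) (V q)) p"
  shows "g (f p) (cov (\<lambda>q. T (f q) (V q)) p u) w =
    nabla_form2 B g (\<lambda>q u v. g q (T q u) v) (f p) (df p u) (V p) w + g (f p) (T (f p) (cov V p u)) w"
  using leibniz2(2)[OF smooth_form2_endo V fdiff_const_field[of p w], of u]
    cov_metric[OF TV fdiff_const_field[of p w], of u]
  by (simp add: const_field_self[OF B])

end

end

section \<open>The identity map: intrinsic Riemannian geometry\<close>

locale riemannian_manifold =
  fixes A :: "('m::{t2_space, second_countable_topology}, 'e::euclidean_space) chart set"
    and g :: "'m \<Rightarrow> 'e \<Rightarrow> 'e \<Rightarrow> real"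
  assumes A: "smooth_atlas A" and g_metric: "riemannian_metric A g"

sublocale riemannian_manifold \<subseteq> manifold_map A A id g
proof
  have "smooth_on (cmap c ` (cdom c \<inter> cdom d)) (cmap d \<circ> cinv c)" if "c \<in> A" "d \<in> A" for c d
    using A that unfolding smooth_atlas_def by blast
  then show "smooth_map A A id" unfolding smooth_map_def by simp
qed (rule A g_metric)+

context riemannian_manifold
begin

lemma metric_inner: "inner_form (g p)"
  using g_metric unfolding riemannian_metric_def inner_form_def by blast

lemma tangent_map_id: "tangent_map A A id p u = u"
  using to_coord_self[OF A, of p u] unfolding tangent_map_def to_coord_def by (simp add: o_def)

lemma coord_field_id: "coord_field c v = (\<lambda>q. from_coord A c q v)"
  unfolding coord_field_def tangent_map_id ..

lemma const_field_smooth: "field_smooth (chart_at A p) (const_field A p v)"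
  using field_smooth_coord_field[OF chart_at(1)[OF A, of p], of v]
  unfolding coord_field_id const_field_def .

lemma fdiff_const: "fdiff (const_field A p v) p"
  using fdiff_const_field[of p v] by simp

lemma nabla_const_sym: "nabla A g (const_field A p v) p u = nabla A g (const_field A p u) p v"
  using cov_coord_field[OF chart_at[OF A, of p], of v u] const_field_self[OF A, of p]
  unfolding nabla_def coord_field_id const_field_def by simp

text \<open>The bridge from \<open>nabla_endo\<close>, in which the theorem is stated, to lowered
  forms, for which the Leibniz rules are available.\<close>

lemma nabla_endo_form2:
  assumes T: "smooth_endo_field A T"
  shows "g p (nabla_endo A g T p u v) w = nabla_form2 A g (\<lambda>q u v. g q (T q u) v) p u v w"
  using cov_endo[OF T fdiff_const[of p v]
      field_smooth_fdiff[OF field_smooth_endo[OF T const_field_smooth chart_at(1)[OF A]] chart_at[OF A]], of u w]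
  unfolding nabla_endo_def nabla_def
  by (simp add: bilinear_lsub[OF g_bilinear] tangent_map_id const_field_self[OF A])

end

text \<open>Lowering an index can be undone smoothly, because the metric coefficients form an
  invertible matrix. In this way forms with smooth coefficients give smooth vector and endomorphism
  fields.\<close>

lemma smooth_on_metric_dual:
  fixes A :: "('m::{t2_space, second_countable_topology}, real^'n) chart set" and V :: "'m \<Rightarrow> real^'n"
  assumes A: "smooth_atlas A" and g: "riemannian_metric A g" and c: "c \<in> A"
    and V: "\<And>w. smooth_on (cmap c ` cdom c) (\<lambda>x. g (cinv c x) (V (cinv c x)) (from_coord A c (cinv c x) w))"
  shows "smooth_on (cmap c ` cdom c) (\<lambda>x. to_coord A c (cinv c x) (V (cinv c x)))"
proof -
  interpret riemannian_manifold A g by unfold_locales (rule A g)+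
  note O = open_chart_image[OF A c]
  let ?b = "\<lambda>x v w. g (cinv c x) (from_coord A c (cinv c x) v) (from_coord A c (cinv c x) w)"
  show ?thesis
  proof (rule smooth_on_dual[OF O])
    fix v w
    show "smooth_on (cmap c ` cdom c) (\<lambda>x. ?b x v w)"
      using smooth_form2_metric c unfolding smooth_form2_def by blast
    show "smooth_on (cmap c ` cdom c) (\<lambda>x. ?b x (to_coord A c (cinv c x) (V (cinv c x))) w)"
      by (rule smooth_on_cong[OF O _ V[of w]]) (use c in \<open>auto simp: cinv_cmap[OF A] from_to_coord[OF A]\<close>)
    fix x assume x: "x \<in> cmap c ` cdom c"
    note q = cmap_cinv(2)[OF A c x]
    show "bilinear (?b x)"
      unfolding bilinear_def using linear_form2[OF A smooth_form2_metric c q] by blast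
    show "?b x v v \<noteq> 0" if v: "v \<noteq> 0"
    proof -
      have "from_coord A c (cinv c x) v \<noteq> 0"
        using to_from_coord[OF A c q, of v] v linear_0[OF linear_to_coord[OF A c q]] by auto
      from inner_form.pos[OF metric_inner[of "cinv c x"] this] show ?thesis by simp
    qed
  qed
qed

section \<open>Six-dimensional nearly Kaehler manifolds\<close>

locale nk_manifold =
  fixes B :: "('n::{t2_space, second_countable_topology}, real^6) chart set"
    and g :: "'n \<Rightarrow> real^6 \<Rightarrow> real^6 \<Rightarrow> real" and J :: "'n \<Rightarrow> real^6 \<Rightarrow> real^6"
  assumes B: "smooth_atlas B" and nk: "nearly_kaehler B g J" and type_one: "constant_type_one B g J"
begin

abbreviation G where "G \<equiv> nabla_endo B g J"
definition om where "om q u v = g q (J q u) v"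
definition psi where "psi q u v w = g q (G q u v) w"

lemma g_metric: "riemannian_metric B g"
  and J_smooth: "smooth_endo_field B J"
  and JJ: "J q (J q u) = - u" and J_iso: "g q (J q u) (J q v) = g q u v"
  and G_skew: "G q u v = - G q v u"
  using nk unfolding nearly_kaehler_def almost_hermitian_def by blast+

sublocale riemannian_manifold B g
  by unfold_locales (rule B g_metric)+

lemmas glin = inner_form.glin[OF metric_inner]
lemmas g_eqI = inner_form.g_eqI[OF metric_inner]

lemma J_linear: "linear (J q)"
  using J_smooth unfolding smooth_endo_field_def by blast

lemma om_form: "smooth_form2 B om"
  using smooth_form2_endo[OF J_smooth] unfolding om_def[abs_def] .

lemma om_skew: "om q u v = - om q v u"
  using J_iso[of q "J q v" u] g_sym[of q u "J q v"] g_sym[of q v "J q u"] J_iso[of q "J q u" v]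
  unfolding om_def by (simp add: JJ glin)

lemma psi_nabla: "psi q u v w = nabla_form2 B g om q u v w"
  using nabla_endo_form2[OF J_smooth, of q u v w] unfolding psi_def om_def[abs_def] .

lemma pdiff_om_const: "pdiff B q (\<lambda>p. om p (const_field B q u p) (const_field B q v p))"
  using leibniz2(1)[OF om_form fdiff_const fdiff_const] by simp

lemma om_bilinear: "bilinear (om q)"
  using om_form unfolding smooth_form2_def by blast

lemmas omlin = bilinear_ladd[OF om_bilinear] bilinear_radd[OF om_bilinear]
  bilinear_lmul[OF om_bilinear] bilinear_rmul[OF om_bilinear]
  bilinear_lneg[OF om_bilinear] bilinear_rneg[OF om_bilinear]

text \<open>\<Psi> is the covariant derivative of the skew form \<omega>; together with the nearly
  Kaehler condition this makes it alternating.\<close>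

lemma psi_skew23: "psi q u v w = - psi q u w v"
proof -
  have "(\<lambda>p. om p (const_field B q v p) (const_field B q w p))
      = (\<lambda>p. - om p (const_field B q w p) (const_field B q v p))"
    by (rule ext) (rule om_skew)
  then show ?thesis
    unfolding psi_nabla nabla_form2_def
    using om_skew[of q "\<Gamma> q u v" w] om_skew[of q v "\<Gamma> q u w"] by (simp add: pdiff_minus(2)[OF pdiff_om_const])
qed

lemma psi_skew12: "psi q u v w = - psi q v u w"
  unfolding psi_def by (subst G_skew) (simp add: glin)

lemma G_bilinear: "bilinear (G q)"
proof -
  have "linear (\<lambda>u. psi q u v w)" for v w
    unfolding psi_nabla nabla_form2_def
    by (rule linearI)
      (simp_all add: linear_add[OF linear_point_deriv[OF pdiff_om_const]] linear_scale[OF linear_point_deriv[OF pdiff_om_const]]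
        bilinear_ladd[OF Gamma_bilinear] bilinear_lmul[OF Gamma_bilinear] omlin algebra_simps)
  note l = linear_add[OF this] linear_scale[OF this]
  have lin: "linear (\<lambda>u. G q u v)" for v
    by (rule linearI; rule g_eqI[of q]) (use l in \<open>simp_all add: psi_def glin\<close>)
  have "linear (G q u)" for u
  proof -
    have "G q u = (\<lambda>v. - G q v u)" by (rule ext) (rule G_skew)
    then show ?thesis using linear_compose_neg[OF lin[of u]] by simp
  qed
  then show ?thesis unfolding bilinear_def using lin by blast
qed

text \<open>The derivative of J^2 = - Id, obtained by differentiating \<omega>(J V, W) = - g(V, W)
  with the rule for \<omega> and with the rule for \<open>g\<close>.\<close>

lemma G_J: "G q t (J q v) = - J q (G q t v)"
proof (rule g_eqI[of q])
  fix w
  let ?V = "const_field B q v" and ?W = "const_field B q w"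
  let ?JV = "\<lambda>p. J p (?V p)"
  have JV: "fdiff ?JV q"
    using field_smooth_fdiff[OF field_smooth_endo[OF J_smooth const_field_smooth chart_at(1)[OF B]] chart_at[OF B]]
    by simp
  note V = fdiff_const[of q v] and W = fdiff_const[of q w]
  have eq: "(\<lambda>p. om p (?JV p) (?W p)) = (\<lambda>p. - g p (?V p) (?W p))"
    unfolding om_def by (simp add: JJ glin)
  have 1: "point_deriv B q (\<lambda>p. om p (?JV p) (?W p)) t
      = psi q t (J q v) w + om q (cov ?JV q t) w + om q (J q v) (cov ?W q t)"
    using leibniz2(2)[OF om_form JV W] by (simp add: psi_nabla tangent_map_id const_field_self[OF B])
  have gVW: "pdiff B q (\<lambda>p. g p (?V p) (?W p))"
    using leibniz2(1)[OF smooth_form2_metric V W] by simp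
  have 2: "point_deriv B q (\<lambda>p. om p (?JV p) (?W p)) t = - (g q (cov ?V q t) w + g q v (cov ?W q t))"
    unfolding eq pdiff_minus(2)[OF gVW] using cov_metric[OF V W] by (simp add: const_field_self[OF B])
  have 3: "g q (cov ?JV q t) x = psi q t v x + g q (J q (cov ?V q t)) x" for x
    using cov_endo[OF J_smooth, of ?V q t x] V JV
    by (simp add: psi_nabla om_def[abs_def] tangent_map_id const_field_self[OF B])
  have "om q (cov ?JV q t) w = - g q (cov ?JV q t) (J q w)"
    using J_iso[of q "cov ?JV q t" "J q w"] unfolding om_def by (simp add: JJ glin)
  then have "om q (cov ?JV q t) w = - psi q t v (J q w) - g q (cov ?V q t) w"
    unfolding 3 by (simp add: J_iso)
  moreover have "psi q t v (J q w) = - g q (J q (G q t v)) w"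
    using J_iso[of q "G q t v" "J q w"] unfolding psi_def by (simp add: JJ glin)
  ultimately show "g q (G q t (J q v)) w = g q (- J q (G q t v)) w"
    using 1 2 by (simp add: psi_def om_def JJ glin)
qed

text \<open>From here on, identities for \<open>G\<close> at a point are those of the linear
  model.\<close>

lemma hermitian_cross: "hermitian_cross (g q) (J q) (G q)"
proof -
  interpret inner_form "g q" by (rule metric_inner)
  show ?thesis
  proof
    show "g q (G q u v) w = - g q v (G q u w)" for u v w
      using psi_skew23[of q u v w] g_sym[of q v "G q u w"] unfolding psi_def by simp
    show "g q (G q u v) (G q u v) = g q u u * g q v v - (g q u v)\<^sup>2 - (g q (J q u) v)\<^sup>2" for u v
      using type_one unfolding constant_type_one_def by blast
  qed (rule linear_add[OF J_linear] linear_scale[OF J_linear] JJ J_iso G_bilinear G_skew G_J)+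
qed

lemma psi_linear: "linear (\<lambda>u. psi q u v w)" "linear (\<lambda>v. psi q u v w)" "linear (psi q u v)"
  unfolding psi_def
  by (rule linearI; simp add: bilinear_ladd[OF G_bilinear] bilinear_radd[OF G_bilinear]
      bilinear_lmul[OF G_bilinear] bilinear_rmul[OF G_bilinear] glin)+

lemmas psilin = linear_add[OF psi_linear(1)] linear_add[OF psi_linear(2)] linear_add[OF psi_linear(3)]
  linear_scale[OF psi_linear(1)] linear_scale[OF psi_linear(2)] linear_scale[OF psi_linear(3)]
  linear_neg[OF psi_linear(1)] linear_neg[OF psi_linear(2)] linear_neg[OF psi_linear(3)]

definition om_coord where "om_coord d v w x = om (cinv d x) (from_coord B d (cinv d x) v) (from_coord B d (cinv d x) w)"

lemma om_coord_smooth: "d \<in> B \<Longrightarrow> smooth_on (cmap d ` cdom d) (om_coord d v w)"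
  using om_form unfolding smooth_form2_def om_coord_def[abs_def] by blast

text \<open>\<open>3 \<Psi> = d\<omega>\<close>, in the coordinates of any chart.\<close>

lemma psi_coord:
  assumes d: "d \<in> B" "q \<in> cdom d"
  defines "D \<equiv> \<lambda>u v w. frechet_derivative (om_coord d v w) (at (cmap d q)) u"
  shows "3 * psi q (from_coord B d q u) (from_coord B d q v) (from_coord B d q w) = D u v w + D v w u + D w u v"
proof -
  let ?F = "\<lambda>v q. from_coord B d q v"
  have F: "fdiff (?F v) q" for v
    using field_smooth_fdiff[OF field_smooth_coord_field[OF d(1), of v] d] unfolding coord_field_id .
  define K where "K u v = cov (?F v) q (?F u q)" for u v
  have K: "K u v = K v u" for u v
    using cov_coord_field[OF d] unfolding K_def coord_field_id .
  have D: "D u v w = psi q (?F u q) (?F v q) (?F w q) + om q (K u v) (?F w q) + om q (?F v q) (K u w)" for u v w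
  proof -
    have "point_deriv B q (\<lambda>p. om p (?F v p) (?F w p)) (?F u q) = D u v w"
      unfolding D_def
    proof (rule point_deriv_chart(3)[OF B d])
      have "(\<lambda>p. om p (?F v p) (?F w p)) \<circ> cinv d = om_coord d v w" by (rule ext) (simp add: om_coord_def)
      then show "((\<lambda>p. om p (?F v p) (?F w p)) \<circ> cinv d has_derivative frechet_derivative (om_coord d v w) (at (cmap d q))) (at (cmap d q))"
        using differentiable_imp_has_derivative[OF smooth_on_differentiable[OF om_coord_smooth[OF d(1)]]] d by simp
    qed
    then show ?thesis
      using leibniz2(2)[OF om_form F[of v] F[of w], of "?F u q"] by (simp add: psi_nabla tangent_map_id K_def)
  qed
  show ?thesis
    unfolding D K[of v u] K[of w u] K[of w v]
    using om_skew[of q "K u v" "?F w q"] om_skew[of q "K v w" "?F u q"] om_skew[of q "K u w" "?F v q"]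
      psi_skew23[of q "?F v q" "?F w q" "?F u q"] psi_skew12[of q "?F v q" "?F u q" "?F w q"]
      psi_skew12[of q "?F w q" "?F u q" "?F v q"] psi_skew23[of q "?F u q" "?F w q" "?F v q"]
    by linarith
qed

text \<open>The coefficients are one third of those of d\<omega>, hence combinations of first
  derivatives of smooth functions.\<close>

lemma psi_form: "smooth_form3 B psi"
  unfolding smooth_form3_def
proof (intro conjI allI ballI psi_linear)
  fix d u v w assume d: "d \<in> B"
  note O = open_chart_image[OF B d]
  have D: "smooth_on (cmap d ` cdom d) (\<lambda>x. frechet_derivative (om_coord d v w) (at x) u)" for u v w
    by (rule smooth_on_deriv[OF om_coord_smooth[OF d]])
  have "smooth_on (cmap d ` cdom d) (\<lambda>x. (1 / 3) * (frechet_derivative (om_coord d v w) (at x) u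
      + frechet_derivative (om_coord d w u) (at x) v + frechet_derivative (om_coord d u v) (at x) w))"
    by (rule smooth_on_mult[OF O smooth_on_const smooth_on_add[OF O smooth_on_add[OF O D D] D]])
  then show "smooth_on (cmap d ` cdom d) (\<lambda>x. psi (cinv d x) (from_coord B d (cinv d x) u) (from_coord B d (cinv d x) v)
      (from_coord B d (cinv d x) w))"
  proof (rule smooth_on_cong[OF O, rotated])
    fix x assume "x \<in> cmap d ` cdom d"
    then obtain q where q: "q \<in> cdom d" "x = cmap d q" by blast
    show "(1 / 3) * (frechet_derivative (om_coord d v w) (at x) u
      + frechet_derivative (om_coord d w u) (at x) v + frechet_derivative (om_coord d u v) (at x) w) =
      psi (cinv d x) (from_coord B d (cinv d x) u) (from_coord B d (cinv d x) v) (from_coord B d (cinv d x) w)"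
      using psi_coord[OF d q(1), of u v w] by (simp add: q cinv_cmap[OF B d])
  qed
qed

section \<open>The covariant derivative of \<Psi>\<close>

abbreviation cf where "cf q v \<equiv> const_field B q v"
abbreviation dpsi where "dpsi \<equiv> nabla_form3 B g psi"

lemma pdiff_psi_const: "pdiff B q (\<lambda>p. psi p (cf q u p) (cf q v p) (cf q w p))"
  using leibniz3(1)[OF psi_form fdiff_const fdiff_const fdiff_const] by simp

text \<open>\<open>const_field\<close> depends linearly on its vector only over the domain of the
  reference chart, so additivity in the form arguments goes through the local comparison
  \<open>pdiff_cong\<close>.\<close>

lemma dpsi_linear: "linear (\<lambda>t. dpsi q t x y z)" "linear (\<lambda>x. dpsi q t x y z)"
proof -
  show "linear (\<lambda>t. dpsi q t x y z)"
    unfolding nabla_form3_def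
    by (rule linearI)
      (simp_all add: linear_add[OF linear_point_deriv[OF pdiff_psi_const]] linear_scale[OF linear_point_deriv[OF pdiff_psi_const]]
        bilinear_ladd[OF Gamma_bilinear] bilinear_lmul[OF Gamma_bilinear] psilin algebra_simps)
  let ?c = "chart_at B q"
  note c = chart_at[OF B, of q]
  have l: "linear (\<lambda>v. cf q v p)" if "p \<in> cdom ?c" for p
    unfolding const_field_def by (rule linear_from_coord[OF B c(1) that])
  have D: "point_deriv B q (\<lambda>p. psi p (cf q (u + v) p) (cf q y p) (cf q z p)) t
    = point_deriv B q (\<lambda>p. psi p (cf q u p) (cf q y p) (cf q z p)) t
      + point_deriv B q (\<lambda>p. psi p (cf q v p) (cf q y p) (cf q z p)) t" for u v
    using fun_cong[OF trans[OF pdiff_cong(2)[OF B open_cdom[OF B c(1)] c(2) _ pdiff_add(1)[OF pdiff_psi_const pdiff_psi_const],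
        of u y z v y z "\<lambda>p. psi p (cf q (u + v) p) (cf q y p) (cf q z p)"] pdiff_add(2)[OF pdiff_psi_const pdiff_psi_const]], of t]
    by (simp add: linear_add[OF l] psilin)
  have E: "point_deriv B q (\<lambda>p. psi p (cf q (r *\<^sub>R u) p) (cf q y p) (cf q z p)) t
    = r * point_deriv B q (\<lambda>p. psi p (cf q u p) (cf q y p) (cf q z p)) t" for r u
    using fun_cong[OF trans[OF pdiff_cong(2)[OF B open_cdom[OF B c(1)] c(2) _ pdiff_mult(1)[OF B pdiff_const(1)[of B q r] pdiff_psi_const],
        of u y z "\<lambda>p. psi p (cf q (r *\<^sub>R u) p) (cf q y p) (cf q z p)"] pdiff_mult(2)[OF B pdiff_const(1)[of B q r] pdiff_psi_const]], of t]
    by (simp add: linear_scale[OF l] psilin pdiff_const(2))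
  show "linear (\<lambda>x. dpsi q t x y z)"
    unfolding nabla_form3_def
    by (rule linearI) (simp_all add: D E bilinear_radd[OF Gamma_bilinear] bilinear_rmul[OF Gamma_bilinear]
        psilin algebra_simps)
qed

lemma dpsi_skew: "dpsi q t x y z = - dpsi q t y x z" "dpsi q t x y z = - dpsi q t x z y"
proof -
  have 1: "(\<lambda>p. psi p (cf q x p) (cf q y p) (cf q z p)) = (\<lambda>p. - psi p (cf q y p) (cf q x p) (cf q z p))"
    by (rule ext) (rule psi_skew12)
  show "dpsi q t x y z = - dpsi q t y x z"
    unfolding nabla_form3_def 1 pdiff_minus(2)[OF pdiff_psi_const]
    using psi_skew12[of q "\<Gamma> q t x"] psi_skew12[of q "\<Gamma> q t y"] psi_skew12[of q x y "\<Gamma> q t z"] by simp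
  have 2: "(\<lambda>p. psi p (cf q x p) (cf q y p) (cf q z p)) = (\<lambda>p. - psi p (cf q x p) (cf q z p) (cf q y p))"
    by (rule ext) (rule psi_skew23)
  show "dpsi q t x y z = - dpsi q t x z y"
    unfolding nabla_form3_def 2 pdiff_minus(2)[OF pdiff_psi_const]
    using psi_skew23[of q x "\<Gamma> q t y"] psi_skew23[of q x "\<Gamma> q t z"] psi_skew23[of q "\<Gamma> q t x" y z] by simp
qed

lemma psi_J: "psi q x y (J q z) = psi q (J q x) y z"
proof -
  interpret hermitian_cross "g q" "J q" "G q" by (rule hermitian_cross)
  show ?thesis unfolding psi_def G_J_left g_J by (simp add: glin)
qed

lemma cov_J_const: "cov (\<lambda>p. J p (cf q v p)) q t = G q t v + J q (cov (cf q v) q t)"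
  and fdiff_J_const: "fdiff (\<lambda>p. J p (cf q v p)) q"
proof -
  show JV: "fdiff (\<lambda>p. J p (cf q v p)) q"
    using field_smooth_fdiff[OF field_smooth_endo[OF J_smooth const_field_smooth chart_at(1)[OF B]] chart_at[OF B]]
    by simp
  show "cov (\<lambda>p. J p (cf q v p)) q t = G q t v + J q (cov (cf q v) q t)"
  proof (rule g_eqI[of q])
    fix w
    show "g q (cov (\<lambda>p. J p (cf q v p)) q t) w = g q (G q t v + J q (cov (cf q v) q t)) w"
      using cov_endo[OF J_smooth fdiff_const[of q v], of t w] JV psi_nabla[of q t v w]
      by (simp add: psi_def om_def[abs_def] tangent_map_id const_field_self[OF B] glin)
  qed
qed

text \<open>Differentiate \<Psi>(X, Y, J Z) = \<Psi>(J X, Y, Z); the derivative of \<open>J\<close>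
  contributes the two terms quadratic in \<open>G\<close>.\<close>

lemma dpsi_J: "dpsi q t x y (J q z) + psi q x y (G q t z) = dpsi q t (J q x) y z + psi q (G q t x) y z"
proof -
  have eq: "(\<lambda>p. psi p (cf q x p) (cf q y p) (J p (cf q z p))) = (\<lambda>p. psi p (J p (cf q x p)) (cf q y p) (cf q z p))"
    by (rule ext) (rule psi_J)
  show ?thesis
    using leibniz3(2)[OF psi_form fdiff_const[of q x] fdiff_const[of q y] fdiff_J_const[of q z], of t]
      leibniz3(2)[OF psi_form fdiff_J_const[of q x] fdiff_const[of q y] fdiff_const[of q z], of t]
      psi_J[of q x y "cov (cf q z) q t"]
    by (simp add: eq tangent_map_id const_field_self[OF B] cov_J_const psilin psi_J)
qed

lemma fdiff_G: "fdiff (\<lambda>p. G p (cf q x p) (cf q y p)) q"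
proof -
  let ?V = "\<lambda>p. G p (cf q x p) (cf q y p)"
  let ?c = "chart_at B q"
  note c = chart_at[OF B, of q]
  have "smooth_on (cmap ?c ` cdom ?c) (\<lambda>z. psi (cinv ?c z) (from_coord B ?c (cinv ?c z) x) (from_coord B ?c (cinv ?c z) y)
      (from_coord B ?c (cinv ?c z) w))" for w
    using psi_form c(1) unfolding smooth_form3_def by blast
  then have "smooth_on (cmap ?c ` cdom ?c) (\<lambda>z. to_coord B ?c (cinv ?c z) (?V (cinv ?c z)))"
    by (intro smooth_on_metric_dual[OF B g_metric c(1)]) (simp add: psi_def const_field_def)
  then have "smooth_on (cmap ?c ` cdom ?c) ((\<lambda>p. to_coord B ?c p (?V p)) \<circ> cinv ?c)" by (simp add: o_def)
  from point_deriv_smooth_chart(1)[OF B c this] show ?thesis unfolding fdiff_def by simp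
qed

text \<open>Differentiate the constant type identity, whose left side is \<Psi>(X, Y, G(X, Y)). By
  polarisation the derivatives of the fields X, Y and G(X, Y) cancel; what remains on the right
  comes from the square of \<omega>, whose derivative is \<Psi>.\<close>

lemma dpsi_type: "dpsi q t x y (G q x y) = - g q (J q x) y * g q (G q t x) y"
proof -
  interpret hermitian_cross "g q" "J q" "G q" by (rule hermitian_cross)
  let ?V = "\<lambda>p. G p (cf q x p) (cf q y p)" and ?X = "cf q x" and ?Y = "cf q y"
  let ?v = "G q x y"
  define X' Y' V' where "X' = cov ?X q t" and "Y' = cov ?Y q t" and "V' = cov ?V q t"
  note X = fdiff_const[of q x] and Y = fdiff_const[of q y] and V = fdiff_G[of q x y]
  note s = tangent_map_id const_field_self[OF B] X'_def[symmetric] Y'_def[symmetric] V'_def[symmetric]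
  have "(\<lambda>p. psi p (?X p) (?Y p) (?V p)) = (\<lambda>p. g p (?V p) (?V p))" by (simp add: psi_def)
  then have 1: "dpsi q t x y ?v + psi q X' y ?v + psi q x Y' ?v + psi q x y V' = g q V' ?v + g q ?v V'"
    using leibniz3(2)[OF psi_form X Y V, of t] cov_metric[OF V V, of t] by (simp add: s)
  have pd: "pdiff B q (\<lambda>p. g p (?X p) (?X p))" "pdiff B q (\<lambda>p. g p (?Y p) (?Y p))" "pdiff B q (\<lambda>p. g p (?X p) (?Y p))"
    "pdiff B q (\<lambda>p. - (g p (?X p) (?Y p)))"
    using leibniz2(1)[OF smooth_form2_metric X X] leibniz2(1)[OF smooth_form2_metric Y Y]
      leibniz2(1)[OF smooth_form2_metric X Y] by (simp_all add: pdiff_minus)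
  note po = pdiff_om_const[of q x y]
  have "(\<lambda>p. g p (?V p) (?V p)) = (\<lambda>p. (g p (?X p) (?X p) * g p (?Y p) (?Y p) + (- (g p (?X p) (?Y p) * g p (?X p) (?Y p))))
      + (- (om p (?X p) (?Y p) * om p (?X p) (?Y p))))"
    using hermitian_cross.const_type[OF hermitian_cross]
    by (simp add: om_def power2_eq_square)
  then have "point_deriv B q (\<lambda>p. g p (?V p) (?V p)) t =
      (g q x x * point_deriv B q (\<lambda>p. g p (?Y p) (?Y p)) t + point_deriv B q (\<lambda>p. g p (?X p) (?X p)) t * g q y y)
      - 2 * g q x y * point_deriv B q (\<lambda>p. g p (?X p) (?Y p)) t
      - 2 * om q x y * point_deriv B q (\<lambda>p. om p (?X p) (?Y p)) t"
    by (simp only: pdiff_add pdiff_minus pdiff_mult[OF B] pd po) (simp add: const_field_self[OF B])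
  then have 2: "2 * g q V' ?v = g q x x * (2 * g q Y' y) + 2 * g q X' x * g q y y
      - 2 * g q x y * (g q X' y + g q x Y') - 2 * om q x y * (psi q t x y + om q X' y + om q x Y')"
    using cov_metric[OF V V, of t] cov_metric[OF X X, of t] cov_metric[OF Y Y, of t] cov_metric[OF X Y, of t]
      leibniz2(2)[OF om_form X Y, of t] g_sym[of q ?v V'] g_sym[of q x X'] g_sym[of q y Y']
    by (simp add: s psi_nabla)
  have polar: "g q (G q u v) (G q u w) = g q u u * g q v w - g q u v * g q u w - g q (J q u) v * g q (J q u) w" for u v w
    using g_G[of u v "G q u w"] GG_self[of u w] g_J[of v u] sym[of "J q u" v] sym[of v w] sym[of v u]
    by (simp add: glin algebra_simps)
  have a: "psi q x Y' ?v = g q x x * g q Y' y - g q x Y' * g q x y - om q x Y' * om q x y"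
    using polar[of x Y' y] by (simp add: psi_def om_def)
  have b: "psi q X' y ?v = g q X' x * g q y y - g q X' y * g q x y - om q X' y * om q x y"
    using polar[of y X' x] G_skew[of X' y] G_skew[of x y] sym[of y X'] sym[of y x] om_skew[of X' y] om_skew[of x y]
    by (simp add: psi_def om_def glin)
  have c: "psi q x y V' = g q V' ?v" "g q ?v V' = g q V' ?v" by (simp_all add: psi_def g_sym)
  show ?thesis
    using 1 2 a b c by (simp add: psi_def om_def algebra_simps)
qed

text \<open>This is \<open>d\<Psi> = 0\<close>.\<close>

lemma dpsi_closed: "dpsi q w x y z - dpsi q x w y z - dpsi q y x w z - dpsi q z x y w = 0"
proof -
  let ?c = "chart_at B q"
  note c = chart_at[OF B, of q]
  note O = open_chart_image[OF B c(1)]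
  have x0: "cmap ?c q \<in> cmap ?c ` cdom ?c" using c by blast
  \<comment> \<open>Second partial derivatives of the coefficients of \<omega>: symmetric in the
    first two indices and skew in the last two, so all of them cancel on alternation.\<close>
  define H where "H t u v w = frechet_derivative (\<lambda>x. frechet_derivative (om_coord ?c v w) (at x) u) (at (cmap ?c q)) t" for t u v w
  have H_sym: "H t u v w = H u t v w" for t u v w
    unfolding H_def by (rule symmetric_second_derivative[OF O x0 om_coord_smooth[OF c(1)]])
  have hd: "((\<lambda>x. frechet_derivative (om_coord ?c v w) (at x) u) has_derivative (\<lambda>t. H t u v w)) (at (cmap ?c q))" for u v w
    unfolding H_def by (rule differentiable_imp_has_derivative,
        rule smooth_on_differentiable[OF smooth_on_deriv[OF om_coord_smooth[OF c(1)]] x0])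
  have H_skew: "H t u v w = - H t u w v" for t u v w
  proof -
    have o: "om_coord ?c v w = (\<lambda>x. - om_coord ?c w v x)"
      by (rule ext) (unfold om_coord_def, rule om_skew)
    have "frechet_derivative (om_coord ?c v w) (at x) = (\<lambda>u. - frechet_derivative (om_coord ?c w v) (at x) u)"
      if "x \<in> cmap ?c ` cdom ?c" for x
      unfolding o by (rule frechet_derivative_eqI, rule has_derivative_minus, rule differentiable_imp_has_derivative,
        rule smooth_on_differentiable[OF om_coord_smooth[OF c(1)] that])
    then have "((\<lambda>x. frechet_derivative (om_coord ?c v w) (at x) u) has_derivative (\<lambda>t. - H t u w v)) (at (cmap ?c q))"
      by (intro has_derivative_transform_within_open[OF has_derivative_minus[OF hd[of w v u]] O x0]) simp
    from has_derivative_unique[OF hd this] show ?thesis by (rule fun_cong)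
  qed
  define K where "K t u = cov (cf q u) q t" for t u
  have K: "K t u = K u t" for t u
    using nabla_const_sym unfolding K_def nabla_def .
  \<comment> \<open>One third of the differentiated d\<omega>, corrected by Christoffel terms. These
    cancel on alternation as well, since \<open>K\<close> is symmetric and \<Psi> is skew.\<close>
  have main: "dpsi q t u v w = (H t u v w + H t v w u + H t w u v) / 3
      - psi q (K t u) v w - psi q u (K t v) w - psi q u v (K t w)" for t u v w
  proof -
    have "point_deriv B q (\<lambda>p. psi p (cf q u p) (cf q v p) (cf q w p)) = (\<lambda>t. (1 / 3) * (H t u v w + H t v w u + H t w u v))"
    proof (rule point_deriv_eqI[OF B])
      show "((\<lambda>x. (1 / 3) * (frechet_derivative (om_coord ?c v w) (at x) u
        + frechet_derivative (om_coord ?c w u) (at x) v + frechet_derivative (om_coord ?c u v) (at x) w))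
        has_derivative (\<lambda>t. (1 / 3) * (H t u v w + H t v w u + H t w u v))) (at (cmap ?c q))"
        by (intro has_derivative_mult_right has_derivative_add hd)
      show "(1 / 3) * (frechet_derivative (om_coord ?c v w) (at (cmap ?c p)) u
        + frechet_derivative (om_coord ?c w u) (at (cmap ?c p)) v + frechet_derivative (om_coord ?c u v) (at (cmap ?c p)) w)
        = psi p (cf q u p) (cf q v p) (cf q w p)" if "p \<in> cdom ?c" for p
        using psi_coord[OF c(1) that, of u v w] by (simp add: const_field_def)
    qed
    then show ?thesis
      using leibniz3(2)[OF psi_form fdiff_const[of q u] fdiff_const[of q v] fdiff_const[of q w], of t]
      by (simp add: tangent_map_id const_field_self[OF B] K_def add_divide_distrib)
  qed
  show ?thesis
    unfolding main K[of x w] K[of y w] K[of z w] K[of y x] K[of z x] K[of z y]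
    using H_sym[of x w y z] H_sym[of y w z x] H_sym[of z w x y] H_sym[of y x w z] H_sym[of z x y w] H_sym[of z y w x]
      H_skew[of x y z w] H_skew[of x z w y] H_skew[of y z x w]
      psi_skew12[of q w "K x y" z] psi_skew23[of q w y "K x z"] psi_skew12[of q w "K x z" y]
      psi_skew23[of q "K x z" w y] psi_skew23[of q x w "K y z"]
    by (simp add: field_simps)
qed

theorem dpsi_eq:
  "dpsi q t x y z = - (g q (J q x) y * g q t z + g q (J q y) z * g q t x + g q (J q z) x * g q t y)"
proof -
  interpret hermitian_cross "g q" "J q" "G q" by (rule hermitian_cross)
  show ?thesis
  proof (rule derivative_of_psi[where D = "dpsi q"])
    show "dpsi q t x y (J q z) + g q (G q x y) (G q t z) = dpsi q t (J q x) y z + g q (G q (G q t x) y) z" for t x y z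
      using dpsi_J unfolding psi_def .
  qed (rule dpsi_linear dpsi_skew dpsi_type dpsi_closed | simp)+
qed

end

section \<open>Hypersurfaces\<close>

locale nk_hypersurface = nk_manifold B g J
  for B :: "('n::{t2_space, second_countable_topology}, real^6) chart set"
    and g :: "'n \<Rightarrow> real^6 \<Rightarrow> real^6 \<Rightarrow> real" and J :: "'n \<Rightarrow> real^6 \<Rightarrow> real^6" +
  fixes A :: "('m::{t2_space, second_countable_topology}, real^5) chart set"
    and gM :: "'m \<Rightarrow> real^5 \<Rightarrow> real^5 \<Rightarrow> real" and f :: "'m \<Rightarrow> 'n" and N :: "'m \<Rightarrow> real^6"
  assumes A: "smooth_atlas A" and gM_metric: "riemannian_metric A gM"
    and immersion: "isometric_immersion A gM B g f" and normal: "unit_normal A B g f N"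
begin

sublocale hyp: riemannian_manifold A gM
  by unfold_locales (rule A gM_metric)+

sublocale emb: manifold_map A B f g
  by unfold_locales (use A B g_metric immersion in \<open>auto simp: isometric_immersion_def\<close>)

abbreviation dF where "dF \<equiv> tangent_map A B f"
abbreviation xi where "xi \<equiv> reeb A B J f N"
abbreviation \<eta> where "\<eta> p u \<equiv> gM p (xi p) u"
abbreviation h where "h \<equiv> second_fundamental_form A B g f N"
abbreviation S where "S \<equiv> shape_operator A B g f N"
abbreviation ph1 where "ph1 \<equiv> phi1 A gM B J f N"
abbreviation ph2 where "ph2 \<equiv> phi2 A B g J f N"
abbreviation ph3 where "ph3 \<equiv> phi3 A B g J f N"
abbreviation cN where "cN p v \<equiv> emb.coord_field (chart_at A p) v"

lemmas dflin = linear_add[OF emb.df_linear] linear_scale[OF emb.df_linear] linear_neg[OF emb.df_linear]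
  linear_diff[OF emb.df_linear] linear_0[OF emb.df_linear]

lemma inner_M: "inner_form (gM p)"
  by (rule hyp.metric_inner)

lemmas gMlin = inner_form.glin[OF inner_M]

lemma gM_eq: "gM p u v = g (f p) (dF p u) (dF p v)"
  using immersion unfolding isometric_immersion_def by blast

lemma df_eqI: "dF p u = dF p v \<Longrightarrow> u = v"
  using immersion unfolding isometric_immersion_def inj_def by blast

lemma normal_unit: "g (f p) (N p) (N p) = 1" and normal_df: "g (f p) (N p) (dF p u) = 0"
  and normal_smooth: "smooth_field_along A B f N"
  using normal unfolding unit_normal_def by blast+

lemma df_normal: "g (f p) (dF p u) (N p) = 0"
  using normal_df g_sym by metis

text \<open>The image of the differential has dimension five and lies in the orthogonal complement
  of \<open>N\<close>, so it fills that complement, and the choice made by \<open>inv\<close> is a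
  genuine inverse there.\<close>

lemma df_pull_back:
  assumes w: "g (f p) (N p) w = 0"
  shows "dF p (pull_back A B f p w) = w"
proof -
  let ?T = "{w. g (f p) (N p) w = 0}"
  have T: "subspace ?T" by (auto simp: subspace_def glin)
  have R: "subspace (range (dF p))" using emb.df_linear by (simp add: linear_subspace_image subspace_UNIV)
  have inj: "inj (dF p)" using df_eqI by (auto simp: inj_def)
  have sp: "span ?T = ?T" using T by (simp only: span_eq_iff)
  have "N p \<notin> span ?T" unfolding sp using normal_unit[of p] by simp
  then have "dim ?T \<noteq> DIM(real^6)" using dim_eq_full[of ?T] by auto
  then have "dim ?T \<le> 5" using dim_subset_UNIV[of ?T] by simp
  moreover have "dim (range (dF p)) = 5"
    using dim_image_eq[OF emb.df_linear[of p], of UNIV] inj by simp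
  ultimately have "range (dF p) = ?T"
    by (intro subspace_dim_equal R T) (auto simp: normal_df)
  then have "w \<in> range (dF p)" using w by blast
  then show ?thesis unfolding pull_back_def by (rule f_inv_into_f)
qed

lemma normal_J: "g q n (J q n) = 0"
  using om_skew[of q n n] g_sym[of q n "J q n"] unfolding om_def by simp

lemma df_xi: "dF p (xi p) = - J (f p) (N p)"
  unfolding reeb_def by (rule df_pull_back) (simp add: glin normal_J)

lemma eta_eq: "\<eta> p u = - g (f p) (J (f p) (N p)) (dF p u)"
  unfolding gM_eq df_xi by (simp add: glin)

lemma df_ph1: "dF p (ph1 p u) = J (f p) (dF p u) - \<eta> p u *\<^sub>R N p"
  unfolding phi1_def
proof (rule df_pull_back)
  show "g (f p) (N p) (J (f p) (dF p u) - \<eta> p u *\<^sub>R N p) = 0"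
    using om_skew[of "f p" "N p" "dF p u"] g_sym[of "f p" "N p" "J (f p) (dF p u)"]
    unfolding eta_eq om_def by (simp add: glin normal_unit)
qed

lemma df_ph3: "dF p (ph3 p u) = G (f p) (N p) (dF p u)"
proof -
  interpret hermitian_cross "g (f p)" "J (f p)" "G (f p)" by (rule hermitian_cross)
  show ?thesis unfolding phi3_def
    by (rule df_pull_back) (use sym[of "N p" "G (f p) (N p) (dF p u)"] in simp)
qed

lemma df_ph2: "dF p (ph2 p u) = J (f p) (G (f p) (N p) (dF p u))"
proof -
  interpret hermitian_cross "g (f p)" "J (f p)" "G (f p)" by (rule hermitian_cross)
  have "dF p (ph2 p u) = G (f p) (dF p (xi p)) (dF p u)" unfolding phi2_def
    by (rule df_pull_back)
      (use sym[of "N p" "J (f p) (G (f p) (N p) (dF p u))"] g_J[of "G (f p) (N p) (dF p u)" "N p"]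
        in \<open>simp add: df_xi Glin glin G_J_left\<close>)
  then show ?thesis by (simp add: df_xi Glin G_J_left)
qed

text \<open>Each identity is checked after applying the injective differential, where the three
  structures are \<open>J\<close> without its normal part, J G(N, .) and G(N, .). Squares and
  products reduce to \<open>GG_self\<close> for the unit vector \<open>N\<close>.\<close>

lemma contact_triple: "contact_triple (gM p) (xi p) (ph1 p) (ph2 p) (ph3 p)"
proof -
  interpret hermitian_cross "g (f p)" "J (f p)" "G (f p)" by (rule hermitian_cross)
  interpret M: inner_form "gM p" by (rule inner_M)
  have Jn: "g (f p) (J (f p) (N p)) (dF p u) = - \<eta> p u" for u by (simp add: eta_eq)
  have eta1: "\<eta> p (ph1 p u) = 0" for u
    unfolding eta_eq df_ph1 by (simp add: glin J_iso normal_df)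
  have eta2: "\<eta> p (ph2 p u) = 0" for u
    unfolding eta_eq df_ph2 using sym[of "N p" "G (f p) (N p) (dF p u)"] by (simp add: J_iso)
  have eta3: "\<eta> p (ph3 p u) = 0" for u
    unfolding eta_eq df_ph3 using sym[of "J (f p) (N p)" "G (f p) (N p) (dF p u)"] by simp
  have n3: "g (f p) (dF p u) (G (f p) (N p) (dF p v)) = - g (f p) (G (f p) (N p) (dF p u)) (dF p v)" for u v
    using g_G[of "N p" "dF p u" "dF p v"] by simp
  show ?thesis
  proof
    show "gM p (xi p) (xi p) = 1" by (simp add: gM_eq df_xi glin J_iso normal_unit)
    show "ph1 p (x + y) = ph1 p x + ph1 p y" "ph1 p (r *\<^sub>R x) = r *\<^sub>R ph1 p x"
      "ph2 p (x + y) = ph2 p x + ph2 p y" "ph2 p (r *\<^sub>R x) = r *\<^sub>R ph2 p x"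
      "ph3 p (x + y) = ph3 p x + ph3 p y" "ph3 p (r *\<^sub>R x) = r *\<^sub>R ph3 p x" for x y r
      by (rule df_eqI[of p]; simp add: df_ph1 df_ph2 df_ph3 dflin Jlin Glin M.glin algebra_simps)+
    show "gM p (ph1 p u) v = - gM p u (ph1 p v)" for u v
      unfolding gM_eq[of p "ph1 p u"] gM_eq[of p u] df_ph1 by (simp add: glin g_J normal_df df_normal)
    show "gM p (ph3 p u) v = - gM p u (ph3 p v)" for u v
      unfolding gM_eq[of p "ph3 p u"] gM_eq[of p u] df_ph3 by (simp add: n3)
    show "gM p (ph2 p u) v = - gM p u (ph2 p v)" for u v
      unfolding gM_eq[of p "ph2 p u"] gM_eq[of p u] df_ph2
      using g_G[of "N p" "J (f p) (dF p u)" "dF p v"]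
      by (simp add: g_J[of "dF p u"] G_J glin)
    show "ph1 p (xi p) = 0" "ph2 p (xi p) = 0" "ph3 p (xi p) = 0"
      by (rule df_eqI[of p]; simp add: df_ph1 df_ph2 df_ph3 df_xi dflin Jlin Glin G_J JJ eta_eq glin J_iso normal_unit)+
    show "ph1 p (ph1 p u) = - u + \<eta> p u *\<^sub>R xi p" for u
      by (rule df_eqI[of p]) (simp add: df_ph1[of p "ph1 p u"] eta1, simp add: df_ph1 df_xi dflin Jlin JJ)
    show "ph3 p (ph3 p u) = - u + \<eta> p u *\<^sub>R xi p" for u
      by (rule df_eqI[of p]) (simp add: df_ph3 df_xi dflin GG_self normal_unit normal_df Jn)
    show "ph2 p (ph2 p u) = - u + \<eta> p u *\<^sub>R xi p" for u
      by (rule df_eqI[of p]) (simp add: df_ph2 df_xi dflin G_J JJ Jlin GG_self normal_unit normal_df Jn)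
    show "ph2 p (ph1 p u) = ph3 p u" for u
      by (rule df_eqI[of p]) (simp add: df_ph1 df_ph2 df_ph3 Glin G_J JJ Jlin)
    show "ph1 p (ph2 p u) = - ph3 p u" for u
      by (rule df_eqI[of p]) (simp add: df_ph1[of p "ph2 p u"] eta2, simp add: df_ph2 df_ph3 JJ dflin)
    show "ph3 p (ph2 p u) = ph1 p u" for u
      by (rule df_eqI[of p]) (simp add: df_ph1 df_ph2 df_ph3 G_J JJ Jlin GG_self normal_unit normal_df Jn)
    show "ph2 p (ph3 p u) = - ph1 p u" for u
      by (rule df_eqI[of p]) (simp add: df_ph1 df_ph2 df_ph3 dflin JJ Jlin GG_self normal_unit normal_df Jn)
    show "ph1 p (ph3 p u) = ph2 p u" for u
      by (rule df_eqI[of p]) (simp add: df_ph1[of p "ph3 p u"] eta3, simp add: df_ph2 df_ph3)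
    show "ph3 p (ph1 p u) = - ph2 p u" for u
      by (rule df_eqI[of p]) (simp add: df_ph1 df_ph2 df_ph3 dflin Glin G_J)
    show "1 < DIM(real^5)" by simp
  qed
qed

lemma N_smooth: "c \<in> A \<Longrightarrow> emb.field_smooth c N"
  by (rule emb.field_smooth_along[OF normal_smooth])

lemma N_fdiff: "emb.fdiff N p"
  using emb.field_smooth_fdiff[OF N_smooth] chart_at[OF A, of p] by blast

lemma cN_fdiff: "emb.fdiff (cN p v) p"
  using emb.field_smooth_fdiff[OF emb.field_smooth_coord_field] chart_at[OF A, of p] by blast

lemma df_S: "dF p (S p u) = - emb.cov N p u"
  unfolding shape_operator_def
proof (rule df_pull_back)
  have "(\<lambda>q. g (f q) (N q) (N q)) = (\<lambda>q. 1)" by (rule ext) (rule normal_unit)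
  then have "2 * g (f p) (N p) (emb.cov N p u) = 0"
    using emb.cov_metric[OF N_fdiff N_fdiff, of p u] g_sym[of "f p" "N p"] by (simp add: pdiff_const(2))
  then show "g (f p) (N p) (- emb.cov N p u) = 0" by (simp add: glin)
qed

lemma h_eq: "h p u v = g (f p) (emb.cov (cN p v) p u) (N p)"
  unfolding second_fundamental_form_def emb.coord_field_def[abs_def] const_field_def ..

lemma cov_cN_sym: "emb.cov (cN p v) p u = emb.cov (cN p u) p v"
  using emb.cov_coord_field[OF chart_at[OF A, of p], of v u] const_field_self[OF A, of p]
  unfolding const_field_def by simp

text \<open>Differentiate the orthogonality of \<open>N\<close> to the pushed-forward coordinate
  fields.\<close>

lemma gM_S: "gM p (S p u) v = h p u v"
proof -
  have "(\<lambda>q. g (f q) (N q) (cN p v q)) = (\<lambda>q. 0)"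
    by (rule ext) (simp add: emb.coord_field_def normal_df)
  then have "g (f p) (emb.cov N p u) (dF p v) + g (f p) (N p) (emb.cov (cN p v) p u) = 0"
    using emb.cov_metric[OF N_fdiff cN_fdiff, of p v u] by (simp add: pdiff_const(2) emb.coord_field_at)
  then show ?thesis unfolding gM_eq df_S h_eq g_sym[of "f p" _ "N p"] by (simp add: glin)
qed

lemma h_sym: "h p u v = h p v u"
  unfolding h_eq by (subst cov_cN_sym) (rule refl)

lemma S_sym: "gM p (S p u) v = gM p u (S p v)"
  using h_sym[of p u v] inner_form.sym[OF inner_M, of p u "S p v"] by (simp add: gM_S)

lemma S_linear: "linear (S p)"
  by (rule linearI; rule df_eqI[of p])
    (simp_all add: df_S dflin linear_add[OF emb.cov_linear[OF N_fdiff]] linear_scale[OF emb.cov_linear[OF N_fdiff]])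

text \<open>The tangential part of the ambient derivative is symmetric and compatible with the
  induced metric, so uniqueness of the Levi-Civita connection identifies it with the intrinsic
  one.\<close>

lemma gauss: "dF p (hyp.\<Gamma> p u v) = emb.cov (cN p v) p u - h p u v *\<^sub>R N p"
proof -
  define K where "K u v = pull_back A B f p (emb.cov (cN p v) p u - h p u v *\<^sub>R N p)" for u v
  have K: "dF p (K u v) = emb.cov (cN p v) p u - h p u v *\<^sub>R N p" for u v
    unfolding K_def
    by (rule df_pull_back) (simp add: glin normal_unit h_eq g_sym[of "f p" "N p"])
  have h_lin: "h p (x + y) v = h p x v + h p y v" "h p (r *\<^sub>R x) v = r * h p x v" for x y v r
    by (simp_all add: gM_S[symmetric] linear_add[OF S_linear] linear_scale[OF S_linear] gMlin)
  have sym: "K u v = K v u" for u v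
    by (rule df_eqI[of p]) (simp add: K cov_cN_sym[of p v u] h_sym[of p u v])
  have lin: "linear (\<lambda>u. K u v)" for v
    by (rule linearI; rule df_eqI[of p])
      (simp_all add: K dflin linear_add[OF emb.cov_linear[OF cN_fdiff]] linear_scale[OF emb.cov_linear[OF cN_fdiff]]
        h_lin algebra_simps)
  have lin2: "linear (K u)" for u
  proof -
    have "K u = (\<lambda>v. K v u)" by (rule ext) (rule sym)
    then show ?thesis using lin[of u] by simp
  qed
  have "levi_civita_at A gM p K"
    unfolding levi_civita_at_def
  proof (intro conjI allI)
    show "bilinear K" unfolding bilinear_def using lin lin2 by blast
    show "K u v = K v u" for u v by (rule sym)
    fix u v w
    have "(\<lambda>q. gM q (const_field A p v q) (const_field A p w q)) = (\<lambda>q. g (f q) (cN p v q) (cN p w q))"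
      by (simp add: gM_eq emb.coord_field_def const_field_def)
    then show "point_deriv A p (\<lambda>q. gM q (const_field A p v q) (const_field A p w q)) u = gM p (K u v) w + gM p v (K u w)"
      using emb.cov_metric[OF cN_fdiff cN_fdiff, of p v w u]
      by (simp add: gM_eq K glin emb.coord_field_at normal_df df_normal)
  qed
  then have "hyp.\<Gamma> p = K"
    using christoffel_levi_civita[OF A gM_metric, of p] by blast
  then show ?thesis using K by simp
qed

text \<open>The fundamental two-forms of the three structures, written through ambient forms and
  fields along the immersion so that the Leibniz rules apply to them directly.\<close>

definition Phi1 where "Phi1 q u v = om (f q) (dF q u) (dF q v)"
definition Phi2 where "Phi2 q u v = psi (f q) (- J (f q) (N q)) (dF q u) (dF q v)"
definition Phi3 where "Phi3 q u v = psi (f q) (N q) (dF q u) (dF q v)"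

lemma gM_ph1: "gM q (ph1 q u) v = Phi1 q u v"
  unfolding gM_eq df_ph1 Phi1_def om_def by (simp add: glin normal_df)

lemma gM_ph2: "gM q (ph2 q u) v = Phi2 q u v"
proof -
  interpret hermitian_cross "g (f q)" "J (f q)" "G (f q)" by (rule hermitian_cross)
  show ?thesis unfolding gM_eq df_ph2 Phi2_def psi_def by (simp add: Glin G_J_left)
qed

lemma gM_ph3: "gM q (ph3 q u) v = Phi3 q u v"
  unfolding gM_eq df_ph3 Phi3_def psi_def ..

lemma JN_smooth: "c \<in> A \<Longrightarrow> emb.field_smooth c (\<lambda>q. J (f q) (N q))"
  by (rule emb.field_smooth_endo[OF J_smooth N_smooth])

lemma JN_fdiff: "emb.fdiff (\<lambda>q. J (f q) (N q)) p"
  using emb.field_smooth_fdiff[OF JN_smooth] chart_at[OF A, of p] by blast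

lemma cov_JN: "emb.cov (\<lambda>q. J (f q) (N q)) p u = G (f p) (dF p u) (N p) - J (f p) (dF p (S p u))"
proof (rule g_eqI[of "f p"])
  fix w
  show "g (f p) (emb.cov (\<lambda>q. J (f q) (N q)) p u) w = g (f p) (G (f p) (dF p u) (N p) - J (f p) (dF p (S p u))) w"
    using emb.cov_endo[OF J_smooth N_fdiff JN_fdiff, of p u w] psi_nabla[of "f p" "dF p u" "N p" w]
    by (simp add: psi_def om_def[abs_def] glin df_S linear_neg[OF J_linear])
qed

lemma coord_eq: "dF q (const_field A p v q) = cN p v q"
  unfolding emb.coord_field_def const_field_def ..

lemma cN_at: "cN p v p = dF p v"
  by (rule emb.coord_field_at)

lemma pdiff_Phi:
  "pdiff A p (\<lambda>q. Phi1 q (const_field A p v q) (const_field A p w q))"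
  "pdiff A p (\<lambda>q. Phi2 q (const_field A p v q) (const_field A p w q))"
  "pdiff A p (\<lambda>q. Phi3 q (const_field A p v q) (const_field A p w q))"
  unfolding Phi1_def Phi2_def Phi3_def coord_eq
  using emb.leibniz2(1)[OF om_form cN_fdiff[of p v] cN_fdiff[of p w]]
    pdiff_minus(1)[OF emb.leibniz3(1)[OF psi_form JN_fdiff[of p] cN_fdiff[of p v] cN_fdiff[of p w]]]
    emb.leibniz3(1)[OF psi_form N_fdiff[of p] cN_fdiff[of p v] cN_fdiff[of p w]]
  by (simp_all add: psilin)

lemma om_normal: "om (f p) (N p) (dF p v) = - \<eta> p v" "om (f p) (dF p v) (N p) = \<eta> p v"
  using om_skew[of "f p" "N p" "dF p v"] unfolding om_def by (simp_all add: eta_eq)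

lemma gauss_cov: "emb.cov (cN p v) p u = dF p (hyp.\<Gamma> p u v) + h p u v *\<^sub>R N p"
  unfolding gauss by simp

lemma nabla_Phi1:
  "nabla_form2 A gM Phi1 p u v w = psi (f p) (dF p u) (dF p v) (dF p w) - h p u v * \<eta> p w + h p u w * \<eta> p v"
proof -
  have "point_deriv A p (\<lambda>q. Phi1 q (const_field A p v q) (const_field A p w q)) u
    = psi (f p) (dF p u) (dF p v) (dF p w) + om (f p) (emb.cov (cN p v) p u) (dF p w)
      + om (f p) (dF p v) (emb.cov (cN p w) p u)"
    unfolding Phi1_def coord_eq
    using emb.leibniz2(2)[OF om_form cN_fdiff[of p v] cN_fdiff[of p w], of u]
    by (simp add: psi_nabla cN_at)
  then show ?thesis
    unfolding nabla_form2_def by (simp add: gauss_cov omlin om_normal Phi1_def)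
qed

text \<open>Three sources contribute: the derivative of \<Psi> with \<open>N\<close> in a slot, the
  derivative - S of \<open>N\<close>, and the normal parts of the derivatives of the arguments,
  which \<Psi>(N, N, .) = 0 removes.\<close>

lemma nabla_Phi3:
  "nabla_form2 A gM Phi3 p u v w = \<eta> p v * gM p u w - \<eta> p w * gM p u v - psi (f p) (dF p (S p u)) (dF p v) (dF p w)"
proof -
  interpret hermitian_cross "g (f p)" "J (f p)" "G (f p)" by (rule hermitian_cross)
  have "point_deriv A p (\<lambda>q. Phi3 q (const_field A p v q) (const_field A p w q)) u
    = dpsi (f p) (dF p u) (N p) (dF p v) (dF p w) + psi (f p) (emb.cov N p u) (dF p v) (dF p w)
      + psi (f p) (N p) (emb.cov (cN p v) p u) (dF p w) + psi (f p) (N p) (dF p v) (emb.cov (cN p w) p u)"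
    unfolding Phi3_def coord_eq
    using emb.leibniz3(2)[OF psi_form N_fdiff[of p] cN_fdiff[of p v] cN_fdiff[of p w], of u]
    by (simp add: cN_at)
  moreover have "dpsi (f p) (dF p u) (N p) (dF p v) (dF p w) = \<eta> p v * gM p u w - \<eta> p w * gM p u v"
    unfolding dpsi_eq gM_eq[of p u]
    using om_normal(1)[of p v] om_normal(2)[of p w] by (simp add: om_def df_normal)
  moreover have "psi (f p) (N p) (N p) x = 0" "psi (f p) (N p) x (N p) = 0" for x
    unfolding psi_def by simp_all (simp add: glin)
  moreover have "emb.cov N p u = - dF p (S p u)" by (simp add: df_S)
  ultimately show ?thesis
    unfolding nabla_form2_def by (simp add: gauss_cov psilin Phi3_def)
qed

text \<open>As for \<open>Phi3\<close>, with \<open>J N\<close> in place of \<open>N\<close>. Its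
  derivative has the additional part G(u, N), which \<open>GG\<close> turns into two of the three
  terms with \<open>Phi1\<close>; the third comes from the derivative of \<Psi>.\<close>

lemma nabla_Phi2:
  "nabla_form2 A gM Phi2 p u v w = - \<eta> p u * Phi1 p v w - \<eta> p v * Phi1 p w u - \<eta> p w * Phi1 p u v
    + psi (f p) (J (f p) (dF p (S p u))) (dF p v) (dF p w)"
proof -
  interpret hermitian_cross "g (f p)" "J (f p)" "G (f p)" by (rule hermitian_cross)
  let ?JN = "J (f p) (N p)"
  have "point_deriv A p (\<lambda>q. Phi2 q (const_field A p v q) (const_field A p w q)) u
    = - (dpsi (f p) (dF p u) ?JN (dF p v) (dF p w) + psi (f p) (emb.cov (\<lambda>q. J (f q) (N q)) p u) (dF p v) (dF p w)
      + psi (f p) ?JN (emb.cov (cN p v) p u) (dF p w) + psi (f p) ?JN (dF p v) (emb.cov (cN p w) p u))"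
    unfolding Phi2_def coord_eq
    using emb.leibniz3[OF psi_form JN_fdiff[of p] cN_fdiff[of p v] cN_fdiff[of p w]]
    by (simp add: psilin pdiff_minus cN_at)
  moreover have "dpsi (f p) (dF p u) ?JN (dF p v) (dF p w) = \<eta> p u * Phi1 p v w"
    unfolding dpsi_eq Phi1_def om_def
    using J_iso[of "dF p w" "N p"] sym[of "dF p u" ?JN] by (simp add: JJ glin normal_df df_normal eta_eq)
  moreover have "psi (f p) ?JN (N p) x = 0" "psi (f p) ?JN x (N p) = 0" for x
  proof -
    show 1: "psi (f p) ?JN (N p) x = 0"
      unfolding psi_def by (simp add: G_J_left Jlin glin)
    show "psi (f p) ?JN x (N p) = 0"
      using psi_skew23[of "f p" ?JN x "N p"] 1 unfolding psi_def by (simp add: G_J_left Jlin glin)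
  qed
  moreover have "psi (f p) (G (f p) (dF p u) (N p)) (dF p v) (dF p w) = - \<eta> p v * Phi1 p u w - \<eta> p w * Phi1 p v u"
  proof -
    have "psi (f p) (G (f p) (dF p u) (N p)) (dF p v) (dF p w)
        = - g (f p) (G (f p) (dF p v) (G (f p) (dF p u) (N p))) (dF p w)"
      unfolding psi_def using G_skew[of "G (f p) (dF p u) (N p)" "dF p v"] by (simp add: glin)
    then show ?thesis
      unfolding GG Phi1_def using om_normal[of p v] om_normal[of p w]
      by (simp add: om_def glin df_normal normal_df)
  qed
  moreover have "Phi1 p u v = - Phi1 p v u" "Phi1 p w u = - Phi1 p u w" unfolding Phi1_def om_def by (rule om_skew)+
  ultimately show ?thesis
    unfolding nabla_form2_def cov_JN by (simp add: gauss_cov psilin Phi2_def linear_diff[OF psi_linear(1)])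
qed

lemma Phi_linear: "linear (\<lambda>u. Phi1 p u v)" "linear (\<lambda>u. Phi2 p u v)" "linear (\<lambda>u. Phi3 p u v)"
  unfolding Phi1_def Phi2_def Phi3_def
  by (rule linearI; simp add: dflin omlin psilin)+

text \<open>Within a tangent space of the hypersurface the complement of \<xi> is J-invariant of
  complex dimension two, so only terms with an explicit \<xi> remain.\<close>

lemma psi_tangent:
  "psi (f p) (dF p u) (dF p v) (dF p w) = \<eta> p u * Phi2 p v w + \<eta> p v * Phi2 p w u + \<eta> p w * Phi2 p u v"
proof -
  interpret hermitian_cross "g (f p)" "J (f p)" "G (f p)" by (rule hermitian_cross)
  show ?thesis
    using psi_hyperplane[OF _ normal_unit[of p] refl normal_df normal_df normal_df, of u v w]
    unfolding psi_def Phi2_def by (simp add: gM_eq df_xi)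
qed

text \<open>Split \<open>J\<close> into its tangential part \<open>ph1\<close> and its normal part.
  The quaternion products convert \<open>Phi2\<close> with an argument \<open>ph1 p u\<close> into
  \<open>Phi3\<close>, and the normal part supplies the remaining \<open>Phi3\<close> term.\<close>

lemma psi_J_tangent:
  "psi (f p) (J (f p) (dF p u)) (dF p v) (dF p w) = \<eta> p u * Phi3 p v w + \<eta> p v * Phi3 p w u + \<eta> p w * Phi3 p u v"
proof -
  interpret contact_triple "gM p" "xi p" "ph1 p" "ph2 p" "ph3 p" by (rule contact_triple)
  have "J (f p) (dF p u) = dF p (ph1 p u) + \<eta> p u *\<^sub>R N p" by (simp add: df_ph1)
  moreover have "Phi2 p w (ph1 p u) = Phi3 p w u" "Phi2 p (ph1 p u) v = Phi3 p u v"
    unfolding gM_ph2[symmetric] gM_ph3[symmetric] using phi_skew by (simp_all add: phi_mult)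
  ultimately show ?thesis
    by (simp add: psilin psi_tangent eta_phi Phi3_def)
qed

text \<open>The three-form \<eta> \<and> \<Phi> with one index raised. For skew \<open>P\<close> it
  is alternating, so it disappears when the condition on \<nabla>\<phi> is symmetrised.\<close>

definition eta_wedge where "eta_wedge p P u v = \<eta> p u *\<^sub>R P p v - \<eta> p v *\<^sub>R P p u + gM p (P p u) v *\<^sub>R xi p"

definition phi_comb where "phi_comb a b c p u = a p *\<^sub>R ph1 p u + b p *\<^sub>R ph2 p u + c p *\<^sub>R ph3 p u"

text \<open>The unit quaternion \<open>R\<close> of \<open>nearly_structure\<close> applied to the
  shape operator, plus \<open>c\<close> times the identity.\<close>

definition rot_shape where "rot_shape a b c p u = a p *\<^sub>R S p u - b p *\<^sub>R ph3 p (S p u) + c p *\<^sub>R ph2 p (S p u) + c p *\<^sub>R u"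

lemma gM_phi_comb: "gM p (phi_comb a b c p u) v = a p * Phi1 p u v + b p * Phi2 p u v + c p * Phi3 p u v"
  unfolding phi_comb_def by (simp add: gMlin gM_ph1 gM_ph2 gM_ph3)

lemma nabla_phi_comb:
  assumes abc: "\<And>p. pdiff A p a" "\<And>p. pdiff A p b" "\<And>p. pdiff A p c"
    and sm: "smooth_endo_field A (phi_comb a b c)"
  shows "nabla_endo A gM (phi_comb a b c) p u v =
    point_deriv A p a u *\<^sub>R ph1 p v + (point_deriv A p b u - c p * \<eta> p (S p u)) *\<^sub>R ph2 p v
    + (point_deriv A p c u + b p * \<eta> p (S p u)) *\<^sub>R ph3 p v
    + \<eta> p v *\<^sub>R rot_shape a b c p u - gM p (rot_shape a b c p u) v *\<^sub>R xi p + a p *\<^sub>R eta_wedge p ph2 u v - b p *\<^sub>R eta_wedge p ph1 u v"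
    (is "_ = ?R")
proof (rule inner_form.g_eqI[OF inner_M, of p])
  fix w
  interpret contact_triple "gM p" "xi p" "ph1 p" "ph2 p" "ph3 p" by (rule contact_triple)
  let ?F = "\<lambda>P q. P q (const_field A p v q) (const_field A p w q)"
  have f: "(\<lambda>q. gM q (phi_comb a b c q (const_field A p v q)) (const_field A p w q)) =
      (\<lambda>q. (a q * ?F Phi1 q + b q * ?F Phi2 q) + c q * ?F Phi3 q)"
    by (simp add: gM_phi_comb)
  have "gM p (nabla_endo A gM (phi_comb a b c) p u v) w =
      point_deriv A p (\<lambda>q. (a q * ?F Phi1 q + b q * ?F Phi2 q) + c q * ?F Phi3 q) u
      - gM p (phi_comb a b c p (hyp.\<Gamma> p u v)) w - gM p (phi_comb a b c p v) (hyp.\<Gamma> p u w)"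
    unfolding hyp.nabla_endo_form2[OF sm] nabla_form2_def f ..
  also have "\<dots> = (point_deriv A p a u * Phi1 p v w + a p * nabla_form2 A gM Phi1 p u v w)
      + (point_deriv A p b u * Phi2 p v w + b p * nabla_form2 A gM Phi2 p u v w)
      + (point_deriv A p c u * Phi3 p v w + c p * nabla_form2 A gM Phi3 p u v w)"
    unfolding nabla_form2_def gM_phi_comb
    by (simp only: pdiff_add pdiff_mult[OF A] abc pdiff_Phi)
      (simp add: const_field_self[OF A] algebra_simps)
  also have "\<dots> = gM p ?R w"
    unfolding nabla_Phi1 nabla_Phi2 nabla_Phi3 psi_tangent psi_J_tangent rot_shape_def eta_wedge_def
    using phi_skew[of w] sym[of w]
    by (simp add: glin gM_ph1[symmetric] gM_ph2[symmetric] gM_ph3[symmetric] gM_S[symmetric] algebra_simps)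
  finally show "gM p (nabla_endo A gM (phi_comb a b c) p u v) w = gM p ?R w" .
qed

section \<open>The differential of \<eta> and total umbilicity\<close>

definition eta_coord where "eta_coord c v = (\<lambda>q. \<eta> q (from_coord A c q v)) \<circ> cinv c"

lemma eta_coord_smooth:
  assumes c: "c \<in> A"
  shows "smooth_on (cmap c ` cdom c) (eta_coord c v)"
proof -
  have "smooth_on (cmap c ` cdom c) (\<lambda>x. - ((\<lambda>q. om (f q) (N q) (emb.coord_field c v q)) \<circ> cinv c) x)"
    by (rule smooth_on_minus[OF open_chart_image[OF A c]
          emb.smooth_form2_along[OF om_form N_smooth[OF c] emb.field_smooth_coord_field[OF c] c]])
  moreover have "(\<lambda>x. - ((\<lambda>q. om (f q) (N q) (emb.coord_field c v q)) \<circ> cinv c) x) = eta_coord c v"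
    by (rule ext) (simp add: eta_coord_def emb.coord_field_def om_def eta_eq)
  ultimately show ?thesis by simp
qed

lemma d_eta:
  assumes c: "c \<in> A" "q \<in> cdom c"
  shows "frechet_derivative (eta_coord c v) (at (cmap c q)) u - frechet_derivative (eta_coord c u) (at (cmap c q)) v
    = 2 * Phi3 q (from_coord A c q u) (from_coord A c q v)
      + Phi1 q (S q (from_coord A c q u)) (from_coord A c q v) - Phi1 q (S q (from_coord A c q v)) (from_coord A c q u)"
proof -
  let ?F = "from_coord A c q"
  have fd: "emb.fdiff N q" "emb.fdiff (emb.coord_field c v) q" for v
    using emb.field_smooth_fdiff[OF N_smooth[OF c(1)] c] emb.field_smooth_fdiff[OF emb.field_smooth_coord_field[OF c(1)] c] by auto
  have D: "frechet_derivative (eta_coord c v) (at (cmap c q)) u =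
    - (psi (f q) (dF q (?F u)) (N q) (dF q (?F v)) - Phi1 q (S q (?F u)) (?F v)
      + om (f q) (N q) (emb.cov (emb.coord_field c v) q (?F u)))" for u v
  proof -
    have eq: "(\<lambda>q. \<eta> q (from_coord A c q v)) = (\<lambda>q. - om (f q) (N q) (emb.coord_field c v q))"
      by (rule ext) (simp add: emb.coord_field_def om_def eta_eq)
    have cov: "emb.cov N q (?F u) = - dF q (S q (?F u))" by (simp add: df_S)
    have "frechet_derivative (eta_coord c v) (at (cmap c q)) u
        = point_deriv A q (\<lambda>q. \<eta> q (from_coord A c q v)) (?F u)"
      unfolding eta_coord_def
      by (rule point_deriv_smooth_chart(2)[OF A c, symmetric])
        (rule eta_coord_smooth[OF c(1), unfolded eta_coord_def])
    also have "\<dots> = - point_deriv A q (\<lambda>q. om (f q) (N q) (emb.coord_field c v q)) (?F u)"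
      unfolding eq by (simp add: pdiff_minus(2)[OF emb.leibniz2(1)[OF om_form fd(1) fd(2)]])
    also have "\<dots> = - (psi (f q) (dF q (?F u)) (N q) (dF q (?F v)) - Phi1 q (S q (?F u)) (?F v)
      + om (f q) (N q) (emb.cov (emb.coord_field c v) q (?F u)))"
      unfolding emb.leibniz2(2)[OF om_form fd(1) fd(2)] cov Phi1_def
      by (simp add: psi_nabla emb.coord_field_def omlin)
    finally show ?thesis .
  qed
  show ?thesis
    unfolding D Phi3_def emb.cov_coord_field[OF c, of v u]
    using psi_skew12[of "f q" "dF q (?F u)" "N q" "dF q (?F v)"]
      psi_skew12[of "f q" "dF q (?F v)" "N q" "dF q (?F u)"] psi_skew23[of "f q" "N q" "dF q (?F v)" "dF q (?F u)"]
    by simp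
qed

text \<open>Such a hypersurface has \<open>d\<eta> = 2 (\<Phi>\<^sub>3 + \<mu> \<Phi>\<^sub>1)\<close>, and \<open>d\<^sup>2\<eta> = 0\<close> becomes
  \<open>d\<mu> \<and> \<Phi>\<^sub>1 = (\<nu> - \<mu>) \<eta> \<and> \<Phi>\<^sub>2\<close>, where both sides have to vanish.\<close>

lemma quasi_umbilical_imp_umbilical:
  assumes conn: "connected (UNIV :: 'm set)"
    and S: "\<And>p u. S p u = \<mu> p *\<^sub>R u + ((\<nu> p - \<mu> p) * \<eta> p u) *\<^sub>R xi p"
  obtains m where "\<And>p. \<mu> p = m" "\<And>p. \<nu> p = m"
proof -
  have main: "pdiff A p \<mu> \<and> (\<forall>t. point_deriv A p \<mu> t = 0) \<and> \<nu> p = \<mu> p" for p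
  proof -
    interpret contact_triple "gM p" "xi p" "ph1 p" "ph2 p" "ph3 p" by (rule contact_triple)
    let ?c = "chart_at A p"
    note c = chart_at[OF A, of p]
    note O = open_chart_image[OF A c(1)]
    have x0: "cmap ?c p \<in> cmap ?c ` cdom ?c" using c by blast
    let ?F = "const_field A p"
    define P1 where "P1 u v q = Phi1 q (?F u q) (?F v q)" for u v q
    define P3 where "P3 u v q = Phi3 q (?F u q) (?F v q)" for u v q
    define K where "K u v q = frechet_derivative (eta_coord ?c v) (at (cmap ?c q)) u
      - frechet_derivative (eta_coord ?c u) (at (cmap ?c q)) v" for u v q
    define H where "H t u v = frechet_derivative (\<lambda>x. frechet_derivative (eta_coord ?c v) (at x) u) (at (cmap ?c p)) t" for t u v
    have H_sym: "H t u v = H u t v" for t u v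
      unfolding H_def by (rule symmetric_second_derivative[OF O x0 eta_coord_smooth[OF c(1)]])
    have Kd: "pdiff A p (K u v)" "point_deriv A p (K u v) = (\<lambda>t. H t u v - H t v u)" for u v
    proof -
      have hd: "((\<lambda>x. frechet_derivative (eta_coord ?c v) (at x) u) has_derivative (\<lambda>t. H t u v)) (at (cmap ?c p))" for u v
        unfolding H_def by (rule differentiable_imp_has_derivative,
            rule smooth_on_differentiable[OF smooth_on_deriv[OF eta_coord_smooth[OF c(1)]] x0])
      have "(K u v \<circ> cinv ?c has_derivative (\<lambda>t. H t u v - H t v u)) (at (cmap ?c p))"
        by (rule has_derivative_transform_within_open[OF has_derivative_diff[OF hd[of v u] hd[of u v]] O x0])
          (auto simp: K_def cinv_cmap[OF A c(1)])
      then show "pdiff A p (K u v)" "point_deriv A p (K u v) = (\<lambda>t. H t u v - H t v u)"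
        by (rule pdiffI)+
    qed
    have Phi1_xi: "Phi1 q (xi q) v = 0" for q v
      unfolding gM_ph1[symmetric] using contact_triple.phi_xi(1)[OF contact_triple[of q]]
      by (simp add: inner_form.glin[OF inner_M])
    have Phi1_S: "Phi1 q (S q u) v = \<mu> q * Phi1 q u v" for q u v
      unfolding S by (simp add: linear_add[OF Phi_linear(1)] linear_scale[OF Phi_linear(1)] Phi1_xi)
    have Phi1_skew: "Phi1 q u v = - Phi1 q v u" for q u v unfolding Phi1_def by (rule om_skew)
    have K: "K u v q = 2 * P3 u v q + 2 * (\<mu> q * P1 u v q)" if "q \<in> cdom ?c" for u v q
      unfolding K_def d_eta[OF c(1) that] Phi1_S P1_def P3_def const_field_def
      using Phi1_skew[of q "from_coord A ?c q v" "from_coord A ?c q u"] by simp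
    have P1_p: "P1 u v p = Phi1 p u v" for u v by (simp add: P1_def const_field_self[OF A])
    note Pd = pdiff_Phi(1)[of p, folded P1_def] pdiff_Phi(3)[of p, folded P3_def]
    obtain e where e: "e \<noteq> 0" "\<eta> p e = 0" using exists_orthogonal[OF dim_gt_1] by blast
    have ge: "gM p e e > 0" by (rule pos[OF e(1)])
    \<comment> \<open>Half of d\<eta> minus \<Phi>\<open>\<^sub>3\<close> equals \<mu>
      \<Phi>\<open>\<^sub>1\<close>. On the pair \<open>e\<close>, \<open>ph1 p e\<close> the form
      \<Phi>\<open>\<^sub>1\<close> is nonzero at \<open>p\<close>, so \<mu> is a quotient of
      differentiable functions.\<close>
    have \<mu>: "pdiff A p \<mu>"
    proof (rule pdiff_factor[OF A])
      show "pdiff A p (\<lambda>q. (1 / 2) * K e (ph1 p e) q + (- P3 e (ph1 p e) q))"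
        by (intro pdiff_add pdiff_minus pdiff_mult[OF A] pdiff_const Kd Pd)
      show "pdiff A p (P1 e (ph1 p e))" by (rule Pd)
      show "P1 e (ph1 p e) p \<noteq> 0"
        using ge by (simp add: P1_def const_field_self[OF A] gM_ph1[symmetric] phi_inner[OF e(2)])
      have "smooth_on (cmap ?c ` cdom ?c) ((\<lambda>q. om (f q) (cN p e q) (cN p (ph1 p e) q)) \<circ> cinv ?c)"
        by (rule emb.smooth_form2_along[OF om_form emb.field_smooth_coord_field[OF c(1)] emb.field_smooth_coord_field[OF c(1)] c(1)])
      moreover have "(\<lambda>q. om (f q) (cN p e q) (cN p (ph1 p e) q)) = P1 e (ph1 p e)"
        by (rule ext) (simp add: P1_def Phi1_def coord_eq)
      ultimately have "smooth_on (cmap ?c ` cdom ?c) (P1 e (ph1 p e) \<circ> cinv ?c)" by simp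
      then show "continuous_on (cmap ?c ` cdom ?c) (P1 e (ph1 p e) \<circ> cinv ?c)"
        unfolding smooth_on_def using C_k_on.simps(1) by blast
      show "(1 / 2) * K e (ph1 p e) q + (- P3 e (ph1 p e) q) = \<mu> q * P1 e (ph1 p e) q" if "q \<in> cdom ?c" for q
        by (simp add: K[OF that] add_divide_distrib)
    qed
    define d\<mu> where "d\<mu> = point_deriv A p \<mu>"
    have d\<mu>: "linear d\<mu>" unfolding d\<mu>_def by (rule linear_point_deriv[OF \<mu>])
    define D1 where "D1 t u v = nabla_form2 A gM Phi1 p t u v" for t u v
    define D3 where "D3 t u v = nabla_form2 A gM Phi3 p t u v" for t u v
    have bil: "bilinear (Phi1 p)" "bilinear (Phi3 p)"
      unfolding bilinear_def Phi1_def Phi3_def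
      by (intro conjI allI linearI; simp add: dflin omlin psilin)+
    \<comment> \<open>The derivative of d\<eta> computed twice: from second derivatives of the
      coefficients of \<eta>, and from the formula for d\<eta>.\<close>
    have HD: "H t u v - H t v u = 2 * (D3 t u v + Phi3 p (hyp.\<Gamma> p t u) v + Phi3 p u (hyp.\<Gamma> p t v))
      + 2 * (d\<mu> t * Phi1 p u v + \<mu> p * (D1 t u v + Phi1 p (hyp.\<Gamma> p t u) v + Phi1 p u (hyp.\<Gamma> p t v)))" for t u v
    proof -
      have "point_deriv A p (K u v) = point_deriv A p (\<lambda>q. 2 * P3 u v q + 2 * (\<mu> q * P1 u v q))"
        by (rule pdiff_cong(2)[OF A open_cdom[OF A c(1)] c(2)])
          (auto simp: K intro!: pdiff_add pdiff_mult[OF A] pdiff_const Pd \<mu>)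
      also have "\<dots> = (\<lambda>t. 2 * point_deriv A p (P3 u v) t + 2 * (\<mu> p * point_deriv A p (P1 u v) t + d\<mu> t * Phi1 p u v))"
        by (simp add: pdiff_add pdiff_mult[OF A] pdiff_const Pd \<mu> d\<mu>_def P1_p)
      finally show ?thesis
        unfolding Kd(2) D1_def D3_def nabla_form2_def P1_def P3_def
        by (simp add: fun_eq_iff algebra_simps)
    qed
    have Phi3_skew: "Phi3 p u v = - Phi3 p v u" for u v unfolding Phi3_def by (rule psi_skew23)
    \<comment> \<open>In the cyclic sum the second derivatives cancel in pairs, and the Christoffel
      terms cancel since \<Gamma> is symmetric while the forms are skew.\<close>
    have cyc: "D3 t u v + D3 u v t + D3 v t u + d\<mu> t * Phi1 p u v + d\<mu> u * Phi1 p v t + d\<mu> v * Phi1 p t u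
        + \<mu> p * (D1 t u v + D1 u v t + D1 v t u) = 0" for t u v
    proof -
      note G = hyp.Gamma_sym[of p u t] hyp.Gamma_sym[of p v t] hyp.Gamma_sym[of p v u]
      show ?thesis
        using HD[of t u v] HD[of u v t] HD[of v t u] H_sym[of t u v] H_sym[of u v t] H_sym[of v t u]
          Phi1_skew[of p t "hyp.\<Gamma> p u v"] Phi1_skew[of p v "hyp.\<Gamma> p t u"] Phi1_skew[of p u "hyp.\<Gamma> p t v"]
          Phi3_skew[of t "hyp.\<Gamma> p u v"] Phi3_skew[of v "hyp.\<Gamma> p t u"] Phi3_skew[of u "hyp.\<Gamma> p t v"]
        unfolding G by (simp add: algebra_simps)
    qed
    have Phi2_skew: "Phi2 p u v = - Phi2 p v u" for u v unfolding Phi2_def by (rule psi_skew23)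
    have Phi2_xi: "Phi2 p (xi p) v = 0" "Phi2 p v (xi p) = 0" for v
      using Phi2_skew[of v "xi p"] by (simp_all add: gM_ph2[symmetric] phi_xi glin)
    have SD: "S p u = \<mu> p *\<^sub>R u" if "\<eta> p u = 0" for u using that by (simp add: S)
    have Sxi: "S p (xi p) = \<nu> p *\<^sub>R xi p" by (simp add: S xi_unit algebra_simps)
    \<comment> \<open>The second fundamental form cancels by symmetry; three equal copies of \<Psi>
      remain.\<close>
    have D1_cyc: "D1 t u v + D1 u v t + D1 v t u
      = 3 * (\<eta> p t * Phi2 p u v + \<eta> p u * Phi2 p v t + \<eta> p v * Phi2 p t u)" for t u v
      unfolding D1_def nabla_Phi1 psi_tangent using h_sym[of p t u] h_sym[of p u v] h_sym[of p v t] by simp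
    have D3_eq: "D3 t u v = \<eta> p u * gM p t v - \<eta> p v * gM p t u
      - (\<eta> p (S p t) * Phi2 p u v + \<eta> p u * Phi2 p v (S p t) + \<eta> p v * Phi2 p (S p t) u)" for t u v
      unfolding D3_def nabla_Phi3 psi_tangent ..
    have P2lin: "Phi2 p (r *\<^sub>R u) v = r * Phi2 p u v" "Phi2 p v (r *\<^sub>R u) = r * Phi2 p v u" for r u v
      unfolding gM_ph2[symmetric] by (simp_all add: philin glin)
    have xi_eq: "d\<mu> (xi p) * Phi1 p u v + (\<mu> p - \<nu> p) * Phi2 p u v = 0" if u: "\<eta> p u = 0" and v: "\<eta> p v = 0" for u v
      using cyc[of "xi p" u v] Phi1_skew[of p v "xi p"] Phi2_skew[of v u] sym[of u v] sym[of u "xi p"] sym[of v "xi p"] u v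
      unfolding D1_cyc D3_eq
      by (simp add: SD[OF u] SD[OF v] Sxi xi_unit Phi1_xi Phi2_xi P2lin glin algebra_simps)
    have eta0: "\<eta> p (ph1 p e) = 0" "\<eta> p (ph2 p e) = 0" by (rule eta_phi)+
    \<comment> \<open>The pair \<open>e\<close>, \<open>ph2 p e\<close> is annihilated by
      \<Phi>\<open>\<^sub>1\<close> but not by \<Phi>\<open>\<^sub>2\<close>; for \<open>e\<close>,
      \<open>ph1 p e\<close> it is the other way round. Each pair isolates one coefficient of
      \<open>xi_eq\<close>.\<close>
    have \<nu>: "\<nu> p = \<mu> p" and d\<mu>xi: "d\<mu> (xi p) = 0"
      using xi_eq[OF e(2) eta0(2)] xi_eq[OF e(2) eta0(1)] ge
      by (simp_all add: gM_ph1[symmetric] gM_ph2[symmetric] phi_inner[OF e(2)])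
    have d\<mu>D: "d\<mu> t = 0" if t: "\<eta> p t = 0" for t
    proof (cases "t = 0")
      case False
      have gt: "gM p t t > 0" by (rule pos[OF False])
      \<comment> \<open>Together with \<open>t\<close> these are pairwise orthogonal, and
        \<Phi>\<open>\<^sub>1\<close> is nonzero on \<open>?u\<close>, \<open>?v\<close> alone among
        the three pairs, so only the derivative along \<open>t\<close> survives.\<close>
      let ?u = "ph2 p t" and ?v = "ph1 p (ph2 p t)"
      have uv: "\<eta> p ?u = 0" "\<eta> p ?v = 0" by (rule eta_phi)+
      have "d\<mu> t * Phi1 p ?u ?v + d\<mu> ?u * Phi1 p ?v t + d\<mu> ?v * Phi1 p t ?u = 0"
        using cyc[of t ?u ?v] unfolding D1_cyc D3_eq
        by (simp add: t uv SD[OF t] SD[OF uv(1)] SD[OF uv(2)] glin)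
      moreover have "Phi1 p ?v t = 0" "Phi1 p t ?u = 0" "Phi1 p ?u ?v = gM p t t"
        unfolding gM_ph1[symmetric] phi_mult(2)
        by (simp_all add: philin glin phi_mult phi_inner[OF t] phi_self)
      ultimately show ?thesis using gt by simp
    qed (simp add: linear_0[OF d\<mu>])
    have "d\<mu> t = 0" for t
    proof -
      have "d\<mu> t = d\<mu> (t - \<eta> p t *\<^sub>R xi p) + \<eta> p t * d\<mu> (xi p)"
        using linear_add[OF d\<mu>, of "t - \<eta> p t *\<^sub>R xi p" "\<eta> p t *\<^sub>R xi p"] linear_scale[OF d\<mu>] by simp
      then show ?thesis using d\<mu>D[of "t - \<eta> p t *\<^sub>R xi p"] by (simp add: d\<mu>xi glin xi_unit)
    qed
    then show ?thesis using \<mu> \<nu> unfolding d\<mu>_def by blast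
  qed
  obtain m where "\<And>p. \<mu> p = m" using pdiff_constant[OF A conn, of \<mu>] main by blast
  then show thesis using that main by auto
qed

section \<open>Smoothness of the induced tensors and the converse part of (1)\<close>

lemma xi_smooth: "smooth_vector_field A xi"
  unfolding smooth_field_along_def
proof (intro ballI)
  fix c d assume c: "c \<in> A" and d: "d \<in> A"
  let ?U = "cmap c ` (cdom c \<inter> id -` cdom d)"
  note O = hyp.open_ovl[OF c d]
  define X where "X x = to_coord A c (cinv c x) (xi (cinv c x))" for x
  have "smooth_on (cmap c ` cdom c) X"
    unfolding X_def
    by (rule smooth_on_metric_dual[OF A gM_metric c])
      (use eta_coord_smooth[OF c] in \<open>simp add: eta_coord_def o_def\<close>)
  then have X: "smooth_on ?U X" by (rule smooth_on_subset) auto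
  \<comment> \<open>Duality gives smooth components in the chart \<open>c\<close> itself;
    \<open>smooth_field_along\<close> also asks for every other chart \<open>d\<close>, reached by
    the derivative of the transition map.\<close>
  have "smooth_on ?U (\<lambda>x. frechet_derivative (cmap d \<circ> id \<circ> cinv c) (at x) (X x))"
    by (rule smooth_on_linear_family[OF O _ _ X])
      (rule linear_frechet_derivative smooth_on_differentiable[OF hyp.smooth_rep[OF c d]]
        smooth_on_deriv[OF hyp.smooth_rep[OF c d]] | assumption)+
  then show "smooth_on ?U (\<lambda>x. to_coord A d (id (cinv c x)) (xi (cinv c x)))"
  proof (rule smooth_on_cong[OF O, rotated])
    fix x assume "x \<in> ?U"
    then obtain q where q: "q \<in> cdom c" "q \<in> cdom d" "x = cmap c q" by auto
    show "frechet_derivative (cmap d \<circ> id \<circ> cinv c) (at x) (X x) = to_coord A d (id (cinv c x)) (xi (cinv c x))"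
      using hyp.coord_field_chart[OF c q(1) d, of "X x"] q(2)
      by (simp add: q(3) cinv_cmap[OF A c q(1)] hyp.coord_field_id X_def from_to_coord[OF A c q(1)])
  qed
qed

lemma ph3_smooth: "smooth_endo_field A ph3"
  unfolding smooth_endo_field_def Let_def
proof (intro conjI allI ballI)
  show "linear (ph3 p)" for p
    by (rule contact_triple.phi_linear(3)[OF contact_triple])
  fix c v assume c: "c \<in> A"
  show "smooth_on (cmap c ` cdom c) (\<lambda>x. to_coord A c (cinv c x) (ph3 (cinv c x) (from_coord A c (cinv c x) v)))"
  proof (rule smooth_on_metric_dual[OF A gM_metric c, of "\<lambda>q. ph3 q (from_coord A c q v)"])
    fix w
    show "smooth_on (cmap c ` cdom c)
        (\<lambda>x. gM (cinv c x) (ph3 (cinv c x) (from_coord A c (cinv c x) v)) (from_coord A c (cinv c x) w))"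
      using emb.smooth_form3_along[OF psi_form N_smooth[OF c] emb.field_smooth_coord_field[OF c, of v]
          emb.field_smooth_coord_field[OF c, of w] c]
      unfolding gM_ph3 Phi3_def emb.coord_field_def by (simp add: o_def)
  qed
qed

text \<open>The converse in (1) has to produce an almost contact structure, whereas elsewhere it is
  part of the hypothesis on \<phi>.\<close>

lemma almost_contact_ph3: "almost_contact A gM xi ph3"
proof -
  have "gM p (ph3 p u) (ph3 p v) = gM p u v - \<eta> p u * \<eta> p v" for p u v
  proof -
    interpret contact_triple "gM p" "xi p" "ph1 p" "ph2 p" "ph3 p" by (rule contact_triple)
    show ?thesis using sym[of u "xi p"] by (simp add: phi_skew phi_sq glin)
  qed
  then show ?thesis
    unfolding almost_contact_def
    using gM_metric xi_smooth ph3_smooth contact_triple.xi_unit[OF contact_triple] contact_triple.phi_sq(3)[OF contact_triple]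
    by simp
qed

lemma sasakian_ph3:
  assumes S: "\<And>p u. S p u = 0"
  shows "sasakian A gM xi ph3"
  unfolding sasakian_def
proof (intro conjI allI almost_contact_ph3)
  fix p u v
  have phi_comb: "phi_comb (\<lambda>_. 0) (\<lambda>_. 0) (\<lambda>_. 1) = ph3"
    by (intro ext) (simp add: phi_comb_def)
  interpret contact_triple "gM p" "xi p" "ph1 p" "ph2 p" "ph3 p" by (rule contact_triple)
  show "nabla_endo A gM ph3 p u v = \<eta> p v *\<^sub>R u - gM p u v *\<^sub>R xi p"
    using nabla_phi_comb[OF pdiff_const(1) pdiff_const(1) pdiff_const(1), of "0::real" 0 1 p u v] ph3_smooth
    unfolding phi_comb
    by (simp add: pdiff_const(2) S rot_shape_def glin
        linear_0[OF phi_linear(2)] linear_0[OF phi_linear(3)])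
qed

text \<open>The parameter \<epsilon> treats (3) and (4) together: the right-hand sides differ only
  by this factor.\<close>

lemma nearly_imp_constant:
  assumes conn: "connected (UNIV :: 'm set)"
    and abc: "\<And>p. pdiff A p a" "\<And>p. pdiff A p b" "\<And>p. pdiff A p c"
    and one: "\<And>p. (a p)\<^sup>2 + (b p)\<^sup>2 + (c p)\<^sup>2 = 1"
    and sm: "smooth_endo_field A (phi_comb a b c)"
    and nearly: "\<And>p u v. nabla_endo A gM (phi_comb a b c) p u v + nabla_endo A gM (phi_comb a b c) p v u
        = \<epsilon> *\<^sub>R (\<eta> p v *\<^sub>R u + \<eta> p u *\<^sub>R v - (2 * gM p u v) *\<^sub>R xi p)"
  obtains m a' b' c' where "\<And>p u. S p u = m *\<^sub>R u" "a = (\<lambda>p. a')" "b = (\<lambda>p. b')" "c = (\<lambda>p. c')"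
    "a' * m = \<epsilon> - c'" "a'\<^sup>2 + b'\<^sup>2 + c'\<^sup>2 = 1"
proof -
  have "\<exists>\<mu> \<nu>. (\<forall>u. S p u = \<mu> *\<^sub>R u + ((\<nu> - \<mu>) * \<eta> p u) *\<^sub>R xi p) \<and> a p * \<mu> = \<epsilon> - c p
    \<and> (\<forall>u. point_deriv A p a u = 0) \<and> (\<forall>u. point_deriv A p b u = c p * (\<nu> - \<mu>) * \<eta> p u)
    \<and> (\<forall>u. point_deriv A p c u = - b p * (\<nu> - \<mu>) * \<eta> p u)" for p
  proof -
    interpret contact_triple "gM p" "xi p" "ph1 p" "ph2 p" "ph3 p" by (rule contact_triple)
    \<comment> \<open>\<open>L\<close> and \<open>T\<close> are what is left of
      \<open>rot_shape\<close> and of \<nabla>\<phi> after removing the \<epsilon>-part, whose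
      symmetrisation is the prescribed right-hand side, and the alternating wedge terms. The
      condition on \<nabla>\<phi> thus says that \<open>T\<close> is skew.\<close>
    define L where "L u = a p *\<^sub>R S p u - b p *\<^sub>R ph3 p (S p u) + c p *\<^sub>R ph2 p (S p u) + (c p - \<epsilon>) *\<^sub>R u" for u
    define T where "T u v = point_deriv A p a u *\<^sub>R ph1 p v + (point_deriv A p b u - c p * \<eta> p (S p u)) *\<^sub>R ph2 p v
        + (point_deriv A p c u + b p * \<eta> p (S p u)) *\<^sub>R ph3 p v + \<eta> p v *\<^sub>R L u - gM p (L u) v *\<^sub>R xi p" for u v
    have T: "nabla_endo A gM (phi_comb a b c) p u v = T u v + \<epsilon> *\<^sub>R (\<eta> p v *\<^sub>R u - gM p u v *\<^sub>R xi p)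
        + a p *\<^sub>R eta_wedge p ph2 u v - b p *\<^sub>R eta_wedge p ph1 u v" for u v
    proof -
      have "rot_shape a b c p u = L u + \<epsilon> *\<^sub>R u" unfolding L_def rot_shape_def by (simp add: algebra_simps)
      then show ?thesis
        unfolding nabla_phi_comb[OF abc sm] T_def by (simp add: glin algebra_simps)
    qed
    have cyc: "eta_wedge p P u v = - eta_wedge p P v u" if "\<And>u v. gM p (P p u) v = - gM p u (P p v)" for P u v
      unfolding eta_wedge_def using that[of u v] sym[of u "P p v"] by (simp add: algebra_simps)
    have skew: "T u v + T v u = 0" for u v
    proof -
      have "(\<epsilon> * (2 * gM p u v)) *\<^sub>R xi p = (\<epsilon> * gM p u v) *\<^sub>R xi p + (\<epsilon> * gM p v u) *\<^sub>R xi p"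
        using sym[of u v] by (simp flip: scaleR_add_left)
      then show ?thesis
        using nearly[of p u v] cyc[of ph1 u v] cyc[of ph2 u v] phi_skew
        unfolding T by (simp add: scaleR_diff_right scaleR_add_right)
    qed
    show ?thesis
      by (rule nearly_structure[of "S p" "a p" "b p" "c p" "point_deriv A p a" "point_deriv A p b" "point_deriv A p c" T L \<epsilon>])
        (use S_linear S_sym one linear_point_deriv[OF abc(1)] linear_point_deriv[OF abc(2)] linear_point_deriv[OF abc(3)]
          T_def L_def skew in auto)
  qed
  then obtain \<mu> \<nu> where S: "\<And>p u. S p u = \<mu> p *\<^sub>R u + ((\<nu> p - \<mu> p) * \<eta> p u) *\<^sub>R xi p"
    and \<mu>: "\<And>p. a p * \<mu> p = \<epsilon> - c p" and d: "\<And>p u. point_deriv A p a u = 0"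
    "\<And>p u. point_deriv A p b u = c p * (\<nu> p - \<mu> p) * \<eta> p u"
    "\<And>p u. point_deriv A p c u = - b p * (\<nu> p - \<mu> p) * \<eta> p u"
    by metis
  \<comment> \<open>Once the two eigenvalues agree, the formulas for the differentials of
    \<open>b\<close> and \<open>c\<close> also give zero.\<close>
  obtain m where m: "\<And>p. \<mu> p = m" "\<And>p. \<nu> p = m"
    by (rule quasi_umbilical_imp_umbilical[OF conn S]) blast
  have d0: "point_deriv A p b u = 0" "point_deriv A p c u = 0" for p u using d m by simp_all
  obtain a' where a': "\<And>p. a p = a'" using pdiff_constant[OF A conn abc(1) d(1)] by blast
  obtain b' where b': "\<And>p. b p = b'" using pdiff_constant[OF A conn abc(2) d0(1)] by blast
  obtain c' where c': "\<And>p. c p = c'" using pdiff_constant[OF A conn abc(3) d0(2)] by blast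
  show thesis
  proof (rule that)
    show "S p u = m *\<^sub>R u" for p u using S[of p u] m by simp
    show "a' * m = \<epsilon> - c'" "a'\<^sup>2 + b'\<^sup>2 + c'\<^sup>2 = 1"
      using \<mu> one a' b' c' m by metis+
  qed (use a' b' c' in auto)
qed

text \<open>Symmetrising reduces to the nearly case. The part lost by that, the alternating wedge
  terms, is recovered from one further evaluation and fixes \<open>a\<close> and \<open>b\<close> in
  terms of \<open>c\<close> and \<open>m\<close>.\<close>

lemma strict_imp_constant:
  assumes conn: "connected (UNIV :: 'm set)"
    and abc: "\<And>p. pdiff A p a" "\<And>p. pdiff A p b" "\<And>p. pdiff A p c"
    and one: "\<And>p. (a p)\<^sup>2 + (b p)\<^sup>2 + (c p)\<^sup>2 = 1"
    and sm: "smooth_endo_field A (phi_comb a b c)"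
    and strict: "\<And>p u v. nabla_endo A gM (phi_comb a b c) p u v = \<epsilon> *\<^sub>R (\<eta> p v *\<^sub>R u - gM p u v *\<^sub>R xi p)"
  obtains m c' where "\<And>p u. S p u = m *\<^sub>R u" "a = (\<lambda>p. c' * m)" "b = (\<lambda>p. 0)" "c = (\<lambda>p. c')"
    "c' * (1 + m\<^sup>2) = \<epsilon>" "c'\<^sup>2 * (1 + m\<^sup>2) = 1"
proof -
  have "nabla_endo A gM (phi_comb a b c) p u v + nabla_endo A gM (phi_comb a b c) p v u
      = \<epsilon> *\<^sub>R (\<eta> p v *\<^sub>R u + \<eta> p u *\<^sub>R v - (2 * gM p u v) *\<^sub>R xi p)" for p u v
  proof -
    have "(\<epsilon> * (2 * gM p u v)) *\<^sub>R xi p = (\<epsilon> * gM p u v) *\<^sub>R xi p + (\<epsilon> * gM p v u) *\<^sub>R xi p"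
      using inner_form.sym[OF inner_M, of p u v] by (simp flip: scaleR_add_left)
    then show ?thesis unfolding strict by (simp add: scaleR_diff_right scaleR_add_right)
  qed
  from nearly_imp_constant[OF conn abc one sm this]
  obtain m a' b' c' where S: "\<And>p u. S p u = m *\<^sub>R u" and k: "a = (\<lambda>p. a')" "b = (\<lambda>p. b')" "c = (\<lambda>p. c')"
    and m: "a' * m = \<epsilon> - c'" "a'\<^sup>2 + b'\<^sup>2 + c'\<^sup>2 = 1" by metis
  obtain p :: 'm where True by blast
  interpret contact_triple "gM p" "xi p" "ph1 p" "ph2 p" "ph3 p" by (rule contact_triple)
  obtain e where e: "e \<noteq> 0" "\<eta> p e = 0" using exists_orthogonal[OF dim_gt_1] by blast
  \<comment> \<open>The prescribed value at \<xi> and \<open>e\<close> is zero, while each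
    \<open>eta_wedge\<close> reduces there to the image of \<open>e\<close>.\<close>
  have "0 *\<^sub>R e + (- b') *\<^sub>R ph1 p e + (a' - c' * m) *\<^sub>R ph2 p e + (b' * m) *\<^sub>R ph3 p e
      + (- (a' * m + c') * gM p (xi p) e) *\<^sub>R xi p = 0"
    using nabla_phi_comb[OF abc sm, of p "xi p" e, unfolded strict] e
    unfolding k pdiff_const(2) rot_shape_def eta_wedge_def S
    by (simp add: k philin phi_xi xi_unit glin pdiff_const(2) algebra_simps)
  from comb_zero[OF e this] have ab: "b' = 0" "a' = c' * m" by auto
  show thesis
  proof (rule that[OF S])
    show "a = (\<lambda>p. c' * m)" "b = (\<lambda>p. 0)" "c = (\<lambda>p. c')" using k ab by auto
    show "c' * (1 + m\<^sup>2) = \<epsilon>" "c'\<^sup>2 * (1 + m\<^sup>2) = 1"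
      using m unfolding ab by (simp_all add: power2_eq_square algebra_simps)
  qed
qed

end

theorem theorem2:
  fixes A :: "('m::{t2_space, second_countable_topology}, real^5) chart set"
    and B :: "('n::{t2_space, second_countable_topology}, real^6) chart set"
    and gM :: "'m \<Rightarrow> real^5 \<Rightarrow> real^5 \<Rightarrow> real"
    and g :: "'n \<Rightarrow> real^6 \<Rightarrow> real^6 \<Rightarrow> real"
    and J :: "'n \<Rightarrow> real^6 \<Rightarrow> real^6"
    and f :: "'m \<Rightarrow> 'n"
    and N :: "'m \<Rightarrow> real^6"
    and a b c :: "'m \<Rightarrow> real"
    and \<xi> :: "'m \<Rightarrow> real^5"
    and \<eta> :: "'m \<Rightarrow> real^5 \<Rightarrow> real"
    and h :: "'m \<Rightarrow> real^5 \<Rightarrow> real^5 \<Rightarrow> real"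
    and S \<phi>\<^sub>1 \<phi>\<^sub>2 \<phi>\<^sub>3 \<phi> :: "'m \<Rightarrow> real^5 \<Rightarrow> real^5"
  assumes "smooth_atlas A" and "connected (UNIV :: 'm set)"
    and "smooth_atlas B"
    and "strict_nearly_kaehler B g J" and "constant_type_one B g J"
    and "riemannian_metric A gM" and "isometric_immersion A gM B g f"
    and "unit_normal A B g f N"
    and "smooth_fun A a" and "smooth_fun A b" and "smooth_fun A c"
    and "\<And>p. (a p)\<^sup>2 + (b p)\<^sup>2 + (c p)\<^sup>2 = 1"
    and "h = second_fundamental_form A B g f N"
    and "S = shape_operator A B g f N"
    and "\<xi> = reeb A B J f N"
    and "\<eta> = (\<lambda>p. gM p (\<xi> p))"
    and "\<phi>\<^sub>1 = phi1 A gM B J f N"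
    and "\<phi>\<^sub>2 = phi2 A B g J f N"
    and "\<phi>\<^sub>3 = phi3 A B g J f N"
    and "\<phi> = (\<lambda>p u. a p *\<^sub>R \<phi>\<^sub>1 p u + b p *\<^sub>R \<phi>\<^sub>2 p u + c p *\<^sub>R \<phi>\<^sub>3 p u)"
  shows
    "(sasakian A gM \<xi> \<phi> \<longleftrightarrow> (\<forall>p u. S p u = 0) \<and> \<phi> = \<phi>\<^sub>3) \<and>
     \<not> co_kaehler A gM \<xi> \<phi> \<and>
     (nearly_sasakian A gM \<xi> \<phi> \<longrightarrow>
        eta_quasi_umbilical A gM \<xi> h \<and>
        ((\<exists>l::real. \<forall>p u. S p u = u + ((l - 1) * \<eta> p u) *\<^sub>R \<xi> p) \<and> \<phi> = \<phi>\<^sub>1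
         \<or> (\<exists>l::real. \<forall>p u. S p u = l *\<^sub>R u) \<and> \<phi> = \<phi>\<^sub>3
         \<or> (\<exists>t::real. cos t \<noteq> 0 \<and> (\<forall>p u. S p u = (1 / cos t) *\<^sub>R u) \<and>
               \<phi> = (\<lambda>p u. cos t *\<^sub>R \<phi>\<^sub>1 p u + sin t *\<^sub>R \<phi>\<^sub>2 p u))
         \<or> (\<forall>p. a p \<noteq> 0 \<and> c p \<noteq> 0) \<and> (\<exists>k. \<forall>p. a p = k) \<and>
            (\<forall>p u. S p u = ((1 - c p) / a p) *\<^sub>R u
                        + (1 / c p * point_deriv A p b (\<xi> p) * \<eta> p u) *\<^sub>R \<xi> p) \<and>
            (\<forall>p u. \<eta> p u = 0 \<longrightarrow> point_deriv A p b u = 0 \<and> point_deriv A p c u = 0))) \<and>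
     (nearly_cosymplectic A gM \<xi> \<phi> \<longrightarrow>
        eta_quasi_umbilical A gM \<xi> h \<and>
        ((\<exists>l::real. \<forall>p u. S p u = l *\<^sub>R u) \<and> (\<phi> = \<phi>\<^sub>2 \<or> \<phi> = (\<lambda>p u. - \<phi>\<^sub>2 p u))
         \<or> (\<exists>l::real. \<forall>p u. S p u = (l * \<eta> p u) *\<^sub>R \<xi> p) \<and> \<phi> = \<phi>\<^sub>1
         \<or> (\<forall>p u. S p u = 0) \<and>
            (\<exists>t::real. \<phi> = (\<lambda>p u. cos t *\<^sub>R \<phi>\<^sub>1 p u + sin t *\<^sub>R \<phi>\<^sub>2 p u))
         \<or> (\<forall>p. a p \<noteq> 0 \<and> c p \<noteq> 0) \<and> (\<exists>k. \<forall>p. a p = k) \<and>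
            (\<forall>p u. S p u = (- (c p / a p)) *\<^sub>R u
                        + (1 / c p * point_deriv A p b (\<xi> p) * \<eta> p u) *\<^sub>R \<xi> p) \<and>
            (\<forall>p u. \<eta> p u = 0 \<longrightarrow> point_deriv A p b u = 0 \<and> point_deriv A p c u = 0)))"
    (is "?sas \<and> ?coK \<and> (?nS \<longrightarrow> _ \<and> ?nSc) \<and> (?nC \<longrightarrow> _ \<and> ?nCc)")
proof -
  interpret M: nk_hypersurface B g J A gM f N
    by unfold_locales (use assms in \<open>auto simp: strict_nearly_kaehler_def\<close>)
  note conn = assms(2) and one = assms(12)
  have abc: "pdiff A p a" "pdiff A p b" "pdiff A p c" for p
    using assms(9,10,11) smooth_fun_pdiff[OF M.A] by blast+
  have phi_comb: "\<phi> = M.phi_comb a b c"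
    unfolding assms(20) assms(17-19) by (intro ext) (simp add: M.phi_comb_def)
  have smooth: "smooth_endo_field A (M.phi_comb a b c)" if "almost_contact A gM \<xi> \<phi>"
    using that unfolding almost_contact_def phi_comb by blast
  have umbilical: "eta_quasi_umbilical A gM \<xi> h" if S: "\<And>p u. S p u = m *\<^sub>R u" for m
    unfolding eta_quasi_umbilical_def
  proof (intro exI conjI allI)
    show "smooth_fun A (\<lambda>p. m)" "smooth_fun A (\<lambda>p. 0)"
      unfolding smooth_fun_def by (simp_all add: o_def smooth_on_const)
    show "h p u v = m * gM p u v + 0 * (gM p (\<xi> p) u * gM p (\<xi> p) v)" for p u v
      using M.gM_S[of p u v] S[of p u] unfolding assms(13,14) by (simp add: M.gMlin)
  qed
  have circle: "\<exists>t. x = cos t \<and> y = sin t" if "x\<^sup>2 + y\<^sup>2 = 1" for x y :: real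
    using sincos_total_2pi[OF that] by metis
  have sas: ?sas
  proof
    assume s: "sasakian A gM \<xi> \<phi>"
    have "nabla_endo A gM (M.phi_comb a b c) p u v = 1 *\<^sub>R (M.\<eta> p v *\<^sub>R u - gM p u v *\<^sub>R M.xi p)" for p u v
      using s unfolding sasakian_def phi_comb assms(15) by simp
    from M.strict_imp_constant[OF conn abc one smooth this]
    obtain m c' where S: "\<And>p u. M.S p u = m *\<^sub>R u" and k: "a = (\<lambda>p. c' * m)" "b = (\<lambda>p. 0)" "c = (\<lambda>p. c')"
      and m: "c' * (1 + m\<^sup>2) = 1" "c'\<^sup>2 * (1 + m\<^sup>2) = 1" using s unfolding sasakian_def by metis
    \<comment> \<open>Dividing the second relation by the first.\<close>
    have c': "c' = 1" using m by (simp add: power2_eq_square mult.assoc)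
    then have "m = 0" using m by simp
    then show "(\<forall>p u. S p u = 0) \<and> \<phi> = \<phi>\<^sub>3"
      using S c' unfolding assms(14,20) k by simp
  next
    assume "(\<forall>p u. S p u = 0) \<and> \<phi> = \<phi>\<^sub>3"
    then show "sasakian A gM \<xi> \<phi>"
      using M.sasakian_ph3 unfolding assms(14,15,19) by simp
  qed
  have coK: ?coK
  proof
    assume s: "co_kaehler A gM \<xi> \<phi>"
    have "nabla_endo A gM (M.phi_comb a b c) p u v = 0 *\<^sub>R (M.\<eta> p v *\<^sub>R u - gM p u v *\<^sub>R M.xi p)" for p u v
      using s unfolding co_kaehler_def phi_comb by simp
    from M.strict_imp_constant[OF conn abc one smooth this]
    obtain m c' :: real where m: "c' * (1 + m\<^sup>2) = 0" "c'\<^sup>2 * (1 + m\<^sup>2) = 1"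
      using s unfolding co_kaehler_def by metis
    then have "c' * (c' * (1 + m\<^sup>2)) = 1" by (simp add: power2_eq_square mult.assoc)
    then show False unfolding m(1) by simp
  qed
  have nS: "eta_quasi_umbilical A gM \<xi> h \<and> ?nSc" if s: ?nS
  proof -
    have "nabla_endo A gM (M.phi_comb a b c) p u v + nabla_endo A gM (M.phi_comb a b c) p v u
        = 1 *\<^sub>R (M.\<eta> p v *\<^sub>R u + M.\<eta> p u *\<^sub>R v - (2 * gM p u v) *\<^sub>R M.xi p)" for p u v
      using s unfolding nearly_sasakian_def phi_comb assms(15) by simp
    from M.nearly_imp_constant[OF conn abc one smooth this]
    obtain m a' b' c' where S: "\<And>p u. S p u = m *\<^sub>R u" and k: "a = (\<lambda>p. a')" "b = (\<lambda>p. b')" "c = (\<lambda>p. c')"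
      and m: "a' * m = 1 - c'" "a'\<^sup>2 + b'\<^sup>2 + c'\<^sup>2 = 1"
      using s unfolding nearly_sasakian_def assms(14) by metis
    consider "a' = 0" | "a' \<noteq> 0" "c' = 0" | "a' \<noteq> 0" "c' \<noteq> 0" by blast
    then have ?nSc
    proof cases
      case 1
      then have "c' = 1" "b' = 0" using m by auto
      then have "\<phi> = \<phi>\<^sub>3" using 1 unfolding assms(20) k by simp
      then show ?thesis using S by blast
    next
      case 2
      \<comment> \<open>With \<open>c' = 0\<close> the point (a', b') lies on the unit circle and
        \<open>a' * m = 1\<close>; this is family (c).\<close>
      obtain t where t: "a' = cos t" "b' = sin t" using circle[of a' b'] m 2 by auto
      have "\<phi> = (\<lambda>p u. cos t *\<^sub>R \<phi>\<^sub>1 p u + sin t *\<^sub>R \<phi>\<^sub>2 p u)" unfolding assms(20) k t 2 by simp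
      moreover have "cos t \<noteq> 0" "m = 1 / cos t" using 2 m t by (auto simp: field_simps)
      ultimately show ?thesis using S by blast
    next
      case 3
      \<comment> \<open>Family (d), in which the term with \<xi>(b) is zero because \<open>b\<close>
        is constant.\<close>
      then have "m = (1 - c') / a'" using m by (simp add: field_simps)
      then show ?thesis using 3 S unfolding k pdiff_const(2) by simp
    qed
    then show ?thesis using umbilical[OF S] by blast
  qed
  have nC: "eta_quasi_umbilical A gM \<xi> h \<and> ?nCc" if s: ?nC
  proof -
    have "nabla_endo A gM (M.phi_comb a b c) p u v + nabla_endo A gM (M.phi_comb a b c) p v u
        = 0 *\<^sub>R (M.\<eta> p v *\<^sub>R u + M.\<eta> p u *\<^sub>R v - (2 * gM p u v) *\<^sub>R M.xi p)" for p u v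
      using s unfolding nearly_cosymplectic_def phi_comb by simp
    from M.nearly_imp_constant[OF conn abc one smooth this]
    obtain m a' b' c' where S: "\<And>p u. S p u = m *\<^sub>R u" and k: "a = (\<lambda>p. a')" "b = (\<lambda>p. b')" "c = (\<lambda>p. c')"
      and m: "a' * m = 0 - c'" "a'\<^sup>2 + b'\<^sup>2 + c'\<^sup>2 = 1"
      using s unfolding nearly_cosymplectic_def assms(14) by metis
    consider "a' = 0" | "a' \<noteq> 0" "c' = 0" | "a' \<noteq> 0" "c' \<noteq> 0" by blast
    then have ?nCc
    proof cases
      case 1
      \<comment> \<open>Only b^2 = 1 is known here, which is why both signs of
        \<open>\<phi>\<^sub>2\<close> occur in family (a).\<close>
      then have "c' = 0" "b' = 1 \<or> b' = -1" using m by (auto simp: power2_eq_1_iff)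
      then have "\<phi> = \<phi>\<^sub>2 \<or> \<phi> = (\<lambda>p u. - \<phi>\<^sub>2 p u)" using 1 unfolding assms(20) k by auto
      then show ?thesis using S by blast
    next
      case 2
      obtain t where t: "a' = cos t" "b' = sin t" using circle[of a' b'] m 2 by auto
      have "\<phi> = (\<lambda>p u. cos t *\<^sub>R \<phi>\<^sub>1 p u + sin t *\<^sub>R \<phi>\<^sub>2 p u)" unfolding assms(20) k t 2 by simp
      moreover have "m = 0" using 2 m by simp
      ultimately show ?thesis using S by auto
    next
      case 3
      then have "m = - (c' / a')" using m by (simp add: field_simps)
      then show ?thesis using 3 S unfolding k pdiff_const(2) by simp
    qed
    then show ?thesis using umbilical[OF S] by blast
  qed
  show ?thesis using sas coK nS nC by blast
qed

end
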